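(* Let $0\leq\alpha<4$, and let $\tau>0$ and $\sigma>0$ be any two positive constants. Put $\beta_{\alpha}=\left(1-\frac{\alpha}{4}\right)32\pi^{2}$. Then for all $0\leq\beta\leq\beta_{\alpha}$, $$\sup_{u\in W^{2,2}(\mathbb{R}^{4}),\ \int_{\mathbb{R}^{4}}\left(|\Delta u|^{2}+\tau|\nabla u|^{2}+\sigma|u|^{2}\right)dx\leq1}\ \int_{\mathbb{R}^{4}}\frac{e^{\beta u^{2}}-1}{|x|^{\alpha}}\,dx<\infty.$$ Moreover, when $\beta>\beta_{\alpha}$, the supremum is infinite.
   Context: $W^{2,2}(\mathbb{R}^4)$ is the usual Sobolev space of real-valued functions; $\nabla$ is the gradient and $\Delta$ the Laplacian. *)

theory Defs
  imports "HOL-Analysis.Analysis"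
begin

definition pderiv_at :: "'n::finite \<Rightarrow> (real^'n \<Rightarrow> real) \<Rightarrow> real^'n \<Rightarrow> real" where
  "pderiv_at i f x = frechet_derivative f (at x) (axis i 1)"

text \<open>Multi-indices are lists of coordinate indices: \<open>pderivs [i, j] f\<close> is the partial derivative of
  \<open>f\<close> in the \<open>j\<close>-th and then in the \<open>i\<close>-th variable. The order of differentiation is the length.\<close>

definition pderivs :: "'n::finite list \<Rightarrow> (real^'n \<Rightarrow> real) \<Rightarrow> real^'n \<Rightarrow> real" where
  "pderivs js f = foldr pderiv_at js f"

text \<open>All iterated partial derivatives exist and are (totally) differentiable, hence also
  continuous; this is \<open>C\<^sup>\<infinity>\<close> smoothness.\<close>

definition smooth :: "(real^'n::finite \<Rightarrow> real) \<Rightarrow> bool" where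
  "smooth f \<longleftrightarrow> (\<forall>js x. pderivs js f differentiable (at x))"

definition test_function :: "(real^'n::finite \<Rightarrow> real) \<Rightarrow> bool" where
  "test_function \<phi> \<longleftrightarrow> smooth \<phi> \<and> compact (closure {x. \<phi> x \<noteq> 0})"

definition locally_integrable :: "(real^'n::finite \<Rightarrow> real) \<Rightarrow> bool" where
  "locally_integrable f \<longleftrightarrow>
     f \<in> borel_measurable lebesgue \<and> (\<forall>K. compact K \<longrightarrow> set_integrable lebesgue K f)"

definition has_weak_deriv ::
    "'n::finite list \<Rightarrow> (real^'n \<Rightarrow> real) \<Rightarrow> (real^'n \<Rightarrow> real) \<Rightarrow> bool" where
  "has_weak_deriv js u v \<longleftrightarrow> locally_integrable u \<and> locally_integrable v \<and>
     (\<forall>\<phi>. test_function \<phi> \<longrightarrow>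
        (LINT x|lebesgue. u x * pderivs js \<phi> x) =
        (- 1) ^ length js * (LINT x|lebesgue. v x * \<phi> x))"

text \<open>Weak derivatives are unique up to null sets; \<open>wderiv\<close> picks a representative.\<close>

definition wderiv :: "'n::finite list \<Rightarrow> (real^'n \<Rightarrow> real) \<Rightarrow> real^'n \<Rightarrow> real" where
  "wderiv js u = (SOME v. has_weak_deriv js u v)"

definition Lp_fun :: "real \<Rightarrow> (real^'n::finite \<Rightarrow> real) \<Rightarrow> bool" where
  "Lp_fun p f \<longleftrightarrow>
     f \<in> borel_measurable lebesgue \<and> integrable lebesgue (\<lambda>x. \<bar>f x\<bar> powr p)"

text \<open>The Sobolev space \<open>W\<^sup>k\<^sup>,\<^sup>p\<close> on the whole space, as a set of functions rather than of
  almost-everywhere classes.\<close>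

definition sobolev :: "nat \<Rightarrow> real \<Rightarrow> (real^'n::finite \<Rightarrow> real) set" where
  "sobolev k p = {u. Lp_fun p u \<and>
     (\<forall>js. length js \<le> k \<longrightarrow> (\<exists>v. has_weak_deriv js u v \<and> Lp_fun p v))}"

definition weak_grad :: "(real^'n::finite \<Rightarrow> real) \<Rightarrow> real^'n \<Rightarrow> real^'n" where
  "weak_grad u x = (\<chi> i. wderiv [i] u x)"

definition weak_laplacian :: "(real^'n::finite \<Rightarrow> real) \<Rightarrow> real^'n \<Rightarrow> real" where
  "weak_laplacian u x = (\<Sum>i\<in>UNIV. wderiv [i, i] u x)"

definition adams_energy :: "real \<Rightarrow> real \<Rightarrow> (real^'n::finite \<Rightarrow> real) \<Rightarrow> ennreal" where
  "adams_energy \<tau> \<sigma> u =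
     (\<integral>\<^sup>+x. ennreal (\<bar>weak_laplacian u x\<bar>\<^sup>2 + \<tau> * (norm (weak_grad u x))\<^sup>2 + \<sigma> * \<bar>u x\<bar>\<^sup>2)
        \<partial>lebesgue)"

text \<open>The integrand takes a conventional value at the origin, a null set.\<close>

definition adams_integral :: "real \<Rightarrow> real \<Rightarrow> (real^'n::finite \<Rightarrow> real) \<Rightarrow> ennreal" where
  "adams_integral \<alpha> \<beta> u =
     (\<integral>\<^sup>+x. ennreal ((exp (\<beta> * (u x)\<^sup>2) - 1) / norm x powr \<alpha>) \<partial>lebesgue)"

definition beta_crit :: "real \<Rightarrow> real" where
  "beta_crit \<alpha> = (1 - \<alpha> / 4) * (32 * pi\<^sup>2)"

end

theory Submission
  imports Defs
begin

text \<open>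
  Upper bound. Put \<open>f = \<Delta>u\<close>. Testing this equation with a truncated Newtonian kernel bounds the averages of
  \<open>\<bar>u\<bar>\<close> over level sets by those of \<open>N * \<bar>f\<bar> + C (1\<^sub>B * \<bar>u\<bar>)\<close>, where \<open>B\<close> is the unit ball and
  \<open>N(x) = 1\<^sub>B(x) / (4\<pi>\<^sup>2\<bar>x\<bar>\<^sup>2)\<close>. For a set \<open>E\<close> of finite measure let \<open>k\<^sub>E = (N * 1\<^sub>E) / \<bar>E\<bar>\<close>. Because
  \<open>(N * N)(x) \<le> log(1/\<bar>x\<bar>) / (8\<pi>\<^sup>2) + C\<close>, these functions satisfy
  \<open>32\<pi>\<^sup>2 \<langle>k\<^sub>E, k\<^sub>F\<rangle> \<le> log(1 / max \<bar>E\<bar> \<bar>F\<bar>) + C\<close>, so their Gram matrix is dominated by that of the indicators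
  of \<open>[0, T\<^sub>E]\<close> with \<open>T\<^sub>E = log(1/\<bar>E\<bar>) + C\<close>. Cauchy-Schwarz with \<open>k\<^sub>E + k\<^sub>F\<close> for the level sets
  \<open>E = {32\<pi>\<^sup>2u\<^sup>2 > i}\<close> and \<open>F = {32\<pi>\<^sup>2u\<^sup>2 > k}\<close>, \<open>i \<le> k\<close>, gives \<open>(\<surd>i + \<surd>k)\<^sup>2 \<le> 3T\<^sub>i + T\<^sub>k\<close>. Hence
  \<open>T\<^sub>k \<ge> k\<close>, and only \<open>O(L)\<close> levels satisfy \<open>T\<^sub>k \<le> k + L\<close>. With \<open>\<theta> = 1 - \<alpha>/4\<close> the sum of
  \<open>exp(\<theta>(k - T\<^sub>k))\<close> is therefore bounded, and it controls the critical integral since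
  \<open>\<integral>\<^sub>E \<bar>x\<bar>\<^sup>-\<^sup>\<alpha> \<le> C \<bar>E\<bar>\<^sup>\<theta>\<close>. No rearrangement is needed, and the gradient term of the energy can be dropped.

  Lower bound. The functions \<open>\<eta>(x) log(1 / (\<bar>x\<bar>\<^sup>2 + d))\<close> with a smooth cutoff \<open>\<eta>\<close>, divided by the square
  root of their energy \<open>16\<pi>\<^sup>2 log(1/d) (1 + o(1))\<close>, concentrate at the origin as \<open>d\<close> tends to \<open>0\<close>.
\<close>

section \<open>Smooth functions\<close>

text \<open>At the critical exponent the inequality for one level, \<open>T_k >= k\<close>, bounds
  each summand exp(\<theta>(k - T_k)) by 1 but not their sum. The second level supplies what is
  missing: were two distant levels both nearly extremal, \<open>k_E\<close> and \<open>k_F\<close>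
  would both be nearly parallel to f, and their Gram matrix forbids this.

  The value 32 pi^2 comes from the Green function log(1/|x|)/(8 pi^2) of the squared Laplacian on
  R^4, since log(1/|x|) averages to log(1/|E|)/4 up to a constant on a ball E. Lower-order terms may
  shift T only by an additive constant; any loss in the factor of log(1/|E|) would lose the
  endpoint. Hence the error from truncating the kernel has to be bounded, uniformly in the
  regularisation; the term \<sigma>|u|^2 of the energy then pays for it.

  Minus the Laplacian of the regularised kernel 1/(4 pi^2 (|x|^2 + e)) is (2e/pi^2)/(|x|^2 + e)^3,
  an approximate identity. One test function thus gives both the potential estimate and the
  mollifier. The same mollifier proves uniqueness of weak derivatives, without which the energy of
  the concentrating functions could not be computed.\<close>

definition smooth_upto :: "nat \<Rightarrow> (real^'n::finite \<Rightarrow> real) \<Rightarrow> bool" where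
  "smooth_upto n f \<longleftrightarrow> (\<forall>js x. length js < n \<longrightarrow> pderivs js f differentiable (at x))"

lemma smooth_iff_smooth_upto: "smooth f \<longleftrightarrow> (\<forall>n. smooth_upto n f)"
  unfolding smooth_def smooth_upto_def by auto

lemma pderivs_Nil [simp]: "pderivs [] f = f"
  by (simp add: pderivs_def)

lemma pderivs_Cons: "pderivs (i # js) f = pderiv_at i (pderivs js f)"
  by (simp add: pderivs_def)

lemma pderivs_append: "pderivs (is @ js) f = pderivs is (pderivs js f)"
  by (simp add: pderivs_def)

lemma pderivs_snoc: "pderivs (js @ [i]) f = pderivs js (pderiv_at i f)"
  by (simp add: pderivs_def)

lemma smooth_upto_0 [simp]: "smooth_upto 0 f"
  by (simp add: smooth_upto_def)

text \<open>\<open>pderivs\<close> adds new derivatives on the outside, while the product and chain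
  rules act on the innermost one. Splitting off the last list entry gives a recursion in the order,
  on which the closure proofs below run by induction.\<close>

lemma smooth_upto_Suc:
  "smooth_upto (Suc n) f \<longleftrightarrow> (\<forall>x. f differentiable (at x)) \<and> (\<forall>i. smooth_upto n (pderiv_at i f))"
proof
  assume f: "smooth_upto (Suc n) f"
  have "pderivs js (pderiv_at i f) differentiable at x" if "length js < n" for js i x
    using f that unfolding smooth_upto_def pderivs_snoc[symmetric] by (metis length_append_singleton Suc_less_eq)
  moreover have "f differentiable at x" for x
    using f[unfolded smooth_upto_def, rule_format, of "[]" x] by simp
  ultimately show "(\<forall>x. f differentiable (at x)) \<and> (\<forall>i. smooth_upto n (pderiv_at i f))"
    unfolding smooth_upto_def by blast
next
  assume f: "(\<forall>x. f differentiable (at x)) \<and> (\<forall>i. smooth_upto n (pderiv_at i f))"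
  have "pderivs js f differentiable at x" if "length js < Suc n" for js x
  proof (cases js rule: rev_cases)
    case Nil
    then show ?thesis using f by simp
  next
    case (snoc ks i)
    then show ?thesis using f that by (simp add: pderivs_snoc smooth_upto_def)
  qed
  then show "smooth_upto (Suc n) f" unfolding smooth_upto_def by blast
qed

lemma smooth_upto_SucD: "smooth_upto (Suc n) f \<Longrightarrow> smooth_upto n f"
  unfolding smooth_upto_def by auto

lemma smooth_uptoI:
  assumes "\<And>x. f differentiable (at x)" "\<And>i. smooth_upto n (pderiv_at i f)"
  shows "smooth_upto (Suc n) f"
  using assms by (simp add: smooth_upto_Suc)

lemma pderiv_at_eqI: "(f has_derivative f') (at x) \<Longrightarrow> pderiv_at i f x = f' (axis i 1)"
  unfolding pderiv_at_def using frechet_derivative_at by metis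

lemma differentiable_has_derivative:
  "f differentiable (at x) \<Longrightarrow> (f has_derivative frechet_derivative f (at x)) (at x)"
  by (simp add: frechet_derivative_works)

lemma pderiv_at_const [simp]: "pderiv_at i (\<lambda>x. c) = (\<lambda>x. 0)"
  by (rule ext, subst pderiv_at_eqI[OF has_derivative_const]) simp

lemma pderiv_at_component:
  "pderiv_at i (\<lambda>x::real^'n::finite. x $ j) = (\<lambda>x. if i = j then 1 else 0)"
proof
  fix x :: "real^'n"
  have "((\<lambda>x. x $ j) has_derivative (\<lambda>x. x $ j)) (at x)"
    by (intro bounded_linear_imp_has_derivative bounded_linear_vec_nth)
  from pderiv_at_eqI[OF this] show "pderiv_at i (\<lambda>x. x $ j) x = (if i = j then 1 else 0)"
    by (simp add: axis_def)
qed

lemma pderiv_at_add: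
  assumes "\<And>x. f differentiable (at x)" "\<And>x. g differentiable (at x)"
  shows "pderiv_at i (\<lambda>x. f x + g x) = (\<lambda>x. pderiv_at i f x + pderiv_at i g x)"
proof
  fix x
  show "pderiv_at i (\<lambda>x. f x + g x) x = pderiv_at i f x + pderiv_at i g x"
    using pderiv_at_eqI[OF has_derivative_add[OF assms[THEN differentiable_has_derivative]], of i]
    by (simp add: pderiv_at_def)
qed

lemma pderiv_at_mult:
  assumes "\<And>x. f differentiable (at x)" "\<And>x. g differentiable (at x)"
  shows "pderiv_at i (\<lambda>x. f x * g x) = (\<lambda>x. f x * pderiv_at i g x + pderiv_at i f x * g x)"
proof
  fix x
  show "pderiv_at i (\<lambda>x. f x * g x) x = f x * pderiv_at i g x + pderiv_at i f x * g x"
    using pderiv_at_eqI[OF has_derivative_mult[OF assms[THEN differentiable_has_derivative]], of i]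
    by (simp add: pderiv_at_def)
qed

lemma has_derivative_real_compose:
  fixes q :: "real^'n::finite \<Rightarrow> real"
  assumes "(F has_real_derivative F') (at (q x))" "q differentiable (at x)"
  shows "((\<lambda>x. F (q x)) has_derivative (\<lambda>h. F' * frechet_derivative q (at x) h)) (at x)"
  using has_derivative_compose[OF differentiable_has_derivative[OF assms(2)]
      has_field_derivative_imp_has_derivative[OF assms(1)]] .

lemma pderiv_at_compose:
  fixes q :: "real^'n::finite \<Rightarrow> real"
  assumes "\<And>x. (F has_real_derivative F' (q x)) (at (q x))" "\<And>x. q differentiable (at x)"
  shows "pderiv_at i (\<lambda>x. F (q x)) = (\<lambda>x. F' (q x) * pderiv_at i q x)"
proof
  fix x
  show "pderiv_at i (\<lambda>x. F (q x)) x = F' (q x) * pderiv_at i q x"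
    using pderiv_at_eqI[OF has_derivative_real_compose[of F "F' (q x)" q x], of i] assms
    by (simp add: pderiv_at_def)
qed

lemma differentiable_real_compose:
  fixes q :: "real^'n::finite \<Rightarrow> real"
  assumes "(F has_real_derivative F') (at (q x))" "q differentiable (at x)"
  shows "(\<lambda>x. F (q x)) differentiable (at x)"
  using has_derivative_real_compose[OF assms] unfolding differentiable_def by blast

lemma smooth_upto_const: "smooth_upto n (\<lambda>x. c)"
  by (induction n arbitrary: c) (auto intro!: smooth_uptoI)

lemma smooth_upto_add:
  "smooth_upto n f \<Longrightarrow> smooth_upto n g \<Longrightarrow> smooth_upto n (\<lambda>x. f x + g x)"
  by (induction n arbitrary: f g) (auto simp: smooth_upto_Suc pderiv_at_add)

lemma smooth_upto_mult:
  "smooth_upto n f \<Longrightarrow> smooth_upto n g \<Longrightarrow> smooth_upto n (\<lambda>x. f x * g x)"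
proof (induction n arbitrary: f g)
  case (Suc n)
  show ?case
    using Suc.prems
    by (intro smooth_uptoI, simp add: smooth_upto_Suc differentiable_mult,
        subst pderiv_at_mult) 
       (auto simp: smooth_upto_Suc intro!: smooth_upto_add Suc.IH smooth_upto_SucD[OF Suc.prems(1)]
          smooth_upto_SucD[OF Suc.prems(2)])
qed simp

text \<open>The chain rule for a whole family \<open>D k\<close>, because the derivative of one
  member may involve other members. The second hypothesis says that \<open>D'\<close> is built from
  the family without loss of order; the induction then gains one order for all k at once.
  Reciprocals form a one-member family, the flat exponentials a family indexed by n.\<close>

lemma smooth_upto_compose:
  fixes q :: "real^'n::finite \<Rightarrow> real"
  assumes "\<And>k x. (D k has_real_derivative D' k (q x)) (at (q x))"
    and "\<And>n k. smooth_upto n q \<Longrightarrow> (\<And>k. smooth_upto n (\<lambda>x. D k (q x))) \<Longrightarrow> smooth_upto n (\<lambda>x. D' k (q x))"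
    and "smooth_upto n q"
  shows "smooth_upto n (\<lambda>x. D k (q x))"
  using assms(3)
proof (induction n arbitrary: k)
  case (Suc n)
  note q = Suc.prems[unfolded smooth_upto_Suc]
  have "smooth_upto n q" by (rule smooth_upto_SucD[OF Suc.prems])
  then have "smooth_upto n (\<lambda>x. D' k (q x) * pderiv_at i q x)" for i
    using q Suc.IH by (intro smooth_upto_mult assms(2)) auto
  then show ?case
    using q by (intro smooth_uptoI differentiable_real_compose[OF assms(1)])
       (auto simp: pderiv_at_compose[of "D k" "D' k" q, OF assms(1)])
qed simp

lemma smooth_imp_differentiable: "smooth f \<Longrightarrow> f differentiable (at x)"
  by (metis pderivs_Nil smooth_def)

lemma smooth_imp_continuous_on: "smooth f \<Longrightarrow> continuous_on S f"
  by (meson differentiable_imp_continuous_on differentiable_on_def differentiable_at_withinI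
      smooth_imp_differentiable)

lemma smooth_pderivs: "smooth f \<Longrightarrow> smooth (pderivs js f)"
  unfolding smooth_def pderivs_append[symmetric] by blast

lemma smooth_pderiv_at: "smooth f \<Longrightarrow> smooth (pderiv_at i f)"
  using smooth_pderivs[of f "[i]"] by (simp add: pderivs_Cons)

lemma smooth_const: "smooth (\<lambda>x. c)"
  by (simp add: smooth_iff_smooth_upto smooth_upto_const)

lemma smooth_component: "smooth (\<lambda>x::real^'n::finite. x $ i)"
proof -
  have "smooth_upto (Suc n) (\<lambda>x::real^'n. x $ i)" for n
    by (intro smooth_uptoI bounded_linear_imp_differentiable bounded_linear_vec_nth)
      (simp add: pderiv_at_component smooth_upto_const)
  then show ?thesis unfolding smooth_iff_smooth_upto using smooth_upto_SucD by blast
qed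

lemma smooth_add: "smooth f \<Longrightarrow> smooth g \<Longrightarrow> smooth (\<lambda>x. f x + g x)"
  by (simp add: smooth_iff_smooth_upto smooth_upto_add)

lemma smooth_mult: "smooth f \<Longrightarrow> smooth g \<Longrightarrow> smooth (\<lambda>x. f x * g x)"
  by (simp add: smooth_iff_smooth_upto smooth_upto_mult)

lemma smooth_diff: 
  assumes "smooth f" "smooth g" shows "smooth (\<lambda>x. f x - g x)"
  using smooth_add[OF assms(1) smooth_mult[OF smooth_const[of "-1"] assms(2)]] by simp

lemma smooth_power: "smooth f \<Longrightarrow> smooth (\<lambda>x. f x ^ n)"
  by (induction n) (simp_all add: smooth_const smooth_mult)

lemma smooth_sum: "(\<And>i. i \<in> A \<Longrightarrow> smooth (f i)) \<Longrightarrow> smooth (\<lambda>x. \<Sum>i\<in>A. f i x)"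
  by (induction A rule: infinite_finite_induct) (simp_all add: smooth_const smooth_add)

section \<open>Reciprocals, logarithms and flat exponentials of smooth functions\<close>

lemma smooth_inverse:
  fixes q :: "real^'n::finite \<Rightarrow> real"
  assumes "smooth q" "\<And>x. q x > 0"
  shows "smooth (\<lambda>x. inverse (q x))"
  unfolding smooth_iff_smooth_upto
proof
  fix n
  have 1: "(inverse has_real_derivative - 1 * (inverse (q x) * inverse (q x))) (at (q x))" for x
    using assms(2)[of x] by (auto intro!: derivative_eq_intros simp: power2_eq_square divide_simps)
  have 2: "smooth_upto n (\<lambda>x. - 1 * (inverse (q x) * inverse (q x)))"
    if "smooth_upto n (\<lambda>x. inverse (q x))" for n
    by (intro smooth_upto_mult smooth_upto_const that)
  show "smooth_upto n (\<lambda>x. inverse (q x))"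
    using smooth_upto_compose[of "\<lambda>_::unit. inverse" "\<lambda>_ y. - 1 * (inverse y * inverse y)" q n "()"]
      1 2 assms(1) unfolding smooth_iff_smooth_upto by blast
qed

text \<open>The logarithm leaves its own family under differentiation, but a single derivative turns
  it into a reciprocal, which is already settled.\<close>

lemma smooth_ln:
  fixes q :: "real^'n::finite \<Rightarrow> real"
  assumes q: "smooth q" "\<And>x. q x > 0"
  shows "smooth (\<lambda>x. ln (q x))"
proof -
  have d: "(ln has_real_derivative inverse (q x)) (at (q x))" for x
    using q(2)[of x] by (auto intro!: derivative_eq_intros simp: divide_simps)
  have "smooth_upto (Suc n) (\<lambda>x. ln (q x))" for n
  proof (rule smooth_uptoI)
    show "(\<lambda>x. ln (q x)) differentiable at x" for x
      by (rule differentiable_real_compose[OF d smooth_imp_differentiable[OF q(1)]])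
    show "smooth_upto n (pderiv_at i (\<lambda>x. ln (q x)))" for i
      using smooth_mult[OF smooth_inverse[OF q] smooth_pderiv_at[OF q(1)]]
      by (simp add: pderiv_at_compose[of ln inverse q, OF d smooth_imp_differentiable[OF q(1)]]
          smooth_iff_smooth_upto)
  qed
  then show ?thesis unfolding smooth_iff_smooth_upto using smooth_upto_SucD by blast
qed

text \<open>The family is closed under differentiation, which makes all its members smooth.\<close>

definition flat_exp :: "nat \<Rightarrow> real \<Rightarrow> real" where
  "flat_exp n t = (if t > 0 then exp (- (1 / t)) / t ^ n else 0)"

lemma flat_exp_nonneg [simp]: "flat_exp n t \<ge> 0"
  by (simp add: flat_exp_def)

text \<open>One term of the exponential series, (1/t)^(n+2)/(n+2)! <= exp(1/t), suffices. The
  quadratic decay makes the derivative at 0 vanish and later bounds the derivatives of the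
  cutoff.\<close>

lemma flat_exp_le: "flat_exp n t \<le> fact (n + 2) * t\<^sup>2"
proof (cases "t > 0")
  case True
  have "sum (\<lambda>k. inverse (fact k) * (1 / t) ^ k) {n+2} \<le> (\<Sum>k. inverse (fact k) * (1 / t) ^ k)"
    by (rule sum_le_suminf[OF summable_exp]) (use True in auto)
  then have "inverse (fact (n + 2)) * (1 / t) ^ (n + 2) \<le> exp (1 / t)"
    by (simp add: exp_def field_simps del: fact_Suc)
  then have "fact (n + 2) * (inverse (fact (n + 2)) * (1 / t) ^ (n + 2)) \<le> fact (n + 2) * exp (1 / t)"
    by (rule mult_left_mono) simp
  then have "(1 / t) ^ (n + 2) \<le> fact (n + 2) * exp (1 / t)"
    by (simp add: mult.assoc[symmetric] del: fact_Suc power_Suc)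
  then have "exp (- (1/t)) / t ^ n \<le> fact (n + 2) * t\<^sup>2"
    using True by (simp add: exp_minus field_simps power_add power2_eq_square del: fact_Suc)
  then show ?thesis using True by (simp add: flat_exp_def del: fact_Suc)
next
  case False
  then show ?thesis by (simp add: flat_exp_def del: fact_Suc)
qed

lemma flat_exp_has_derivative:
  "(flat_exp n has_real_derivative flat_exp (n + 2) t - real n * flat_exp (n + 1) t) (at t)"
proof -
  consider "t > 0" | "t < 0" | "t = 0" by linarith
  then show ?thesis
  proof cases
    case 1
    have "((\<lambda>t. exp (- (1 / t)) / t ^ n) has_real_derivative
        ((exp (- (1/t)) * (1 / t\<^sup>2)) * t ^ n - exp (- (1/t)) * (real n * t ^ (n - 1))) / (t ^ n * t ^ n)) (at t)"
    proof (rule DERIV_divide)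
      show "((\<lambda>t. exp (- (1 / t))) has_real_derivative exp (- (1/t)) * (1 / t\<^sup>2)) (at t)"
        using 1 by (auto intro!: derivative_eq_intros simp: power2_eq_square)
      show "((\<lambda>t. t ^ n) has_real_derivative real n * t ^ (n - 1)) (at t)"
        by (auto intro!: derivative_eq_intros)
    qed (use 1 in auto)
    also have "((exp (- (1/t)) * (1 / t\<^sup>2)) * t ^ n - exp (- (1/t)) * (real n * t ^ (n - 1))) / (t ^ n * t ^ n)
        = flat_exp (n + 2) t - real n * flat_exp (n + 1) t"
      using 1 by (cases n) (simp_all add: flat_exp_def field_simps power2_eq_square)
    finally show ?thesis
      by (rule has_field_derivative_transform_within_open[of _ _ _ "{0<..}"])
        (use 1 in \<open>auto simp: flat_exp_def\<close>)
  next
    case 2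
    have "((\<lambda>_. 0) has_real_derivative 0) (at t)" by simp
    then have "(flat_exp n has_real_derivative 0) (at t)"
      by (rule has_field_derivative_transform_within_open[of _ _ _ "{..<0}"])
        (use 2 in \<open>auto simp: flat_exp_def\<close>)
    then show ?thesis using 2 by (simp add: flat_exp_def)
  next
    case 3
    have "(\<lambda>h. (flat_exp n (0 + h) - flat_exp n 0) / h) \<midarrow>0\<rightarrow> 0"
    proof (rule Lim_null_comparison)
      show "\<forall>\<^sub>F h in at 0. norm ((flat_exp n (0 + h) - flat_exp n 0) / h) \<le> fact (n+2) * \<bar>h\<bar>"
        unfolding eventually_at_filter
      proof (intro always_eventually allI impI)
        fix h :: real assume "h \<noteq> 0"
        then show "norm ((flat_exp n (0 + h) - flat_exp n 0) / h) \<le> fact (n+2) * \<bar>h\<bar>"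
          using flat_exp_le[of n h] by (simp add: flat_exp_def[of n 0] power2_eq_square divide_simps abs_mult
              mult.assoc del: fact_Suc)
      qed
      show "(\<lambda>h. fact (n+2) * \<bar>h\<bar>) \<midarrow>0\<rightarrow> (0::real)" by (intro tendsto_eq_intros) auto
    qed
    then show ?thesis using 3 by (simp add: DERIV_def flat_exp_def)
  qed
qed

lemma smooth_flat_exp:
  fixes q :: "real^'n::finite \<Rightarrow> real"
  assumes "smooth q"
  shows "smooth (\<lambda>x. flat_exp k (q x))"
  unfolding smooth_iff_smooth_upto
proof
  fix n
  have 1: "(flat_exp k has_real_derivative flat_exp (k + 2) (q x) + (- real k) * flat_exp (k + 1) (q x)) (at (q x))"
    for k x using flat_exp_has_derivative[of k "q x"] by simp
  have 2: "smooth_upto n (\<lambda>x. flat_exp (k + 2) (q x) + (- real k) * flat_exp (k + 1) (q x))"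
    if "\<And>k. smooth_upto n (\<lambda>x. flat_exp k (q x))" for n k
    by (intro smooth_upto_add smooth_upto_mult smooth_upto_const that)
  show "smooth_upto n (\<lambda>x. flat_exp k (q x))"
    using smooth_upto_compose[of flat_exp "\<lambda>k t. flat_exp (k + 2) t + (- real k) * flat_exp (k + 1) t" q n k]
      1 2 assms unfolding smooth_iff_smooth_upto by blast
qed

section \<open>Radial functions and the truncated Newtonian kernel\<close>

lemma norm_diff_sq_has_derivative:
  fixes y :: "'a::euclidean_space"
  shows "((\<lambda>x. (norm (x - y))\<^sup>2) has_derivative (\<lambda>h. 2 * (h \<bullet> (x - y)))) (at x)"
  unfolding power2_norm_eq_inner
  by (auto intro!: derivative_eq_intros simp: inner_commute)

lemma pderiv_at_norm_diff_sq:
  fixes y :: "real^'n::finite"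
  shows "pderiv_at i (\<lambda>x. (norm (x - y))\<^sup>2) = (\<lambda>x. 2 * (x $ i - y $ i))"
proof
  fix x show "pderiv_at i (\<lambda>x. (norm (x - y))\<^sup>2) x = 2 * (x $ i - y $ i)"
    using pderiv_at_eqI[OF norm_diff_sq_has_derivative[of y x], of i]
    by (simp add: inner_axis' inner_axis)
qed

lemma smooth_norm_diff_sq:
  fixes y :: "real^'n::finite"
  shows "smooth (\<lambda>x. (norm (x - y))\<^sup>2)"
proof -
  have "(\<lambda>x. (norm (x - y))\<^sup>2) = (\<lambda>x. \<Sum>i\<in>UNIV. (x $ i - y $ i)\<^sup>2)"
    unfolding power2_norm_eq_inner by (simp add: inner_vec_def power2_eq_square)
  then show ?thesis
    by (simp add: smooth_sum smooth_power smooth_diff smooth_component smooth_const)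
qed

lemma pderiv_at_radial:
  fixes y :: "real^'n::finite"
  assumes "\<And>s. s \<ge> 0 \<Longrightarrow> (F has_real_derivative F1 s) (at s)"
  shows "pderiv_at i (\<lambda>x. F ((norm (x - y))\<^sup>2)) =
    (\<lambda>x. F1 ((norm (x - y))\<^sup>2) * (2 * (x $ i - y $ i)))"
  using pderiv_at_compose[of F F1 "\<lambda>x. (norm (x - y))\<^sup>2" i] assms
    smooth_imp_differentiable[OF smooth_norm_diff_sq, of y]
  by (simp add: pderiv_at_norm_diff_sq)

lemma pderivs_radial_second:
  fixes y :: "real^'n::finite"
  assumes F: "\<And>s. s \<ge> 0 \<Longrightarrow> (F has_real_derivative F1 s) (at s)"
    and F1: "\<And>s. s \<ge> 0 \<Longrightarrow> (F1 has_real_derivative F2 s) (at s)"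
  shows "pderivs [i, i] (\<lambda>x. F ((norm (x - y))\<^sup>2)) x =
    F2 ((norm (x - y))\<^sup>2) * (2 * (x $ i - y $ i))\<^sup>2 + 2 * F1 ((norm (x - y))\<^sup>2)"
proof -
  let ?q = "\<lambda>x. (norm (x - y))\<^sup>2" and ?l = "\<lambda>x. 2 * (x $ i - y $ i)"
  have l: "smooth ?l"
    by (intro smooth_mult smooth_diff smooth_component smooth_const)
  have l': "pderiv_at i ?l = (\<lambda>x. 2)"
  proof
    fix x :: "real^'n"
    have "(?l has_derivative (\<lambda>h. 2 * h $ i)) (at x)"
      by (auto intro!: derivative_eq_intros bounded_linear_imp_has_derivative bounded_linear_vec_nth)
    from pderiv_at_eqI[OF this] show "pderiv_at i ?l x = 2" by (simp add: axis_def)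
  qed
  have "pderivs [i, i] (\<lambda>x. F (?q x)) = pderiv_at i (\<lambda>x. F1 (?q x) * ?l x)"
    using pderiv_at_radial[OF F, of i y] by (simp add: pderivs_def)
  also have "\<dots> = (\<lambda>x. F1 (?q x) * 2 + F2 (?q x) * ?l x * ?l x)"
  proof (subst pderiv_at_mult)
    show "(\<lambda>x. F1 (?q x)) differentiable at x" for x
      by (intro differentiable_real_compose[OF F1] smooth_imp_differentiable[OF smooth_norm_diff_sq]) simp
    show "?l differentiable at x" for x by (rule smooth_imp_differentiable[OF l])
    show "(\<lambda>x. F1 (?q x) * pderiv_at i ?l x + pderiv_at i (\<lambda>x. F1 (?q x)) x * ?l x) =
      (\<lambda>x. F1 (?q x) * 2 + F2 (?q x) * ?l x * ?l x)"
      by (simp only: l' pderiv_at_radial[of F1 F2, OF F1])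
  qed
  finally show ?thesis by (simp add: power2_eq_square mult_ac)
qed

text \<open>Radial functions are written in s = |x - y|^2, which avoids the singularity of the norm
  at the centre. As the gradient of s is 2(x - y), the second-order terms sum to 4s and the
  first-order ones to twice the dimension.\<close>

lemma laplacian_radial:
  fixes y :: "real^'n::finite"
  assumes F: "\<And>s. s \<ge> 0 \<Longrightarrow> (F has_real_derivative F1 s) (at s)"
    and F1: "\<And>s. s \<ge> 0 \<Longrightarrow> (F1 has_real_derivative F2 s) (at s)"
  shows "(\<Sum>i\<in>UNIV. pderivs [i, i] (\<lambda>x. F ((norm (x - y))\<^sup>2)) x) =
    4 * (norm (x - y))\<^sup>2 * F2 ((norm (x - y))\<^sup>2) + 2 * real CARD('n) * F1 ((norm (x - y))\<^sup>2)"
proof -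
  have "(norm (x - y))\<^sup>2 = (\<Sum>i\<in>UNIV. (x $ i - y $ i)\<^sup>2)"
    unfolding power2_norm_eq_inner by (simp add: inner_vec_def power2_eq_square)
  then have *: "4 * (norm (x - y))\<^sup>2 * c = (\<Sum>i\<in>UNIV. c * (2 * (x $ i - y $ i))\<^sup>2)" for c
    by (simp add: sum_distrib_left power_mult_distrib right_diff_distrib[symmetric] mult_ac del: right_diff_distrib_numeral)
  show ?thesis
    unfolding * by (simp only: pderivs_radial_second[of F F1 F2, OF F F1] sum.distrib) simp
qed

lemma norm_gradient_radial:
  fixes y :: "real^'n::finite"
  assumes F: "\<And>s. s \<ge> 0 \<Longrightarrow> (F has_real_derivative F1 s) (at s)"
  shows "(norm (\<chi> i. pderivs [i] (\<lambda>x. F ((norm (x - y))\<^sup>2)) x))\<^sup>2 =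
    4 * (norm (x - y))\<^sup>2 * (F1 ((norm (x - y))\<^sup>2))\<^sup>2"
proof -
  have "(\<chi> i. pderivs [i] (\<lambda>x. F ((norm (x - y))\<^sup>2)) x) = (2 * F1 ((norm (x - y))\<^sup>2)) *\<^sub>R (x - y)"
    by (simp add: pderivs_Cons vec_eq_iff pderiv_at_radial[of F F1, OF F])
  then show ?thesis by (simp add: power_mult_distrib)
qed

text \<open>The argument of the flat exponential is \<open>1 - s\<^sup>2\<close> with \<open>s = \<bar>x\<bar>\<^sup>2\<close>: since the cutoff then differs from
  \<open>1\<close> by \<open>O(\<bar>x\<bar>\<^sup>4)\<close>, cutting off the Newtonian kernel produces a bounded error term.\<close>

definition cutoff :: "real \<Rightarrow> real" where
  "cutoff s = exp 1 * flat_exp 0 (1 - s\<^sup>2)"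

definition cutoff1 :: "real \<Rightarrow> real" where
  "cutoff1 s = - 2 * exp 1 * s * flat_exp 2 (1 - s\<^sup>2)"

definition cutoff2 :: "real \<Rightarrow> real" where
  "cutoff2 s = - 2 * exp 1 * flat_exp 2 (1 - s\<^sup>2)
     + 4 * exp 1 * s\<^sup>2 * (flat_exp 4 (1 - s\<^sup>2) - 2 * flat_exp 3 (1 - s\<^sup>2))"

lemma cutoff_has_derivative: "(cutoff has_real_derivative cutoff1 s) (at s)"
proof -
  have "((\<lambda>s. flat_exp 0 (1 - s\<^sup>2)) has_real_derivative flat_exp 2 (1 - s\<^sup>2) * (- 2 * s)) (at s)"
    by (rule DERIV_chain2[of "flat_exp 0"])
       (use flat_exp_has_derivative[of 0 "1 - s\<^sup>2"] in \<open>auto intro!: derivative_eq_intros simp: numeral_2_eq_2\<close>)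
  from DERIV_cmult[OF this, of "exp 1"] show ?thesis
    unfolding cutoff_def[abs_def] cutoff1_def by (simp add: mult_ac)
qed

lemma cutoff1_has_derivative: "(cutoff1 has_real_derivative cutoff2 s) (at s)"
proof -
  have "((\<lambda>s. flat_exp 2 (1 - s\<^sup>2)) has_real_derivative
      (flat_exp 4 (1 - s\<^sup>2) - 2 * flat_exp 3 (1 - s\<^sup>2)) * (- 2 * s)) (at s)"
    by (rule DERIV_chain2[of "flat_exp 2"])
       (use flat_exp_has_derivative[of 2 "1 - s\<^sup>2"] in \<open>auto intro!: derivative_eq_intros\<close>)
  from DERIV_mult[OF DERIV_cmult_Id this, of "- 2 * exp 1"] show ?thesis
    unfolding cutoff1_def[abs_def] cutoff2_def by (simp add: power2_eq_square algebra_simps)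
qed

lemma cutoff_eq_0: "s \<ge> 1 \<Longrightarrow> cutoff s = 0"
  and cutoff1_eq_0: "s \<ge> 1 \<Longrightarrow> cutoff1 s = 0"
  and cutoff2_eq_0: "s \<ge> 1 \<Longrightarrow> cutoff2 s = 0"
proof -
  show "cutoff s = 0" "cutoff1 s = 0" "cutoff2 s = 0" if "s \<ge> 1"
  proof -
    have "\<not> s\<^sup>2 < 1" using that by (simp add: not_less one_le_power)
    then show "cutoff s = 0" "cutoff1 s = 0" "cutoff2 s = 0"
      by (simp_all add: cutoff_def cutoff1_def cutoff2_def flat_exp_def)
  qed
qed

lemma cutoff_nonneg [simp]: "0 \<le> cutoff s"
  by (simp add: cutoff_def)

lemma cutoff_le_1: "cutoff s \<le> 1"
proof (cases "s\<^sup>2 < 1")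
  case True
  then have "1 \<le> 1 / (1 - s\<^sup>2)" by simp
  then have "exp 1 * exp (- (1 / (1 - s\<^sup>2))) \<le> 1" by (simp flip: exp_add)
  then show ?thesis using True by (simp add: cutoff_def flat_exp_def)
qed (auto simp: cutoff_def flat_exp_def)

lemma cutoff_0 [simp]: "cutoff 0 = 1"
  by (simp add: cutoff_def flat_exp_def exp_minus)

lemma continuous_cutoff: "continuous_on S cutoff"
  using cutoff_has_derivative DERIV_isCont continuous_at_imp_continuous_on by blast

lemma borel_measurable_cutoff [measurable]: "cutoff \<in> borel_measurable borel"
  using continuous_cutoff by (rule borel_measurable_continuous_onI)

text \<open>The bound on \<open>cutoff1\<close> is linear in s because the inner function 1 - s^2
  has derivative -2s. This factor s cancels the singularity 1/s of the kernel in the cross terms of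
  the Laplacian. The factorials come from \<open>flat_exp_le\<close> with 1 - s^2 <= 1.\<close>

lemma cutoff_derivative_bounds:
  obtains C where "C > 0" "\<And>s. s \<ge> 0 \<Longrightarrow> \<bar>cutoff1 s\<bar> \<le> C * s" "\<And>s. s \<ge> 0 \<Longrightarrow> \<bar>cutoff2 s\<bar> \<le> C"
proof -
  have fl: "flat_exp n (1 - s\<^sup>2) \<le> fact (n + 2)" for n and s :: real
  proof (cases "s\<^sup>2 < 1")
    case True
    then have "(1 - s\<^sup>2)\<^sup>2 \<le> 1" by (simp add: power_le_one)
    then have "fact (n + 2) * (1 - s\<^sup>2)\<^sup>2 \<le> (fact (n + 2) * 1 :: real)"
      by (rule mult_left_mono) simp
    then show ?thesis using flat_exp_le[of n "1 - s\<^sup>2"] by linarith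
  qed (auto simp: flat_exp_def)
  define C where "C = 2 * exp 1 * fact 4 + 4 * exp 1 * (fact 6 + 2 * fact 5 :: real)"
  have C0: "C > 0" unfolding C_def by (intro add_pos_pos mult_pos_pos) auto
  have "\<bar>cutoff1 s\<bar> \<le> C * s \<and> \<bar>cutoff2 s\<bar> \<le> C" if s: "s \<ge> 0" for s
  proof (cases "s \<ge> 1")
    case True
    then show ?thesis using C0 s by (simp add: cutoff1_eq_0 cutoff2_eq_0)
  next
    case False
    have "\<bar>cutoff1 s\<bar> = 2 * exp 1 * flat_exp 2 (1 - s\<^sup>2) * s"
      using s by (simp add: cutoff1_def abs_mult)
    also have "\<dots> \<le> 2 * exp 1 * fact 4 * s"
      using s fl[of 2 s] by (intro mult_right_mono mult_left_mono) auto
    also have "\<dots> \<le> C * s"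
      unfolding C_def using s by (intro mult_right_mono) auto
    finally have 1: "\<bar>cutoff1 s\<bar> \<le> C * s" .
    let ?a = "flat_exp 4 (1 - s\<^sup>2) - 2 * flat_exp 3 (1 - s\<^sup>2)"
    have a: "\<bar>?a\<bar> \<le> fact 6 + 2 * fact 5"
      using fl[of 4 s] fl[of 3 s] flat_exp_nonneg[of 4 "1 - s\<^sup>2"] flat_exp_nonneg[of 3 "1 - s\<^sup>2"]
      unfolding abs_le_iff by (simp del: flat_exp_nonneg)
    have "\<bar>cutoff2 s\<bar> \<le> 2 * exp 1 * flat_exp 2 (1 - s\<^sup>2) + 4 * exp 1 * s\<^sup>2 * \<bar>?a\<bar>"
      unfolding cutoff2_def by (rule order_trans[OF abs_triangle_ineq]) (simp add: abs_mult)
    also have "\<dots> \<le> 2 * exp 1 * fact 4 + 4 * exp 1 * 1 * (fact 6 + 2 * fact 5)"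
      using False s fl[of 2 s] a by (intro add_mono mult_mono) (auto simp: power_le_one)
    also have "\<dots> = C" by (simp add: C_def)
    finally show ?thesis using 1 by blast
  qed
  with C0 show ?thesis using that by blast
qed

section \<open>The regularised Newtonian kernel and its Laplacian\<close>

lemma test_function_cutoff:
  fixes y :: "real^'n::finite"
  assumes "smooth (\<lambda>x. g (norm (x - y) ^ 2))"
  shows "test_function (\<lambda>x. cutoff ((norm (x - y))\<^sup>2) * g ((norm (x - y))\<^sup>2))"
  unfolding test_function_def
proof
  show "smooth (\<lambda>x. cutoff ((norm (x - y))\<^sup>2) * g ((norm (x - y))\<^sup>2))"
    unfolding cutoff_def
    by (intro smooth_mult assms smooth_const smooth_flat_exp smooth_diff smooth_power[OF smooth_norm_diff_sq])
  have "{x. cutoff ((norm (x - y))\<^sup>2) * g ((norm (x - y))\<^sup>2) \<noteq> 0} \<subseteq> cball y 1"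
  proof
    fix x assume "x \<in> {x. cutoff ((norm (x - y))\<^sup>2) * g ((norm (x - y))\<^sup>2) \<noteq> 0}"
    then have "(norm (x - y))\<^sup>2 < 1" using cutoff_eq_0[of "(norm (x - y))\<^sup>2"] by (auto simp: not_le[symmetric])
    then show "x \<in> cball y 1" by (simp add: dist_norm norm_minus_commute abs_square_less_1 less_imp_le)
  qed
  then show "compact (closure {x. cutoff ((norm (x - y))\<^sup>2) * g ((norm (x - y))\<^sup>2) \<noteq> 0})"
    by (meson bounded_cball bounded_subset compact_closure)
qed

lemma laplacian_cutoff:
  fixes y :: "real^4"
  assumes G: "\<And>s. s \<ge> 0 \<Longrightarrow> (G has_real_derivative G1 s) (at s)"
    and G1: "\<And>s. s \<ge> 0 \<Longrightarrow> (G1 has_real_derivative G2 s) (at s)"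
    and s: "s = (norm (x - y))\<^sup>2"
  shows "(\<Sum>i\<in>UNIV. pderivs [i, i] (\<lambda>x. cutoff ((norm (x - y))\<^sup>2) * G ((norm (x - y))\<^sup>2)) x) =
    cutoff s * (4 * s * G2 s + 8 * G1 s) + 8 * s * cutoff1 s * G1 s + G s * (4 * s * cutoff2 s + 8 * cutoff1 s)"
proof -
  have 1: "((\<lambda>s. cutoff s * G s) has_real_derivative cutoff1 s * G s + G1 s * cutoff s) (at s)" if "s \<ge> 0" for s
    by (rule DERIV_mult[OF cutoff_has_derivative G[OF that]])
  have 2: "((\<lambda>s. cutoff1 s * G s + G1 s * cutoff s) has_real_derivative
      (cutoff2 s * G s + G1 s * cutoff1 s) + (G2 s * cutoff s + cutoff1 s * G1 s)) (at s)" if "s \<ge> 0" for s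
    by (rule DERIV_add[OF DERIV_mult[OF cutoff1_has_derivative G[OF that]]
        DERIV_mult[OF G1[OF that] cutoff_has_derivative]])
  show ?thesis
    using laplacian_radial[OF 1 2, of y x] unfolding s by (simp add: algebra_simps)
qed

text \<open>A smooth, compactly supported version of 1/(4 pi^2 |x|^2), the fundamental solution of
  minus the Laplacian on R^4. The shift e > 0 makes it an admissible test function.\<close>

definition newton :: "real \<Rightarrow> real^4 \<Rightarrow> real" where
  "newton e x = cutoff ((norm x)\<^sup>2) / (4 * pi\<^sup>2 * ((norm x)\<^sup>2 + e))"

text \<open>Minus the Laplacian of 1/(4 pi^2 (|x|^2 + e)), cut off. Before the cutoff its total mass
  is 1, so it acts as an approximate identity as e tends to 0.\<close>

definition bubble :: "real \<Rightarrow> real^4 \<Rightarrow> real" where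
  "bubble e x = cutoff ((norm x)\<^sup>2) * (2 * e / pi\<^sup>2 / ((norm x)\<^sup>2 + e) ^ 3)"

lemma test_function_newton:
  assumes "e > 0" shows "test_function (\<lambda>x. newton e (x - y))"
proof -
  have "smooth (\<lambda>x. (1 / (4 * pi\<^sup>2)) * inverse ((norm (x - y))\<^sup>2 + e))"
    using assms by (intro smooth_mult smooth_const smooth_inverse smooth_add smooth_norm_diff_sq add_nonneg_pos) auto
  from test_function_cutoff[where g="\<lambda>s. (1 / (4 * pi\<^sup>2)) * inverse (s + e)", OF this]
  show ?thesis unfolding newton_def by (simp add: inverse_eq_divide)
qed

lemma test_function_bubble:
  assumes "e > 0" shows "test_function (\<lambda>x. bubble e (x - y))"
proof -
  have "smooth (\<lambda>x. (2 * e / pi\<^sup>2) * inverse ((norm (x - y))\<^sup>2 + e) ^ 3)"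
    using assms by (intro smooth_mult smooth_const smooth_inverse smooth_add smooth_power smooth_norm_diff_sq add_nonneg_pos) auto
  from test_function_cutoff[where g="\<lambda>s. (2 * e / pi\<^sup>2) * inverse (s + e) ^ 3", OF this]
  show ?thesis unfolding bubble_def by (simp add: inverse_eq_divide power_divide)
qed

text \<open>The constant is uniform in e. Where both derivatives fall on the kernel,
  \<open>bubble\<close> cancels the result exactly. Every remaining term contains
  \<open>cutoff1\<close> or s times \<open>cutoff2\<close>; both are O(s) and outweigh the factor
  1/(s + e).\<close>

lemma laplacian_newton:
  obtains C where "C > 0"
    "\<And>e x y. e > 0 \<Longrightarrow>
       \<bar>(\<Sum>i\<in>UNIV. pderivs [i, i] (\<lambda>x. newton e (x - y)) x) + bubble e (x - y)\<bar> \<le> C * indicator (ball 0 1) (x - y)"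
proof -
  obtain C0 where C0: "C0 > 0" "\<And>s. s \<ge> 0 \<Longrightarrow> \<bar>cutoff1 s\<bar> \<le> C0 * s" "\<And>s. s \<ge> 0 \<Longrightarrow> \<bar>cutoff2 s\<bar> \<le> C0"
    using cutoff_derivative_bounds by blast
  \<comment> \<open>The three error terms contribute 8, 4 and 8 times \<open>C0\<close>.\<close>
  define C where "C = 20 * C0"
  have "\<bar>(\<Sum>i\<in>UNIV. pderivs [i, i] (\<lambda>x. newton e (x - y)) x) + bubble e (x - y)\<bar> \<le> C * indicator (ball 0 1) (x - y)"
    if e: "e > 0" for e :: real and x y :: "real^4"
  proof -
    define s where "s = (norm (x - y))\<^sup>2"
    have s: "s \<ge> 0" by (simp add: s_def)
    define c where "c = 1 / (4 * pi\<^sup>2)"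
    define w where "w = inverse (s + e)"
    have w: "w > 0" "(s + e) * w = 1" using s e by (auto simp: w_def)
    have G: "((\<lambda>s. c * inverse (s + e)) has_real_derivative (- c * inverse (s + e) ^ 2)) (at s)" if "s \<ge> 0" for s
      using that e by (auto intro!: derivative_eq_intros simp: power2_eq_square divide_simps)
    have G1: "((\<lambda>s. - c * inverse (s + e) ^ 2) has_real_derivative (2 * c * inverse (s + e) ^ 3)) (at s)" if "s \<ge> 0" for s
    proof -
      have "((\<lambda>s. inverse (s + e)) has_real_derivative - (inverse (s + e) ^ 2)) (at s)"
        using that e by (auto intro!: derivative_eq_intros simp: power2_eq_square divide_simps)
      from DERIV_cmult[OF DERIV_power[OF this, of 2], of "- c"] show ?thesis
        by (simp add: power2_eq_square power3_eq_cube mult_ac)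
    qed
    have sum: "(\<Sum>i\<in>UNIV. pderivs [i, i] (\<lambda>x. newton e (x - y)) x) =
      cutoff s * (4 * s * (2 * c * w ^ 3) + 8 * (- c * w\<^sup>2))
       + 8 * s * cutoff1 s * (- c * w\<^sup>2) + c * w * (4 * s * cutoff2 s + 8 * cutoff1 s)"
    proof -
      have n: "newton e (x - y) = cutoff ((norm (x - y))\<^sup>2) * (c * inverse ((norm (x - y))\<^sup>2 + e))" for x
        by (simp add: newton_def c_def divide_simps)
      show ?thesis
        unfolding n w_def
        by (rule laplacian_cutoff[of "\<lambda>s. c * inverse (s + e)" "\<lambda>s. - c * inverse (s + e) ^ 2"
            "\<lambda>s. 2 * c * inverse (s + e) ^ 3", OF _ _ s_def]) (rule G G1, assumption)+
    qed
    have b: "bubble e (x - y) = cutoff s * (8 * c * e * w ^ 3)"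
      unfolding bubble_def s_def[symmetric] by (simp add: c_def w_def power_divide inverse_eq_divide)
    \<comment> \<open>Writing w^2 as a multiple of w^3 turns 8s w^3 - 8 w^2 into -8e w^3, which up
      to the factor c and the cutoff is the negative of the bubble.\<close>
    have w2: "w\<^sup>2 = (s + e) * w ^ 3"
    proof -
      have "(s + e) * w ^ 3 = ((s + e) * w) * w\<^sup>2" by (simp add: power2_eq_square power3_eq_cube)
      then show ?thesis using w(2) by simp
    qed
    have eq: "(\<Sum>i\<in>UNIV. pderivs [i, i] (\<lambda>x. newton e (x - y)) x) + bubble e (x - y)
       = c * (8 * (s * w) * (- (cutoff1 s * w)) + 4 * (s * w) * cutoff2 s + 8 * (cutoff1 s * w))"
    proof -
      have "cutoff s * (4 * s * (2 * c * w ^ 3) + 8 * (- c * w\<^sup>2)) + cutoff s * (8 * c * e * w ^ 3) = 0"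
        unfolding w2 by (simp add: algebra_simps)
      then show ?thesis unfolding sum b by (simp add: algebra_simps power2_eq_square)
    qed
    show ?thesis
    proof (cases "s < 1")
      case True
      then have x: "x - y \<in> ball 0 1" by (simp add: s_def abs_square_less_1)
      have a: "0 \<le> s * w" "s * w \<le> 1" using s e by (auto simp: w_def divide_inverse[symmetric])
      have b: "\<bar>cutoff1 s * w\<bar> \<le> C0"
      proof -
        have "\<bar>cutoff1 s * w\<bar> \<le> C0 * s * w" using C0(2)[OF s] w
          by (simp add: abs_mult)
        also have "\<dots> \<le> C0 * 1" using a(2) C0(1) by (metis mult_left_mono less_imp_le mult.assoc)
        finally show ?thesis by simp
      qed
      have "\<bar>8 * (s * w) * (- (cutoff1 s * w)) + 4 * (s * w) * cutoff2 s + 8 * (cutoff1 s * w)\<bar>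
        \<le> \<bar>8 * (s * w) * (- (cutoff1 s * w))\<bar> + \<bar>4 * (s * w) * cutoff2 s\<bar> + \<bar>8 * (cutoff1 s * w)\<bar>"
        by linarith
      also have "\<dots> = 8 * (s * w) * \<bar>cutoff1 s * w\<bar> + 4 * (s * w) * \<bar>cutoff2 s\<bar> + 8 * \<bar>cutoff1 s * w\<bar>"
        using a(1) by (simp only: abs_mult abs_minus_cancel abs_of_nonneg abs_numeral) (use s w in simp)
      also have "\<dots> \<le> 8 * 1 * C0 + 4 * 1 * C0 + 8 * C0"
        using a b C0 s by (intro add_mono mult_mono) auto
      finally have d: "\<bar>8 * (s * w) * (- (cutoff1 s * w)) + 4 * (s * w) * cutoff2 s + 8 * (cutoff1 s * w)\<bar> \<le> C"
        by (simp add: C_def)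
      have "1 < pi\<^sup>2" using pi_gt3 by (simp add: power2_eq_square less_1_mult)
      then have "0 < c" "c \<le> 1" by (auto simp: c_def divide_simps)
      then have "\<bar>c * (8 * (s * w) * (- (cutoff1 s * w)) + 4 * (s * w) * cutoff2 s + 8 * (cutoff1 s * w))\<bar> \<le> 1 * C"
        unfolding abs_mult[of c] using d by (intro mult_mono) auto
      then show ?thesis unfolding eq using x by simp
    next
      case False
      then show ?thesis unfolding eq using C0(1) by (simp add: cutoff1_eq_0 cutoff2_eq_0 C_def)
    qed
  qed
  moreover have "C > 0" using C0 by (simp add: C_def)
  ultimately show ?thesis using that by blast
qed

section \<open>Radial integrals and the Riesz kernel\<close>

lemma ennreal_mult_add_mult:
  "0 \<le> a \<Longrightarrow> 0 \<le> b \<Longrightarrow> 0 \<le> c \<Longrightarrow> 0 \<le> d \<Longrightarrow>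
    ennreal a * ennreal b + ennreal c * ennreal d = ennreal (a * b + c * d)"
  by (simp add: ennreal_mult)

lemma nn_integral_lborel_affine:
  fixes f :: "'a::euclidean_space \<Rightarrow> ennreal"
  assumes [measurable]: "f \<in> borel_measurable borel" and c: "c \<noteq> 0"
  shows "(\<integral>\<^sup>+x. f x \<partial>lborel) = ennreal (\<bar>c\<bar> ^ DIM('a)) * (\<integral>\<^sup>+x. f (t + c *\<^sub>R x) \<partial>lborel)"
  by (subst lborel_affine[OF c, of t])
     (simp add: nn_integral_density nn_integral_distr nn_integral_cmult)

lemma nn_integral_lborel_reflect:
  fixes f :: "'a::euclidean_space \<Rightarrow> ennreal"
  assumes "f \<in> borel_measurable borel"
  shows "(\<integral>\<^sup>+x. f (t - x) \<partial>lborel) = (\<integral>\<^sup>+x. f x \<partial>lborel)"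
  using nn_integral_lborel_affine[OF assms, of "-1" t] by simp

lemma nn_integral_lborel_shift:
  fixes f :: "'a::euclidean_space \<Rightarrow> ennreal"
  assumes "f \<in> borel_measurable borel"
  shows "(\<integral>\<^sup>+x. f (x - t) \<partial>lborel) = (\<integral>\<^sup>+x. f x \<partial>lborel)"
  using nn_integral_lborel_affine[OF assms, of 1 "- t"] by simp

lemma emeasure_lborel_radial:
  "emeasure lborel {x :: real^4. (norm x)\<^sup>2 \<le> a} = ennreal (if a \<ge> 0 then pi\<^sup>2 / 2 * a\<^sup>2 else 0)"
proof (cases "a \<ge> 0")
  case True
  then have "{x :: real^4. (norm x)\<^sup>2 \<le> a} = cball 0 (sqrt a)"
    by (auto simp: real_le_rsqrt real_le_lsqrt) (metis norm_ge_zero real_sqrt_le_iff real_sqrt_pow2_iff real_sqrt_abs abs_of_nonneg sqrt_le_D real_sqrt_unique)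
  then show ?thesis using True
    by (simp add: emeasure_cball unit_ball_vol_4) (simp add: power4_eq_xxxx power2_eq_square)
next
  case False
  then have "{x :: real^4. (norm x)\<^sup>2 \<le> a} = {}"
    by (auto simp: not_le) (meson less_le_trans not_less zero_le_power2)
  then show ?thesis using False by simp
qed

lemma emeasure_density_linear:
  "emeasure (density lborel (\<lambda>s. ennreal (pi\<^sup>2 * s))) {..a} = ennreal (if a \<ge> 0 then pi\<^sup>2 / 2 * a\<^sup>2 else 0)"
proof (cases "a \<ge> 0")
  case True
  have "((\<lambda>s. pi\<^sup>2 * s) has_integral (pi\<^sup>2 / 2 * a\<^sup>2 - pi\<^sup>2 / 2 * 0\<^sup>2)) {0..a}"
    using True by (intro fundamental_theorem_of_calculus)
      (auto intro!: derivative_eq_intros simp flip: has_real_derivative_iff_has_vector_derivative)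
  then have "(\<integral>\<^sup>+s. ennreal (pi\<^sup>2 * s) * indicator {0..a} s \<partial>lborel) = ennreal (pi\<^sup>2 / 2 * a\<^sup>2)"
    by (subst nn_integral_has_integral_lebesgue') auto
  moreover have "ennreal (pi\<^sup>2 * s) * indicator {..a} s = ennreal (pi\<^sup>2 * s) * indicator {0..a} s" for s :: real
    by (auto simp: indicator_def ennreal_neg mult_nonneg_nonpos)
  ultimately show ?thesis using True by (simp add: emeasure_density)
next
  case False
  then have "(\<lambda>s. ennreal (pi\<^sup>2 * s) * indicator {..a} s) = (\<lambda>s. 0)"
    by (intro ext) (auto simp: indicator_def ennreal_neg mult_nonneg_nonpos)
  then show ?thesis using False by (simp add: emeasure_density)
qed

text \<open>The ball of radius sqrt a in R^4 has volume pi^2 a^2 / 2, with derivative pi^2 a.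
  Comparing the two measures on half-lines is enough, and later radial integrals become
  one-dimensional.\<close>

lemma distr_norm_sq:
  "distr lborel borel (\<lambda>x :: real^4. (norm x)\<^sup>2) = density lborel (\<lambda>s. ennreal (pi\<^sup>2 * s))"
proof (rule measure_eqI_generator_eq[where E="range atMost" and \<Omega>=UNIV and A="\<lambda>n. {..real n}"])
  show "Int_stable (range (atMost :: real \<Rightarrow> _))"
    by (auto simp: Int_stable_def)
  show "emeasure (distr lborel borel (\<lambda>x :: real^4. (norm x)\<^sup>2)) X = emeasure (density lborel (\<lambda>s. ennreal (pi\<^sup>2 * s))) X"
    if X: "X \<in> range atMost" for X
  proof -
    obtain a where a: "X = {..a}" using X by auto
    have "emeasure (distr lborel borel (\<lambda>x :: real^4. (norm x)\<^sup>2)) {..a} = emeasure lborel {x :: real^4. (norm x)\<^sup>2 \<le> a}"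
      by (subst emeasure_distr) (auto simp: vimage_def)
    then show ?thesis by (simp add: a emeasure_lborel_radial emeasure_density_linear)
  qed
  show "sets (distr lborel borel (\<lambda>x :: real^4. (norm x)\<^sup>2)) = sigma_sets UNIV (range atMost)"
    by (simp add: borel_eq_atMost[where 'a=real])
  show "sets (density lborel (\<lambda>s. ennreal (pi\<^sup>2 * s))) = sigma_sets UNIV (range atMost)"
    by (simp add: borel_eq_atMost[where 'a=real])
  show "emeasure (distr lborel borel (\<lambda>x :: real^4. (norm x)\<^sup>2)) {..real n} \<noteq> \<infinity>" for n
    by (subst emeasure_distr) (auto simp: vimage_def emeasure_lborel_radial)
qed (auto simp: real_arch_simple)

lemma nn_integral_radial:
  assumes [measurable]: "F \<in> borel_measurable borel"
  shows "(\<integral>\<^sup>+x. F ((norm (x::real^4))\<^sup>2) \<partial>lborel) = (\<integral>\<^sup>+s. ennreal (pi\<^sup>2 * s) * F s \<partial>lborel)"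
proof -
  have "(\<integral>\<^sup>+x. F ((norm (x::real^4))\<^sup>2) \<partial>lborel) = (\<integral>\<^sup>+s. F s \<partial>distr lborel borel (\<lambda>x :: real^4. (norm x)\<^sup>2))"
    by (subst nn_integral_distr) auto
  also have "\<dots> = (\<integral>\<^sup>+s. ennreal (pi\<^sup>2 * s) * F s \<partial>lborel)"
    by (simp add: distr_norm_sq nn_integral_density)
  finally show ?thesis .
qed

text \<open>The set S leaves room for the half-open intervals of the later decompositions, while the
  one-dimensional integral is computed on a closed interval.\<close>

lemma nn_integral_radial_interval:
  assumes f: "\<And>s. s \<in> {a..b} \<Longrightarrow> 0 \<le> f s" and I: "((\<lambda>s. pi\<^sup>2 * s * f s) has_integral I) {a..b}"
    and a: "0 \<le> a" and [measurable]: "f \<in> borel_measurable borel"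
    and S: "S \<in> sets borel" "S \<subseteq> {a..b}"
  shows "(\<integral>\<^sup>+x. indicator S ((norm (x::real^4))\<^sup>2) * ennreal (f ((norm x)\<^sup>2)) \<partial>lborel) \<le> ennreal I"
proof -
  have [measurable]: "S \<in> sets borel" by fact
  have "(\<integral>\<^sup>+x. indicator S ((norm (x::real^4))\<^sup>2) * ennreal (f ((norm x)\<^sup>2)) \<partial>lborel)
      = (\<integral>\<^sup>+s. ennreal (pi\<^sup>2 * s) * (indicator S s * ennreal (f s)) \<partial>lborel)"
    by (rule nn_integral_radial) measurable
  also have "\<dots> \<le> (\<integral>\<^sup>+s. ennreal (pi\<^sup>2 * s * f s) * indicator {a..b} s \<partial>lborel)"
    using a f S(2) by (intro nn_integral_mono) (auto simp: indicator_def ennreal_mult)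
  also have "\<dots> = ennreal I"
    using a f by (intro nn_integral_has_integral_lebesgue' I mult_nonneg_nonneg) auto
  finally show ?thesis .
qed

lemma ball_norm_sq: "indicator (ball 0 r) x = indicator {..<r\<^sup>2} ((norm x)\<^sup>2)" if "r > 0" for x :: "'a::real_normed_vector"
proof -
  have "norm x < r \<longleftrightarrow> (norm x)\<^sup>2 < r\<^sup>2"
    using that power_strict_mono[of "norm x" r 2] power2_less_imp_less[of "norm x" r] by auto
  then show ?thesis by (simp add: indicator_def)
qed

lemma nn_integral_ball_powr:
  assumes p: "p < 4" and r: "r > 0"
  shows "(\<integral>\<^sup>+x. indicator (ball 0 r) x * ennreal (norm (x::real^4) powr - p) \<partial>lborel)
    \<le> ennreal (pi\<^sup>2 / (2 - p / 2) * r powr (4 - p))"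
proof -
  have *: "norm x powr - p = (norm x)\<^sup>2 powr (- p / 2)" for x :: "real^4"
    by (cases "x = 0") (simp_all add: powr_powr flip: powr_numeral)
  have "((\<lambda>s. s powr (1 - p/2)) has_integral (r\<^sup>2) powr ((1 - p/2) + 1) / ((1 - p/2) + 1)) {0..r\<^sup>2}"
    using p by (intro has_integral_powr_from_0) auto
  from has_integral_mult_right[OF this, of "pi\<^sup>2"]
  have I: "((\<lambda>s. pi\<^sup>2 * s powr (1 - p/2)) has_integral (pi\<^sup>2 / (2 - p / 2) * r powr (4 - p))) {0..r\<^sup>2}"
    using r by (simp add: powr_powr algebra_simps flip: powr_numeral)
  have I': "((\<lambda>s. pi\<^sup>2 * s * s powr (- p/2)) has_integral (pi\<^sup>2 / (2 - p / 2) * r powr (4 - p))) {0..r\<^sup>2}"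
  proof (rule has_integral_eq[OF _ I])
    fix s assume "s \<in> {0..r\<^sup>2}"
    then show "pi\<^sup>2 * s powr (1 - p / 2) = pi\<^sup>2 * s * s powr (- p/2)"
      using powr_add[of s 1 "- p / 2"] by (cases "s = 0") (auto simp: add_divide_distrib)
  qed
  have "(\<integral>\<^sup>+x. indicator {0..<r\<^sup>2} ((norm (x::real^4))\<^sup>2) * ennreal ((norm x)\<^sup>2 powr (- p/2)) \<partial>lborel)
    \<le> ennreal (pi\<^sup>2 / (2 - p / 2) * r powr (4 - p))"
    by (rule nn_integral_radial_interval[OF _ I']) auto
  moreover have "indicator (ball 0 r) x = (indicator {0..<r\<^sup>2} ((norm x)\<^sup>2) :: ennreal)" for x :: "real^4"
    using ball_norm_sq[OF r, of x] by (auto simp: indicator_def)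
  ultimately show ?thesis unfolding * by simp
qed

section \<open>Integrals of powers of the norm over sets of given measure\<close>

lemma ball_in_sets_borel [measurable]: "ball x r \<in> sets borel"
  by simp

lemma cball_in_sets_borel [measurable]: "cball x r \<in> sets borel"
  by simp

text \<open>Split E at the radius r with r^4 = m. Inside, the singularity is integrated over the
  whole ball; outside, the power is at most r^(-p) and E has measure m. Both parts are of size m^(1
  - p/4). The case p = \<alpha> serves the singular weight, p = 1 the logarithmic kernel.\<close>

lemma nn_integral_set_powr:
  assumes p: "0 \<le> p" "p < 4"
  obtains C where "C > 0"
    "\<And>E m (y::real^4). E \<in> sets borel \<Longrightarrow> emeasure lborel E = ennreal m \<Longrightarrow> m > 0 \<Longrightarrow>
      (\<integral>\<^sup>+x. indicator E x * ennreal (norm (x - y) powr - p) \<partial>lborel) \<le> ennreal (C * m powr (1 - p / 4))"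
proof -
  define C where "C = pi\<^sup>2 / (2 - p / 2) + 1"
  have Cp: "pi\<^sup>2 / (2 - p / 2) \<ge> 0" using p by auto
  have "(\<integral>\<^sup>+x. indicator E x * ennreal (norm (x - y) powr - p) \<partial>lborel) \<le> ennreal (C * m powr (1 - p / 4))"
    if E: "E \<in> sets borel" "emeasure lborel E = ennreal m" "m > 0" for E m and y :: "real^4"
  proof -
    have [measurable]: "E \<in> sets borel" by fact
    define r where "r = m powr (1/4)"
    have r: "r > 0" using E by (simp add: r_def)
    have "(\<integral>\<^sup>+x. indicator E x * ennreal (norm (x - y) powr - p) \<partial>lborel) \<le>
      (\<integral>\<^sup>+x. indicator (ball 0 r) (x - y) * ennreal (norm (x - y) powr - p) + ennreal (r powr - p) * indicator E x \<partial>lborel)"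
    proof (rule nn_integral_mono)
      fix x
      show "indicator E x * ennreal (norm (x - y) powr - p) \<le>
        indicator (ball 0 r) (x - y) * ennreal (norm (x - y) powr - p) + ennreal (r powr - p) * indicator E x"
      proof (cases "norm (x - y) < r")
        case True
        then show ?thesis by (auto simp: indicator_def)
      next
        case False
        then have "norm (x - y) powr - p \<le> r powr - p"
          using r p by (intro powr_mono2') auto
        then show ?thesis using False by (auto simp: indicator_def)
      qed
    qed
    also have "\<dots> = (\<integral>\<^sup>+x. indicator (ball 0 r) (x - y) * ennreal (norm (x - y) powr - p) \<partial>lborel) + ennreal (r powr - p) * ennreal m"
      by (subst nn_integral_add) (auto simp: nn_integral_cmult_indicator E(2))
    also have "(\<integral>\<^sup>+x. indicator (ball 0 r) (x - y) * ennreal (norm (x - y) powr - p) \<partial>lborel) = 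
        (\<integral>\<^sup>+x. indicator (ball 0 r) x * ennreal (norm (x::real^4) powr - p) \<partial>lborel)"
      by (rule nn_integral_lborel_shift[of "\<lambda>x. indicator (ball 0 r) x * ennreal (norm x powr - p)"]) measurable
    also have "\<dots> \<le> ennreal (pi\<^sup>2 / (2 - p / 2) * r powr (4 - p))"
      by (rule nn_integral_ball_powr[OF p(2) r])
    also have "ennreal (pi\<^sup>2 / (2 - p / 2) * r powr (4 - p)) + ennreal (r powr - p) * ennreal m = ennreal (C * m powr (1 - p / 4))"
    proof -
      have 1: "r powr (4 - p) = m powr (1 - p / 4)" 
        unfolding r_def powr_powr by (simp add: field_simps)
      have "r powr - p * m = m powr (- p / 4) * m powr 1"
        unfolding r_def powr_powr using E by simp
      also have "\<dots> = m powr (1 - p/4)" unfolding powr_add[symmetric] by simp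
      finally have 2: "r powr - p * m = m powr (1 - p/4)" .
      have "ennreal (pi\<^sup>2 / (2 - p / 2) * r powr (4 - p)) + ennreal (r powr - p) * ennreal m
        = ennreal (pi\<^sup>2 / (2 - p / 2) * r powr (4 - p) + r powr - p * m)"
        using E p by (subst ennreal_plus) (auto simp: ennreal_mult intro!: divide_nonneg_nonneg)
      then show ?thesis unfolding 1 2 by (simp add: C_def distrib_right)
    qed
    finally show ?thesis by (simp add: add_right_mono)
  qed
  moreover have "C > 0" using Cp by (simp add: C_def)
  ultimately show ?thesis using that by blast
qed

text \<open>The limit e = 0 of \<open>newton\<close> with the smooth cutoff replaced by the
  indicator of the unit ball; away from the origin it dominates every \<open>newton e\<close>. At
  the origin division by zero gives the value 0.\<close>

definition riesz :: "real^4 \<Rightarrow> real" where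
  "riesz x = indicator (ball 0 1) x / (4 * pi\<^sup>2 * (norm x)\<^sup>2)"

lemma borel_measurable_riesz [measurable]: "riesz \<in> borel_measurable borel"
  unfolding riesz_def by measurable

lemma riesz_nonneg [simp]: "0 \<le> riesz x"
  by (simp add: riesz_def)

lemma riesz_minus: "riesz (- x) = riesz x"
  by (simp add: riesz_def indicator_def)

lemma riesz_commute: "riesz (x - y) = riesz (y - x)"
  using riesz_minus[of "x - y"] by simp

text \<open>Away from both singularities the arithmetic-geometric mean inequality
  \<open>1 / (\<bar>z\<bar>\<^sup>2 \<bar>x - z\<bar>\<^sup>2) \<le> (1 / \<bar>z\<bar>\<^sup>4 + 1 / \<bar>x - z\<bar>\<^sup>4) / 2\<close> still gives the sharp constant of the logarithm.\<close>

lemma riesz_product_le: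
  fixes x z :: "real^4"
  assumes x: "x \<noteq> 0" and a: "a = (norm x)\<^sup>2 / 4"
  defines "h \<equiv> \<lambda>w::real^4. indicator {a..<1} ((norm w)\<^sup>2) * (1 / 2) / ((norm w)\<^sup>2)\<^sup>2 + indicator {0..<a} ((norm w)\<^sup>2) / ((norm w)\<^sup>2 * a)"
  shows "riesz z * riesz (x - z) \<le> (1 / (16 * pi ^ 4)) * (h z + h (x - z))"
proof (cases "norm z < 1 \<and> norm (x - z) < 1 \<and> z \<noteq> 0 \<and> x \<noteq> z")
  case False
  then have 0: "riesz z * riesz (x - z) = 0" by (auto simp: riesz_def)
  have "h w \<ge> 0" for w proof -
    have "a \<ge> 0" unfolding a by simp
    then show ?thesis unfolding h_def by (intro add_nonneg_nonneg divide_nonneg_nonneg mult_nonneg_nonneg) auto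
  qed
  then show ?thesis unfolding 0 by (intro mult_nonneg_nonneg add_nonneg_nonneg) auto
next
  case True
  define s where "s = (norm z)\<^sup>2" define t where "t = (norm (x - z))\<^sup>2"
  have s: "s > 0" "s < 1" and t: "t > 0" "t < 1"
    using True by (auto simp: s_def t_def abs_square_less_1)
  have a0: "a > 0" unfolding a using x by simp
  \<comment> \<open>If both failed, z and x - z would both be shorter than |x|/2. Hence at most one
    factor is close to its pole, and the other is at most 1/a.\<close>
  have tri: "s \<ge> a \<or> t \<ge> a"
  proof (rule ccontr)
    assume "\<not> (s \<ge> a \<or> t \<ge> a)"
    then have "(norm z)\<^sup>2 < (norm x / 2)\<^sup>2" "(norm (x - z))\<^sup>2 < (norm x / 2)\<^sup>2"
      by (auto simp: s_def t_def a power_divide)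
    then have "norm z < norm x / 2" "norm (x - z) < norm x / 2"
      using power2_less_imp_less[of "norm z" "norm x / 2"] power2_less_imp_less[of "norm (x - z)" "norm x / 2"] by auto
    moreover have "norm x \<le> norm z + norm (x - z)" by (metis norm_triangle_ineq diff_add_cancel add.commute)
    ultimately show False by simp
  qed
  have riesz: "riesz z * riesz (x - z) = (1 / (16 * pi ^ 4)) * (1 / (s * t))"
    using True by (simp add: riesz_def s_def t_def power4_eq_xxxx power2_eq_square)
  have "1 / (s * t) \<le> h z + h (x - z)"
  proof -
    consider "s \<ge> a" "t \<ge> a" | "s < a" "t \<ge> a" | "s \<ge> a" "t < a" using tri by linarith
    then show ?thesis
    proof cases
      case 1
      have "0 \<le> (1 / s - 1 / t)\<^sup>2" by simp
      then have "1 / (s * t) \<le> (1 / 2) / s\<^sup>2 + (1 / 2) / t\<^sup>2"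
        by (simp add: power2_diff power_divide) 
      then show ?thesis unfolding h_def s_def[symmetric] t_def[symmetric] using 1 s t by (simp add: indicator_def)
    next
      case 2
      have "1 / (s * t) \<le> 1 / (s * a)" using 2 s t a0 by (intro divide_left_mono mult_left_mono) auto
      then show ?thesis unfolding h_def s_def[symmetric] t_def[symmetric] using 2 s t by (simp add: indicator_def add_increasing2)
    next
      case 3
      have "1 / (s * t) \<le> 1 / (a * t)" using 3 s t a0 by (intro divide_left_mono mult_right_mono) auto
      then show ?thesis unfolding h_def s_def[symmetric] t_def[symmetric] using 3 s t by (simp add: indicator_def add_increasing mult.commute)
    qed
  qed
  then show ?thesis unfolding riesz by (intro mult_left_mono) auto
qed

definition riesz2 :: "real^4 \<Rightarrow> ennreal" where
  "riesz2 x = (\<integral>\<^sup>+z. ennreal (riesz z) * ennreal (riesz (x - z)) \<partial>lborel)"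

lemma borel_measurable_riesz2 [measurable]: "riesz2 \<in> borel_measurable borel"
  unfolding riesz2_def by measurable

lemma riesz2_eq_0:
  assumes "norm x \<ge> 2" shows "riesz2 x = 0"
proof -
  have "riesz z * riesz (x - z) = 0" for z
  proof (rule ccontr)
    assume "\<not> ?thesis"
    then have "norm z < 1" "norm (x - z) < 1" by (auto simp: riesz_def indicator_def split: if_splits)
    moreover have "norm x \<le> norm z + norm (x - z)" by (metis norm_triangle_ineq diff_add_cancel add.commute)
    ultimately show False using assms by simp
  qed
  then have "(\<lambda>z. ennreal (riesz z) * ennreal (riesz (x - z))) = (\<lambda>z. 0)"
    by (intro ext) (simp add: ennreal_mult[symmetric])
  then show ?thesis unfolding riesz2_def by simp
qed

text \<open>The shell a <= |z|^2 < 1 contributes pi^2 ln(1/a)/2 and the ball |z|^2 < a contributes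
  pi^2, for \<open>h\<close> and for its reflection alike. With ln(1/a) = 2 ln(2/|x|) the prefactor
  1/(16 pi^4) leaves ln(1/|x|)/(8 pi^2) as the leading term, with the sharp constant.\<close>

lemma riesz2_le_ln:
  assumes x: "x \<noteq> 0" "norm x < 2"
  shows "riesz2 x \<le> ennreal ((1 + ln (2 / norm x)) / (8 * pi\<^sup>2))"
proof -
  define a where "a = (norm x)\<^sup>2 / 4"
  have "(norm x)\<^sup>2 < 2\<^sup>2" using x by (intro power_strict_mono) auto
  then have a: "0 < a" "a < 1" using x by (auto simp: a_def)
  define h1 where "h1 s = (1 / 2) / s\<^sup>2" for s :: real
  define h2 where "h2 s = 1 / (s * a)" for s :: real
  define h where "h w = indicator {a..<1} ((norm w)\<^sup>2) * ennreal (h1 ((norm w)\<^sup>2)) + indicator {0..<a} ((norm w)\<^sup>2) * ennreal (h2 ((norm w)\<^sup>2))" for w :: "real^4"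
  have [measurable]: "h1 \<in> borel_measurable borel" "h2 \<in> borel_measurable borel"
    unfolding h1_def[abs_def] h2_def[abs_def] by measurable
  have [measurable]: "h \<in> borel_measurable borel" unfolding h_def by measurable
  have h: "(\<integral>\<^sup>+w. h w \<partial>lborel) \<le> ennreal (pi\<^sup>2 / 2 * ln (1 / a) + pi\<^sup>2)"
  proof -
    have "((\<lambda>s. pi\<^sup>2 / 2 * (1 / s)) has_integral (pi\<^sup>2 / 2 * ln 1 - pi\<^sup>2 / 2 * ln a)) {a..1}"
      using a by (intro fundamental_theorem_of_calculus)
        (auto intro!: derivative_eq_intros simp flip: has_real_derivative_iff_has_vector_derivative)
    then have 1: "((\<lambda>s. pi\<^sup>2 * s * h1 s) has_integral (pi\<^sup>2 / 2 * ln (1 / a))) {a..1}"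
      using a by (subst has_integral_cong[where g="\<lambda>s. pi\<^sup>2 / 2 * (1 / s)"]) (auto simp: h1_def power2_eq_square ln_div)
    have "((\<lambda>s. pi\<^sup>2 / a) has_integral (pi\<^sup>2 / a * a)) {0..a}"
      using has_integral_const_real[of "pi\<^sup>2 / a" 0 a] a by (simp add: mult.commute)
    \<comment> \<open>The integrand is constant except at s = 0, where division by zero gives
      0.\<close>
    then have 2: "((\<lambda>s. pi\<^sup>2 * s * h2 s) has_integral pi\<^sup>2) {0..a}"
      using a by (subst has_integral_spike_finite_eq[of "{0}" _ "\<lambda>s. pi\<^sup>2 / a"]) (auto simp: h2_def)
    have "(\<integral>\<^sup>+w. h w \<partial>lborel) = (\<integral>\<^sup>+w. indicator {a..<1} ((norm (w::real^4))\<^sup>2) * ennreal (h1 ((norm w)\<^sup>2)) \<partial>lborel)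
        + (\<integral>\<^sup>+w. indicator {0..<a} ((norm (w::real^4))\<^sup>2) * ennreal (h2 ((norm w)\<^sup>2)) \<partial>lborel)"
      unfolding h_def by (rule nn_integral_add) measurable
    also have "\<dots> \<le> ennreal (pi\<^sup>2 / 2 * ln (1 / a)) + ennreal (pi\<^sup>2)"
    proof (rule add_mono)
      show "(\<integral>\<^sup>+w. indicator {a..<1} ((norm (w::real^4))\<^sup>2) * ennreal (h1 ((norm w)\<^sup>2)) \<partial>lborel) \<le> ennreal (pi\<^sup>2 / 2 * ln (1 / a))"
        by (rule nn_integral_radial_interval[OF _ 1]) (use a in \<open>auto simp: h1_def[abs_def]\<close>)
      show "(\<integral>\<^sup>+w. indicator {0..<a} ((norm (w::real^4))\<^sup>2) * ennreal (h2 ((norm w)\<^sup>2)) \<partial>lborel) \<le> ennreal (pi\<^sup>2)"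
        by (rule nn_integral_radial_interval[OF _ 2]) (use a in \<open>auto simp: h2_def[abs_def]\<close>)
    qed
    finally have "(\<integral>\<^sup>+w. h w \<partial>lborel) \<le> ennreal (pi\<^sup>2 / 2 * ln (1 / a)) + ennreal (pi\<^sup>2)" .
    then show ?thesis using a by (subst ennreal_plus) auto
  qed
  have "riesz2 x \<le> (\<integral>\<^sup>+z. ennreal (1 / (16 * pi ^ 4)) * (h z + h (x - z)) \<partial>lborel)"
    unfolding riesz2_def
  proof (rule nn_integral_mono)
    fix z
    have e: "h w = ennreal (indicator {a..<1} ((norm w)\<^sup>2) * (1 / 2) / ((norm w)\<^sup>2)\<^sup>2 + indicator {0..<a} ((norm w)\<^sup>2) / ((norm w)\<^sup>2 * a))" for w
      unfolding h_def h1_def h2_def using a by (auto simp: indicator_def)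
    show "ennreal (riesz z) * ennreal (riesz (x - z)) \<le> ennreal (1 / (16 * pi ^ 4)) * (h z + h (x - z))"
      using riesz_product_le[OF x(1) a_def, of z] a unfolding e
      by (subst ennreal_plus[symmetric], simp, simp) (subst ennreal_mult[symmetric], simp, simp, subst ennreal_mult[symmetric], simp, simp, intro ennreal_leI)
  qed
  also have "\<dots> = ennreal (1 / (16 * pi ^ 4)) * ((\<integral>\<^sup>+w. h w \<partial>lborel) + (\<integral>\<^sup>+w. h w \<partial>lborel))"
    by (simp add: nn_integral_cmult nn_integral_add nn_integral_lborel_reflect)
  also have "\<dots> \<le> ennreal (1 / (16 * pi ^ 4)) * (ennreal (pi\<^sup>2 / 2 * ln (1 / a) + pi\<^sup>2) + ennreal (pi\<^sup>2 / 2 * ln (1 / a) + pi\<^sup>2))"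
    by (intro mult_left_mono add_mono h) auto
  also have "\<dots> = ennreal (1 / (16 * pi ^ 4) * (2 * (pi\<^sup>2 / 2 * ln (1 / a) + pi\<^sup>2)))"
  proof -
    define X where "X = pi\<^sup>2 / 2 * ln (1 / a) + pi\<^sup>2"
    have "X \<ge> 0" unfolding X_def using a by (intro add_nonneg_nonneg mult_nonneg_nonneg) auto
    then have "ennreal (1 / (16 * pi ^ 4)) * (ennreal X + ennreal X) = ennreal (1 / (16 * pi ^ 4) * (X + X))"
      by (subst ennreal_plus[symmetric], simp, simp, subst ennreal_mult[symmetric], simp_all)
    then show ?thesis unfolding X_def mult_2 .
  qed
  also have "1 / (16 * pi ^ 4) * (2 * (pi\<^sup>2 / 2 * ln (1 / a) + pi\<^sup>2)) = (1 + ln (2 / norm x)) / (8 * pi\<^sup>2)"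
  proof -
    have "1 / a = (2 / norm x)\<^sup>2" by (simp add: a_def power_divide)
    then have "ln (1 / a) = 2 * ln (2 / norm x)" using x by (simp add: ln_realpow)
    then show ?thesis by (simp add: power4_eq_xxxx power2_eq_square field_simps)
  qed
  finally show ?thesis .
qed

text \<open>The logarithm is linearised at the length scale exp(-a): ln y <= y - 1 with y = 2
  exp(-a)/|w| leaves the constant a and the integrable power 1/|w|. With a = ln(M/m)/4 the power
  integrates over E to a multiple of m, and the quarter in a turns 8 pi^2 into 32 pi^2. The bound
  \<open>C > ln M\<close> keeps \<open>C - ln m\<close> positive for all m <= M.\<close>

lemma nn_integral_set_riesz2:
  assumes M: "M > 0"
  obtains C where "C > 0" "C > ln M"
    "\<And>E m y. E \<in> sets borel \<Longrightarrow> emeasure lborel E = ennreal m \<Longrightarrow> 0 < m \<Longrightarrow> m \<le> M \<Longrightarrow>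
      (\<integral>\<^sup>+x. indicator E x * riesz2 (x - y) \<partial>lborel) \<le> ennreal (m * (C - ln m) / (32 * pi\<^sup>2))"
proof -
  obtain C1 where C1: "C1 > 0" "\<And>E m (y::real^4). E \<in> sets borel \<Longrightarrow> emeasure lborel E = ennreal m \<Longrightarrow> m > 0 \<Longrightarrow>
      (\<integral>\<^sup>+x. indicator E x * ennreal (norm (x - y) powr - 1) \<partial>lborel) \<le> ennreal (C1 * m powr (1 - 1 / 4))"
    using nn_integral_set_powr[of 1] by auto
  define C where "C = \<bar>ln M\<bar> + 8 * C1 / M powr (1/4)"
  have C: "C > 0" "C > ln M" proof -
    have "8 * C1 / M powr (1/4) > 0" using C1(1) M by simp
    then show "C > 0" "C > ln M" unfolding C_def by linarith+
  qed
  have "(\<integral>\<^sup>+x. indicator E x * riesz2 (x - y) \<partial>lborel) \<le> ennreal (m * (C - ln m) / (32 * pi\<^sup>2))"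
    if E: "E \<in> sets borel" "emeasure lborel E = ennreal m" "0 < m" "m \<le> M" for E m y
  proof -
    have [measurable]: "E \<in> sets borel" by fact
    define a where "a = (ln M - ln m) / 4"
    have a: "a \<ge> 0" using E M by (simp add: a_def)
    have ea: "exp (- a) = (m / M) powr (1/4)"
      proof -
      have "- a = 1 / 4 * ln (m / M)" using E M by (simp add: a_def ln_div field_simps)
      then show ?thesis using E M by (simp add: powr_def)
    qed
    have K: "riesz2 w \<le> ennreal ((a + 2 * exp (- a) * norm w powr - 1) / (8 * pi\<^sup>2))" if w: "w \<noteq> 0" for w
    proof (cases "norm w < 2")
      case True
      have "ln (2 * exp (- a) / norm w) \<le> 2 * exp (- a) / norm w - 1" using w by (intro ln_le_minus_one) auto
      moreover have "ln (2 * exp (- a) / norm w) = ln (2 / norm w) - a" using w by (simp add: ln_div ln_mult)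
      ultimately have "1 + ln (2 / norm w) \<le> a + 2 * exp (- a) * norm w powr - 1"
        using w by (simp add: powr_minus divide_inverse)
      then show ?thesis
        by (intro order_trans[OF riesz2_le_ln[OF w True]] ennreal_leI divide_right_mono) auto
    next
      case False then show ?thesis by (simp add: riesz2_eq_0)
    qed
    have "(\<integral>\<^sup>+x. indicator E x * riesz2 (x - y) \<partial>lborel) \<le>
       (\<integral>\<^sup>+x. ennreal (a / (8 * pi\<^sup>2)) * indicator E x + ennreal (2 * exp (- a) / (8 * pi\<^sup>2)) * (indicator E x * ennreal (norm (x - y) powr - 1)) \<partial>lborel)"
    proof (rule nn_integral_mono_AE)
      show "AE x in lborel. indicator E x * riesz2 (x - y) \<le> ennreal (a / (8 * pi\<^sup>2)) * indicator E x + ennreal (2 * exp (- a) / (8 * pi\<^sup>2)) * (indicator E x * ennreal (norm (x - y) powr - 1))"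
        using AE_lborel_singleton[of y]
      proof eventually_elim
        case (elim x)
        have "ennreal ((a + 2 * exp (- a) * norm (x - y) powr - 1) / (8 * pi\<^sup>2)) = ennreal (a / (8 * pi\<^sup>2)) + ennreal (2 * exp (- a) / (8 * pi\<^sup>2)) * ennreal (norm (x - y) powr - 1)"
          using a by (subst ennreal_mult[symmetric], simp, simp, subst ennreal_plus[symmetric], simp, simp) (simp add: add_divide_distrib)
        then show ?case using K[of "x - y"] elim by (auto simp: indicator_def)
      qed
    qed
    also have "\<dots> = ennreal (a / (8 * pi\<^sup>2)) * ennreal m + ennreal (2 * exp (- a) / (8 * pi\<^sup>2)) * (\<integral>\<^sup>+x. indicator E x * ennreal (norm (x - y) powr - 1) \<partial>lborel)"
      by (simp add: nn_integral_add nn_integral_cmult nn_integral_cmult_indicator E(2))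
    also have "\<dots> \<le> ennreal (a / (8 * pi\<^sup>2)) * ennreal m + ennreal (2 * exp (- a) / (8 * pi\<^sup>2)) * ennreal (C1 * m powr (1 - 1 / 4))"
      by (intro add_left_mono mult_left_mono C1 E) auto
    also have "\<dots> = ennreal (a / (8 * pi\<^sup>2) * m + 2 * exp (- a) / (8 * pi\<^sup>2) * (C1 * m powr (1 - 1 / 4)))"
      using a C1(1) E by (intro ennreal_mult_add_mult) auto
    also have "\<dots> \<le> ennreal (m * (C - ln m) / (32 * pi\<^sup>2))"
    proof (rule ennreal_leI)
      have "m powr (1/4) * m powr (1 - 1/4) = m" unfolding powr_add[symmetric] using E by simp
      then have e: "exp (- a) * m powr (1 - 1/4) = m / M powr (1/4)"
        unfolding ea using E M by (simp add: powr_divide)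
      have "a / (8 * pi\<^sup>2) * m + 2 * exp (- a) / (8 * pi\<^sup>2) * (C1 * m powr (1 - 1 / 4))
        = (a * m + 2 * C1 * (exp (- a) * m powr (1 - 1/4))) / (8 * pi\<^sup>2)" by (simp add: add_divide_distrib mult_ac)
      also have "\<dots> = m * (ln M - ln m + 8 * C1 / M powr (1/4)) / (32 * pi\<^sup>2)"
        unfolding e by (simp add: a_def field_simps)
      also have "\<dots> \<le> m * (C - ln m) / (32 * pi\<^sup>2)"
        unfolding C_def using E by (intro divide_right_mono mult_left_mono) auto
      finally show "a / (8 * pi\<^sup>2) * m + 2 * exp (- a) / (8 * pi\<^sup>2) * (C1 * m powr (1 - 1 / 4)) \<le> m * (C - ln m) / (32 * pi\<^sup>2)" .
    qed
    finally show ?thesis .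
  qed
  with C that show ?thesis by blast
qed

section \<open>The two-level inequality and the critical exponent\<close>

text \<open>For levels i <= k that both lie within L of the diagonal the inequality leaves sqrt(ik)
  <= i + 2L, hence k <= i + 4L + 4L^2/i. Once i > 2L, this confines all such k to a window of length
  6L above the smallest one.\<close>

lemma card_near_diagonal:
  fixes T :: "nat \<Rightarrow> real"
  assumes fin: "finite I" and I: "\<And>k. k \<in> I \<Longrightarrow> k \<ge> 1"
    and T: "\<And>i k. i \<in> I \<Longrightarrow> k \<in> I \<Longrightarrow> i \<le> k \<Longrightarrow> (sqrt (real i) + sqrt (real k))\<^sup>2 \<le> 3 * T i + T k"
    and L: "L \<ge> 1"
  shows "card {k \<in> I. T k - real k \<le> real L} \<le> 9 * L"
proof -
  define S where "S = {k \<in> I. T k - real k \<le> real L}"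
  define S' where "S' = {k \<in> S. k > 2 * L}"
  have finS: "finite S" "finite S'" using fin by (auto simp: S_def S'_def)
  show ?thesis
  proof (cases "S' = {}")
    case True
    then have "S \<subseteq> {1..2 * L}" using I by (force simp: S_def S'_def)
    then have "card S \<le> card {1..2 * L}" by (intro card_mono) auto
    then show ?thesis by (simp add: S_def)
  next
    case False
    define i where "i = Min S'"
    have i: "i \<in> S'" "\<And>k. k \<in> S' \<Longrightarrow> i \<le> k" using False finS by (auto simp: i_def)
    have "k \<le> i + 6 * L" if k: "k \<in> S'" for k
    proof -
      have ik: "i \<le> k" "i > 2 * L" "i \<in> I" "k \<in> I" "T i \<le> real i + real L" "T k \<le> real k + real L"
        using i k by (auto simp: S'_def S_def)
      have "(sqrt (real i) + sqrt (real k))\<^sup>2 = real i + real k + 2 * sqrt (real i * real k)"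
        by (simp add: power2_sum real_sqrt_mult)
      then have "sqrt (real i * real k) \<le> real i + 2 * real L"
        using T[OF ik(3,4,1)] ik(5,6) by linarith
      then have "real i * real k \<le> (real i + 2 * real L)\<^sup>2"
        by (rule sqrt_le_D)
      also have "\<dots> = real i * (real i + 4 * real L) + (2 * real L) * (2 * real L)"
        by (simp add: power2_eq_square algebra_simps)
      also have "(2 * real L) * (2 * real L) \<le> real i * (2 * real L)"
        using ik(2) by (intro mult_right_mono) auto
      finally have "real i * real k \<le> real i * (real i + 6 * real L)" by (simp add: algebra_simps)
      then have "real k \<le> real i + 6 * real L" using ik(2) by (simp add: mult_le_cancel_left)
      then show ?thesis by linarith
    qed
    then have "S \<subseteq> {1..2 * L} \<union> {i..i + 6 * L}"
      using I i(2) by (force simp: S_def S'_def)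
    then have "card S \<le> card ({1..2 * L} \<union> {i..i + 6 * L})" by (intro card_mono) auto
    also have "\<dots> \<le> card {1..2 * L} + card {i..i + 6 * L}" by (rule card_Un_le)
    \<comment> \<open>There are 2L small levels and 6L + 1 in the window; L >= 1 absorbs the extra
      one.\<close>
    also have "\<dots> \<le> 9 * L" using L by simp
    finally show ?thesis by (simp add: S_def)
  qed
qed

text \<open>Sort the levels by the rounded-up distance l of \<open>T k\<close> from k. At most 9(j +
  1) of them have l = j, and each contributes at most exp(\<theta>(1 - j)). The series of (j + 1)
  r^j converges for r < 1, so the bound depends on \<theta> alone.\<close>

lemma sum_exp_near_diagonal:
  fixes \<theta> :: real
  assumes \<theta>: "\<theta> > 0"
  obtains K where "K \<ge> 0" "\<And>(I :: nat set) T. finite I \<Longrightarrow> (\<And>k. k \<in> I \<Longrightarrow> k \<ge> 1) \<Longrightarrow>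
    (\<And>i k. i \<in> I \<Longrightarrow> k \<in> I \<Longrightarrow> i \<le> k \<Longrightarrow> (sqrt (real i) + sqrt (real k))\<^sup>2 \<le> 3 * T i + T k) \<Longrightarrow>
    (\<Sum>k\<in>I. exp (\<theta> * (real k - T k))) \<le> K"
proof -
  define r where "r = exp (- \<theta>)"
  have r: "0 < r" "r < 1" using \<theta> by (auto simp: r_def)
  have sums: "(\<lambda>n. of_nat (Suc n) * r ^ n) sums (1 / (1 - r)\<^sup>2)"
    by (rule geometric_deriv_sums) (use r in auto)
  define K where "K = exp \<theta> * (9 * (1 / (1 - r)\<^sup>2))"
  have "(\<Sum>k\<in>I. exp (\<theta> * (real k - T k))) \<le> K"
    if fin: "finite I" and I: "\<And>k. k \<in> I \<Longrightarrow> k \<ge> 1"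
    and T: "\<And>i k. i \<in> I \<Longrightarrow> k \<in> I \<Longrightarrow> i \<le> k \<Longrightarrow> (sqrt (real i) + sqrt (real k))\<^sup>2 \<le> 3 * T i + T k"
    for I T
  proof -
    \<comment> \<open>The case i = k of the two-level inequality reads 4k <= 4 T k.\<close>
    have l0: "T k - real k \<ge> 0" if "k \<in> I" for k
      using T[OF that that] by (simp add: power2_eq_square algebra_simps)
    define l where "l k = nat \<lceil>T k - real k\<rceil>" for k
    have l: "T k - real k \<le> real (l k)" "real (l k) \<le> T k - real k + 1" if "k \<in> I" for k
      using l0[OF that] unfolding l_def by linarith+
    have card: "card {k \<in> I. l k = j} \<le> 9 * Suc j" for j
    proof -
      have "{k \<in> I. l k = j} \<subseteq> {k \<in> I. T k - real k \<le> real (Suc j)}" using l(1) by force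
      then have "card {k \<in> I. l k = j} \<le> card {k \<in> I. T k - real k \<le> real (Suc j)}"
        using fin by (intro card_mono) auto
      \<comment> \<open>Counting with \<open>Suc j\<close> in place of j meets the condition L >= 1
        also for j = 0.\<close>
      also have "\<dots> \<le> 9 * Suc j" by (rule card_near_diagonal[OF fin I T]) auto
      finally show ?thesis .
    qed
    have "(\<Sum>k\<in>I. exp (\<theta> * (real k - T k))) \<le> (\<Sum>k\<in>I. exp \<theta> * r ^ l k)"
    proof (rule sum_mono)
      fix k assume k: "k \<in> I"
      have "\<theta> * (real k - T k) \<le> \<theta> * (1 - real (l k))"
        using l(2)[OF k] \<theta> by (intro mult_left_mono) auto
      then have "exp (\<theta> * (real k - T k)) \<le> exp (\<theta> + real (l k) * (- \<theta>))" by (simp add: algebra_simps)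
      then show "exp (\<theta> * (real k - T k)) \<le> exp \<theta> * r ^ l k"
        unfolding r_def exp_add exp_of_nat_mult .
    qed
    also have "\<dots> = (\<Sum>j\<in>l ` I. \<Sum>k\<in>{k \<in> I. l k = j}. exp \<theta> * r ^ l k)"
      by (rule sum.image_gen[OF fin])
    also have "\<dots> = (\<Sum>j\<in>l ` I. real (card {k \<in> I. l k = j}) * (exp \<theta> * r ^ j))"
      by (intro sum.cong) (auto simp: sum.If_cases)
    also have "\<dots> \<le> (\<Sum>j\<in>l ` I. exp \<theta> * 9 * (of_nat (Suc j) * r ^ j))"
    proof (rule sum_mono)
      fix j
      have "real (card {k \<in> I. l k = j}) \<le> 9 * real (Suc j)" using card[of j] by linarith
      then have "real (card {k \<in> I. l k = j}) * (exp \<theta> * r ^ j) \<le> 9 * real (Suc j) * (exp \<theta> * r ^ j)"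
        using r by (intro mult_right_mono) auto
      then show "real (card {k \<in> I. l k = j}) * (exp \<theta> * r ^ j) \<le> exp \<theta> * 9 * (of_nat (Suc j) * r ^ j)"
        by (simp only: mult_ac)
    qed
    also have "\<dots> = exp \<theta> * 9 * (\<Sum>j\<in>l ` I. of_nat (Suc j) * r ^ j)" by (simp only: sum_distrib_left)
    also have "(\<Sum>j\<in>l ` I. of_nat (Suc j) * r ^ j) \<le> (\<Sum>j. of_nat (Suc j) * r ^ j)"
      by (rule sum_le_suminf[OF sums_summable[OF sums]]) (use fin r in auto)
    also have "(\<Sum>j. of_nat (Suc j) * r ^ j) = 1 / (1 - r)\<^sup>2" using sums by (rule sums_unique[symmetric])
    finally show ?thesis by (simp add: K_def)
  qed
  moreover have "K \<ge> 0" by (simp add: K_def)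
  ultimately show ?thesis using that by blast
qed

text \<open>The majorant of \<open>\<bar>u\<bar>\<close> when \<open>f\<close> is the Laplacian of \<open>u\<close>.\<close>

definition pot :: "real \<Rightarrow> (real^4 \<Rightarrow> real) \<Rightarrow> (real^4 \<Rightarrow> real) \<Rightarrow> real^4 \<Rightarrow> ennreal" where
  "pot c f u y = (\<integral>\<^sup>+x. ennreal (riesz (x - y)) * ennreal \<bar>f x\<bar> \<partial>lborel)
     + ennreal c * (\<integral>\<^sup>+x. indicator (ball 0 1) (x - y) * ennreal \<bar>u x\<bar> \<partial>lborel)"

section \<open>Duality with averaged Riesz potentials\<close>

lemma borel_measurable_pot:
  assumes [measurable]: "f \<in> borel_measurable borel" "u \<in> borel_measurable borel"
  shows "pot c f u \<in> borel_measurable borel"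
  unfolding pot_def by measurable

lemma nn_integral_ball: "(\<integral>\<^sup>+x. indicator (ball 0 1) (x - y) \<partial>lborel) = ennreal (pi\<^sup>2 / 2)" for y :: "real^4"
  using nn_integral_lborel_shift[of "indicator (ball 0 1)" y]
  by (simp add: emeasure_ball unit_ball_vol_4)

text \<open>Fubini, with the convolution of two Riesz kernels recognised as \<open>riesz2\<close>.
  This is the Gram matrix entry of E and F before division by their measures.\<close>

lemma riesz_potential_inner:
  fixes E F :: "(real^4) set"
  assumes [measurable]: "E \<in> sets borel" "F \<in> sets borel"
  shows "(\<integral>\<^sup>+x. (\<integral>\<^sup>+y. indicator E y * ennreal (riesz (x - y)) \<partial>lborel) * (\<integral>\<^sup>+y. indicator F y * ennreal (riesz (x - y)) \<partial>lborel) \<partial>lborel)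
    = (\<integral>\<^sup>+y. indicator E y * (\<integral>\<^sup>+z. indicator F z * riesz2 (z - y) \<partial>lborel) \<partial>lborel)"
proof -
  have r: "(\<integral>\<^sup>+x. ennreal (riesz (x - y)) * ennreal (riesz (x - z)) \<partial>lborel) = riesz2 (z - y)" for y z
  proof -
    have "(\<integral>\<^sup>+x. ennreal (riesz (x - y)) * ennreal (riesz (x - z)) \<partial>lborel)
      = (\<integral>\<^sup>+x. ennreal (riesz (x - y)) * ennreal (riesz ((z - y) - (x - y))) \<partial>lborel)"
      by (simp add: riesz_commute[of z])
    also have "\<dots> = (\<integral>\<^sup>+x. ennreal (riesz x) * ennreal (riesz ((z - y) - x)) \<partial>lborel)"
      by (rule nn_integral_lborel_shift[of "\<lambda>x. ennreal (riesz x) * ennreal (riesz ((z - y) - x))"]) measurable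
    finally show ?thesis by (simp add: riesz2_def)
  qed
  have "(\<integral>\<^sup>+x. (\<integral>\<^sup>+y. indicator E y * ennreal (riesz (x - y)) \<partial>lborel) * (\<integral>\<^sup>+y. indicator F y * ennreal (riesz (x - y)) \<partial>lborel) \<partial>lborel)
    = (\<integral>\<^sup>+x. (\<integral>\<^sup>+y. (\<integral>\<^sup>+z. indicator E y * ennreal (riesz (x - y)) * (indicator F z * ennreal (riesz (x - z))) \<partial>lborel) \<partial>lborel) \<partial>lborel)"
    by (simp add: nn_integral_cmult nn_integral_multc)
  also have "\<dots> = (\<integral>\<^sup>+y. (\<integral>\<^sup>+x. (\<integral>\<^sup>+z. indicator E y * ennreal (riesz (x - y)) * (indicator F z * ennreal (riesz (x - z))) \<partial>lborel) \<partial>lborel) \<partial>lborel)"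
    by (rule lborel_pair.Fubini') measurable
  also have "\<dots> = (\<integral>\<^sup>+y. (\<integral>\<^sup>+z. (\<integral>\<^sup>+x. indicator E y * ennreal (riesz (x - y)) * (indicator F z * ennreal (riesz (x - z))) \<partial>lborel) \<partial>lborel) \<partial>lborel)"
    by (intro nn_integral_cong lborel_pair.Fubini') measurable
  also have "\<dots> = (\<integral>\<^sup>+y. (\<integral>\<^sup>+z. indicator E y * (indicator F z * riesz2 (z - y)) \<partial>lborel) \<partial>lborel)"
  proof (intro nn_integral_cong)
    fix y z
    have "(\<integral>\<^sup>+x. indicator E y * ennreal (riesz (x - y)) * (indicator F z * ennreal (riesz (x - z))) \<partial>lborel)
      = (\<integral>\<^sup>+x. (indicator E y * indicator F z) * (ennreal (riesz (x - y)) * ennreal (riesz (x - z))) \<partial>lborel)"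
      by (simp only: mult_ac)
    also have "\<dots> = indicator E y * indicator F z * riesz2 (z - y)"
      by (subst nn_integral_cmult) (simp_all add: r)
    finally show "(\<integral>\<^sup>+x. indicator E y * ennreal (riesz (x - y)) * (indicator F z * ennreal (riesz (x - z))) \<partial>lborel)
      = indicator E y * (indicator F z * riesz2 (z - y))" by (simp only: mult_ac)
  qed
  finally show ?thesis by (simp add: nn_integral_cmult)
qed

text \<open>A substitute for the Cauchy-Schwarz inequality that stays valid for infinite b and
  infinite integrals: the pointwise inequality is integrated, and the best t is chosen
  afterwards.\<close>

lemma ennreal_AM_GM:
  fixes b :: ennreal
  assumes t: "t > 0"
  shows "ennreal \<bar>a\<bar> * b \<le> ennreal (t / 2) * ennreal (a\<^sup>2) + ennreal (1 / (2 * t)) * b\<^sup>2"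
proof (cases b)
  case (real r)
  have "0 \<le> (t * \<bar>a\<bar> - r)\<^sup>2" by simp
  also have "\<dots> = t\<^sup>2 * a\<^sup>2 - 2 * (t * (\<bar>a\<bar> * r)) + r\<^sup>2"
    by (simp add: power2_eq_square algebra_simps)
  finally have "2 * t * (\<bar>a\<bar> * r) \<le> t\<^sup>2 * a\<^sup>2 + r\<^sup>2" by simp
  also have "\<dots> = 2 * t * (t / 2 * a\<^sup>2 + 1 / (2 * t) * r\<^sup>2)"
    using t by (simp add: distrib_left power2_eq_square)
  finally have "\<bar>a\<bar> * r \<le> t / 2 * a\<^sup>2 + 1 / (2 * t) * r\<^sup>2"
    using t by (simp add: mult_le_cancel_left)
  moreover have "ennreal (t / 2) * ennreal (a\<^sup>2) + ennreal (1 / (2 * t)) * b\<^sup>2 = ennreal (t / 2 * a\<^sup>2 + 1 / (2 * t) * r\<^sup>2)"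
    unfolding real ennreal_power[OF real(1)] using t by (intro ennreal_mult_add_mult) auto
  moreover have "ennreal \<bar>a\<bar> * b = ennreal (\<bar>a\<bar> * r)" using real by (simp add: ennreal_mult)
  ultimately show ?thesis by (simp only: ennreal_leI)
next
  case top
  have "ennreal (1 / (2 * t)) * b\<^sup>2 = top" using t top by (simp add: power2_eq_square ennreal_mult_eq_top_iff ennreal_top_mult)
  then show ?thesis by simp
qed

text \<open>Pairing \<open>pot\<close> with the normalised indicators moves the kernels onto them: f
  is tested against \<open>K\<close> and u against \<open>c * H\<close>. For the energy with weight
  \<sigma> on u the dual quadratic form is |K|^2 + c^2 |H|^2 / \<sigma>. Its first part carries the
  logarithms, its second part is bounded.\<close>

lemma two_level_inequality:
  fixes \<sigma> c :: real and E1 E2 :: "(real^4) set"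
  assumes [measurable]: "f \<in> borel_measurable borel" "u \<in> borel_measurable borel"
      "E1 \<in> sets borel" "E2 \<in> sets borel"
    and energy: "(\<integral>\<^sup>+x. ennreal ((f x)\<^sup>2) \<partial>lborel) + ennreal \<sigma> * (\<integral>\<^sup>+x. ennreal ((u x)\<^sup>2) \<partial>lborel) \<le> 1"
    and \<sigma>: "\<sigma> > 0" and c: "c > 0"
    and m: "emeasure lborel E1 = ennreal m1" "emeasure lborel E2 = ennreal m2" "0 < m1" "0 < m2" 
    and mM: "m1 \<le> M" "m2 \<le> M" and D: "D > ln M"
    and R: "\<And>E m y. E \<in> sets borel \<Longrightarrow> emeasure lborel E = ennreal m \<Longrightarrow> 0 < m \<Longrightarrow> m \<le> M \<Longrightarrow>
      (\<integral>\<^sup>+x. indicator E x * riesz2 (x - y) \<partial>lborel) \<le> ennreal (m * (D - ln m) / (32 * pi\<^sup>2))"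
    and s: "0 \<le> s1" "0 \<le> s2"
    and lev1: "ennreal s1 * ennreal m1 \<le> (\<integral>\<^sup>+y. indicator E1 y * pot c f u y \<partial>lborel)"
    and lev2: "ennreal s2 * ennreal m2 \<le> (\<integral>\<^sup>+y. indicator E2 y * pot c f u y \<partial>lborel)"
  shows "32 * pi\<^sup>2 * (s1 + s2)\<^sup>2 \<le> 3 * (D - ln m1) + (D - ln m2) + 64 * pi ^ 4 * c\<^sup>2 / \<sigma>"
proof -
  define \<phi> where "\<phi> y = ennreal (1 / m1) * indicator E1 y + ennreal (1 / m2) * indicator E2 y" for y
  have [measurable]: "\<phi> \<in> borel_measurable borel" unfolding \<phi>_def by measurable
  have [measurable]: "pot c f u \<in> borel_measurable borel" by (rule borel_measurable_pot) measurable
  define P where "P E x = (\<integral>\<^sup>+y. indicator E y * ennreal (riesz (x - y)) \<partial>lborel)" for E and x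
  define K where "K x = (\<integral>\<^sup>+y. \<phi> y * ennreal (riesz (x - y)) \<partial>lborel)" for x
  define H where "H x = (\<integral>\<^sup>+y. \<phi> y * indicator (ball 0 1) (x - y) \<partial>lborel)" for x
  have [measurable]: "K \<in> borel_measurable borel" "H \<in> borel_measurable borel"
    unfolding K_def H_def by measurable
  have Pm [measurable]: "P E \<in> borel_measurable borel" if "E \<in> sets borel" for E
    unfolding P_def using that by measurable
  have K: "K x = ennreal (1 / m1) * P E1 x + ennreal (1 / m2) * P E2 x" for x
  proof -
    have "K x = (\<integral>\<^sup>+y. ennreal (1 / m1) * (indicator E1 y * ennreal (riesz (x - y))) + ennreal (1 / m2) * (indicator E2 y * ennreal (riesz (x - y))) \<partial>lborel)"
      unfolding K_def \<phi>_def by (simp only: distrib_right mult.assoc)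
    then show ?thesis unfolding P_def by (simp add: nn_integral_add nn_integral_cmult)
  qed
  \<comment> \<open>The bound involves the logarithm of only one of the two sets, and either may be
    taken. Both mixed terms below are charged to \<open>E1\<close>, which produces the coefficients
    3 and 1.\<close>
  have G: "(\<integral>\<^sup>+x. P E x * P F x \<partial>lborel) \<le> ennreal (n * m * (D - ln m) / (32 * pi\<^sup>2))"
    if [measurable]: "E \<in> sets borel" "F \<in> sets borel" and mm: "emeasure lborel E = ennreal n" "emeasure lborel F = ennreal m" "0 < n" "0 < m" "m \<le> M"
    for E F n m
  proof -
    have dm: "0 \<le> D - ln m" using mm D by (smt (verit) ln_le_cancel_iff)
    have "(\<integral>\<^sup>+x. P E x * P F x \<partial>lborel) = (\<integral>\<^sup>+y. indicator E y * (\<integral>\<^sup>+z. indicator F z * riesz2 (z - y) \<partial>lborel) \<partial>lborel)"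
      unfolding P_def by (rule riesz_potential_inner) measurable
    also have "\<dots> \<le> (\<integral>\<^sup>+y. ennreal (m * (D - ln m) / (32 * pi\<^sup>2)) * indicator E y \<partial>lborel)"
      using R[OF that(2) mm(2,4,5)] by (intro nn_integral_mono) (auto split: split_indicator)
    also have "\<dots> = ennreal (m * (D - ln m) / (32 * pi\<^sup>2)) * ennreal n" by (simp add: nn_integral_cmult_indicator mm)
    also have "\<dots> = ennreal (n * m * (D - ln m) / (32 * pi\<^sup>2))"
      using mm dm by (subst ennreal_mult[symmetric]) (auto simp: mult_ac)
    finally show ?thesis .
  qed
  have KK: "(\<integral>\<^sup>+x. (K x)\<^sup>2 \<partial>lborel) \<le> ennreal ((3 * (D - ln m1) + (D - ln m2)) / (32 * pi\<^sup>2))"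
  proof -
    have d: "0 \<le> D - ln m1" "0 \<le> D - ln m2" using m mM D by (smt (verit) ln_le_cancel_iff)+
    let ?a = "ennreal (1 / m1)" and ?b = "ennreal (1 / m2)"
    have "(\<integral>\<^sup>+x. (K x)\<^sup>2 \<partial>lborel) = (\<integral>\<^sup>+x. (?a * ?a) * (P E1 x * P E1 x) + (?b * ?a) * (P E2 x * P E1 x)
      + (?b * ?a) * (P E2 x * P E1 x) + (?b * ?b) * (P E2 x * P E2 x) \<partial>lborel)"
      unfolding K power2_eq_square by (simp only: distrib_left distrib_right) (simp only: mult_ac add_ac)
    also have "\<dots> = (?a * ?a) * (\<integral>\<^sup>+x. P E1 x * P E1 x \<partial>lborel) + (?b * ?a) * (\<integral>\<^sup>+x. P E2 x * P E1 x \<partial>lborel)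
      + (?b * ?a) * (\<integral>\<^sup>+x. P E2 x * P E1 x \<partial>lborel) + (?b * ?b) * (\<integral>\<^sup>+x. P E2 x * P E2 x \<partial>lborel)"
      by (simp add: nn_integral_add nn_integral_cmult)
    also have "\<dots> \<le> (?a * ?a) * ennreal (m1 * m1 * (D - ln m1) / (32 * pi\<^sup>2)) + (?b * ?a) * ennreal (m2 * m1 * (D - ln m1) / (32 * pi\<^sup>2))
      + (?b * ?a) * ennreal (m2 * m1 * (D - ln m1) / (32 * pi\<^sup>2)) + (?b * ?b) * ennreal (m2 * m2 * (D - ln m2) / (32 * pi\<^sup>2))"
      by (intro add_mono mult_left_mono G m mM) auto
    also have "\<dots> = ennreal ((D - ln m1) / (32 * pi\<^sup>2)) + ennreal ((D - ln m1) / (32 * pi\<^sup>2)) + ennreal ((D - ln m1) / (32 * pi\<^sup>2)) + ennreal ((D - ln m2) / (32 * pi\<^sup>2))"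
      using m by (simp add: ennreal_mult'[symmetric])
    also have "\<dots> = ennreal ((3 * (D - ln m1) + (D - ln m2)) / (32 * pi\<^sup>2))"
    proof -
      have e: "(3 * (D - ln m1) + (D - ln m2)) / (32 * pi\<^sup>2) = (D - ln m1) / (32 * pi\<^sup>2) + (D - ln m1) / (32 * pi\<^sup>2) + (D - ln m1) / (32 * pi\<^sup>2) + (D - ln m2) / (32 * pi\<^sup>2)"
        by (simp add: field_simps)
      have "ennreal p + ennreal p' + ennreal r + ennreal q = ennreal (p + p' + r + q)"
        if "0 \<le> p" "0 \<le> p'" "0 \<le> r" "0 \<le> q" for p p' r q
        using that by simp
      then show ?thesis unfolding e using d by (meson divide_nonneg_nonneg mult_nonneg_nonneg zero_le_numeral zero_le_power2)
    qed
    finally show ?thesis .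
  qed
  have phi: "(\<integral>\<^sup>+y. \<phi> y \<partial>lborel) = 2"
  proof -
    have "(\<integral>\<^sup>+y. \<phi> y \<partial>lborel) = ennreal (1 / m1) * ennreal m1 + ennreal (1 / m2) * ennreal m2"
      unfolding \<phi>_def by (simp add: nn_integral_add nn_integral_cmult_indicator m)
    also have "\<dots> = 2" using m by (simp add: ennreal_mult'[symmetric])
    finally show ?thesis .
  qed
  \<comment> \<open>\<open>H\<close> is at most the total mass 2 of \<phi>, and its integral is that
    mass times the volume pi^2/2 of the unit ball.\<close>
  have HH: "(\<integral>\<^sup>+x. (H x)\<^sup>2 \<partial>lborel) \<le> ennreal (2 * pi\<^sup>2)"
  proof -
    have H2: "H x \<le> 2" for x
      unfolding phi[symmetric] H_def by (intro nn_integral_mono) (auto simp: indicator_def)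
    have "(\<integral>\<^sup>+x. (H x)\<^sup>2 \<partial>lborel) \<le> (\<integral>\<^sup>+x. 2 * H x \<partial>lborel)"
      unfolding power2_eq_square by (intro nn_integral_mono mult_right_mono H2) auto
    also have "\<dots> = 2 * (\<integral>\<^sup>+x. H x \<partial>lborel)" by (simp add: nn_integral_cmult)
    also have "(\<integral>\<^sup>+x. H x \<partial>lborel) = (\<integral>\<^sup>+y. (\<integral>\<^sup>+x. \<phi> y * indicator (ball 0 1) (x - y) \<partial>lborel) \<partial>lborel)"
      unfolding H_def by (rule lborel_pair.Fubini') measurable
    also have "\<dots> = (\<integral>\<^sup>+y. \<phi> y * ennreal (pi\<^sup>2 / 2) \<partial>lborel)"
      by (simp add: nn_integral_cmult nn_integral_ball)
    also have "\<dots> = 2 * ennreal (pi\<^sup>2 / 2)" by (simp add: nn_integral_multc phi)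
    also have "2 * (2 * ennreal (pi\<^sup>2 / 2)) = ennreal (2 * pi\<^sup>2)"
    proof -
      have "ennreal 2 * (ennreal 2 * ennreal (pi\<^sup>2 / 2)) = ennreal (2 * (2 * (pi\<^sup>2 / 2)))"
        by (simp only: ennreal_mult[symmetric] zero_le_numeral zero_le_power2 divide_nonneg_nonneg mult_nonneg_nonneg)
      then show ?thesis by simp
    qed
    finally show ?thesis .
  qed
  have lower: "ennreal (s1 + s2) \<le> (\<integral>\<^sup>+y. \<phi> y * pot c f u y \<partial>lborel)"
  proof -
    have "ennreal s = ennreal (1 / m) * (ennreal s * ennreal m)" if "m > 0" "s \<ge> 0" for s m
      using that by (simp add: ennreal_mult[symmetric])
    then have "ennreal (s1 + s2) = ennreal (1 / m1) * (ennreal s1 * ennreal m1) + ennreal (1 / m2) * (ennreal s2 * ennreal m2)"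
      using s m by (metis ennreal_plus)
    also have "\<dots> \<le> ennreal (1 / m1) * (\<integral>\<^sup>+y. indicator E1 y * pot c f u y \<partial>lborel) + ennreal (1 / m2) * (\<integral>\<^sup>+y. indicator E2 y * pot c f u y \<partial>lborel)"
      by (intro add_mono mult_left_mono lev1 lev2) auto
    also have "\<dots> = (\<integral>\<^sup>+y. \<phi> y * pot c f u y \<partial>lborel)"
      unfolding \<phi>_def distrib_right mult.assoc by (simp add: nn_integral_add nn_integral_cmult)
    finally show ?thesis .
  qed
  have dual: "(\<integral>\<^sup>+y. \<phi> y * pot c f u y \<partial>lborel) = (\<integral>\<^sup>+x. ennreal \<bar>f x\<bar> * K x + ennreal \<bar>u x\<bar> * (ennreal c * H x) \<partial>lborel)"
  proof -
    have "(\<integral>\<^sup>+y. \<phi> y * pot c f u y \<partial>lborel) =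
      (\<integral>\<^sup>+y. (\<integral>\<^sup>+x. \<phi> y * (ennreal (riesz (x - y)) * ennreal \<bar>f x\<bar>) + \<phi> y * (ennreal c * (indicator (ball 0 1) (x - y) * ennreal \<bar>u x\<bar>)) \<partial>lborel) \<partial>lborel)"
      unfolding pot_def by (simp add: nn_integral_add nn_integral_cmult distrib_left)
    also have "\<dots> = (\<integral>\<^sup>+x. (\<integral>\<^sup>+y. \<phi> y * (ennreal (riesz (x - y)) * ennreal \<bar>f x\<bar>) + \<phi> y * (ennreal c * (indicator (ball 0 1) (x - y) * ennreal \<bar>u x\<bar>)) \<partial>lborel) \<partial>lborel)"
      by (rule lborel_pair.Fubini') measurable
    also have "\<dots> = (\<integral>\<^sup>+x. (\<integral>\<^sup>+y. ennreal \<bar>f x\<bar> * (\<phi> y * ennreal (riesz (x - y))) + ennreal \<bar>u x\<bar> * (ennreal c * (\<phi> y * indicator (ball 0 1) (x - y))) \<partial>lborel) \<partial>lborel)"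
      by (simp only: mult_ac)
    also have "\<dots> = (\<integral>\<^sup>+x. ennreal \<bar>f x\<bar> * K x + ennreal \<bar>u x\<bar> * (ennreal c * H x) \<partial>lborel)"
      unfolding K_def H_def by (simp add: nn_integral_add nn_integral_cmult)
    finally show ?thesis .
  qed
  define Q where "Q = (3 * (D - ln m1) + (D - ln m2)) / (32 * pi\<^sup>2) + c\<^sup>2 / \<sigma> * (2 * pi\<^sup>2)"
  have Q0: "0 \<le> (3 * (D - ln m1) + (D - ln m2)) / (32 * pi\<^sup>2)"
  proof -
    have "0 \<le> D - ln m1" "0 \<le> D - ln m2" using m mM D by (smt (verit) ln_le_cancel_iff)+
    then show ?thesis by simp
  qed
  then have Q: "Q > 0" unfolding Q_def using c \<sigma> by (intro add_nonneg_pos) auto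
  \<comment> \<open>The bound t/2 + Q/(2t) obtained from energy at most 1 is smallest at t = sqrt Q,
    where it equals t.\<close>
  define t where "t = sqrt Q"
  have t: "t > 0" "t\<^sup>2 = Q" using Q by (auto simp: t_def)
  \<comment> \<open>Using t for f and t times \<sigma> for u reproduces the weight \<sigma> of the
    energy and puts c^2/\<sigma> on the dual side.\<close>
  have pw: "ennreal \<bar>f x\<bar> * K x + ennreal \<bar>u x\<bar> * (ennreal c * H x) \<le>
    ennreal (t / 2) * (ennreal ((f x)\<^sup>2) + ennreal \<sigma> * ennreal ((u x)\<^sup>2)) + ennreal (1 / (2 * t)) * ((K x)\<^sup>2 + ennreal (c\<^sup>2 / \<sigma>) * (H x)\<^sup>2)" for x
  proof -
    have "ennreal \<bar>u x\<bar> * (ennreal c * H x) \<le> ennreal (t * \<sigma> / 2) * ennreal ((u x)\<^sup>2) + ennreal (1 / (2 * (t * \<sigma>))) * (ennreal c * H x)\<^sup>2"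
      using t \<sigma> by (intro ennreal_AM_GM) auto
    also have "ennreal (t * \<sigma> / 2) = ennreal (t / 2) * ennreal \<sigma>"
      using t \<sigma> by (subst ennreal_mult[symmetric]) auto
    also have "ennreal (1 / (2 * (t * \<sigma>))) * (ennreal c * H x)\<^sup>2 = ennreal (1 / (2 * t)) * (ennreal (c\<^sup>2 / \<sigma>) * (H x)\<^sup>2)"
    proof -
      have "ennreal (1 / (2 * (t * \<sigma>))) * (ennreal c)\<^sup>2 = ennreal (1 / (2 * t)) * ennreal (c\<^sup>2 / \<sigma>)"
        using t \<sigma> c by (subst ennreal_power, simp, subst ennreal_mult[symmetric], simp, simp, subst ennreal_mult[symmetric]) (auto simp: divide_simps)
      then show ?thesis by (simp add: power_mult_distrib mult.assoc[symmetric])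
    qed
    finally have 2: "ennreal \<bar>u x\<bar> * (ennreal c * H x) \<le> ennreal (t / 2) * ennreal \<sigma> * ennreal ((u x)\<^sup>2) + ennreal (1 / (2 * t)) * (ennreal (c\<^sup>2 / \<sigma>) * (H x)\<^sup>2)" .
    show ?thesis using add_mono[OF ennreal_AM_GM[OF t(1), of "f x" "K x"] 2]
      by (simp only: distrib_left mult.assoc add_ac)
  qed
  have "ennreal (s1 + s2) \<le> (\<integral>\<^sup>+x. ennreal (t / 2) * (ennreal ((f x)\<^sup>2) + ennreal \<sigma> * ennreal ((u x)\<^sup>2)) + ennreal (1 / (2 * t)) * ((K x)\<^sup>2 + ennreal (c\<^sup>2 / \<sigma>) * (H x)\<^sup>2) \<partial>lborel)"
    using lower unfolding dual by (rule order_trans) (intro nn_integral_mono pw)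
  also have "\<dots> = ennreal (t / 2) * ((\<integral>\<^sup>+x. ennreal ((f x)\<^sup>2) \<partial>lborel) + ennreal \<sigma> * (\<integral>\<^sup>+x. ennreal ((u x)\<^sup>2) \<partial>lborel))
    + ennreal (1 / (2 * t)) * ((\<integral>\<^sup>+x. (K x)\<^sup>2 \<partial>lborel) + ennreal (c\<^sup>2 / \<sigma>) * (\<integral>\<^sup>+x. (H x)\<^sup>2 \<partial>lborel))"
    by (simp add: nn_integral_add nn_integral_cmult)
  also have "\<dots> \<le> ennreal (t / 2) * 1 + ennreal (1 / (2 * t)) * (ennreal ((3 * (D - ln m1) + (D - ln m2)) / (32 * pi\<^sup>2)) + ennreal (c\<^sup>2 / \<sigma>) * ennreal (2 * pi\<^sup>2))"
    by (intro add_mono mult_left_mono energy KK HH) auto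
  also have "\<dots> = ennreal (t / 2) * ennreal 1 + ennreal (1 / (2 * t)) * ennreal Q"
  proof -
    have "ennreal a + ennreal b * ennreal d = ennreal (a + b * d)" if "0 \<le> a" "0 \<le> b" "0 \<le> d" for a b d
      using ennreal_mult_add_mult[of a 1 b d] that by simp
    from this[OF Q0, of "c\<^sup>2 / \<sigma>" "2 * pi\<^sup>2"] show ?thesis
      unfolding Q_def using \<sigma> by simp
  qed
  also have "\<dots> = ennreal (t / 2 * 1 + 1 / (2 * t) * Q)"
    using t Q by (intro ennreal_mult_add_mult) auto
  also have "t / 2 * 1 + 1 / (2 * t) * Q = t" using t by (simp add: t(2)[symmetric] power2_eq_square)
  finally have "s1 + s2 \<le> t" using t by simp
  then have "(s1 + s2)\<^sup>2 \<le> Q" using s t by (metis power_mono add_nonneg_nonneg)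
  then have "32 * pi\<^sup>2 * (s1 + s2)\<^sup>2 \<le> 32 * pi\<^sup>2 * Q" by (intro mult_left_mono) auto
  also have "\<dots> = 3 * (D - ln m1) + (D - ln m2) + 64 * pi ^ 4 * c\<^sup>2 / \<sigma>"
  proof -
    have "32 * pi\<^sup>2 * (X / (32 * pi\<^sup>2) + c\<^sup>2 / \<sigma> * (2 * pi\<^sup>2)) = X + 64 * pi ^ 4 * c\<^sup>2 / \<sigma>" for X
      by (simp add: distrib_left power4_eq_xxxx power2_eq_square)
    then show ?thesis unfolding Q_def .
  qed
  finally show ?thesis .
qed

section \<open>Summation over the level sets\<close>

lemma exp_minus_one_le: "exp y - 1 \<le> y * exp y" for y :: real
proof -
  have "exp y * (1 + - y) \<le> exp y * exp (- y)" by (intro mult_left_mono exp_ge_add_one_self) auto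
  then show ?thesis by (simp add: exp_minus algebra_simps)
qed

text \<open>In units of 32 pi^2 u^2, the integrand on the layer between k and k + 1 is at most
  exp(\<theta>(k + 1)) |x|^(-\<alpha>), and the weight integrates over the level set to a multiple
  of its measure to the power \<theta>. With T = \<open>D' - ln (m k)\<close> the layers add up to a
  multiple of the near-diagonal sum. The level inequality is the only link between u and f.\<close>

lemma level_set_integral_bound:
  fixes \<alpha> \<sigma> c :: real
  assumes \<alpha>: "0 \<le> \<alpha>" "\<alpha> < 4" and \<sigma>: "\<sigma> > 0" and c: "c > 0"
  obtains K :: real where "\<And>f u :: real^4 \<Rightarrow> real. f \<in> borel_measurable borel \<Longrightarrow> u \<in> borel_measurable borel \<Longrightarrow>
     (\<integral>\<^sup>+x. ennreal ((f x)\<^sup>2) \<partial>lborel) + ennreal \<sigma> * (\<integral>\<^sup>+x. ennreal ((u x)\<^sup>2) \<partial>lborel) \<le> 1 \<Longrightarrow>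
     (\<And>s E. 0 \<le> s \<Longrightarrow> E \<in> sets borel \<Longrightarrow> emeasure lborel E < \<infinity> \<Longrightarrow> (\<And>x. x \<in> E \<Longrightarrow> s < \<bar>u x\<bar>) \<Longrightarrow>
        ennreal s * emeasure lborel E \<le> (\<integral>\<^sup>+y. indicator E y * pot c f u y \<partial>lborel)) \<Longrightarrow>
     (\<integral>\<^sup>+x. ennreal ((exp (beta_crit \<alpha> * (u x)\<^sup>2) - 1) / norm x powr \<alpha>) \<partial>lborel) \<le> ennreal K"
proof -
  define b where "b = 32 * pi\<^sup>2"
  define \<theta> where "\<theta> = 1 - \<alpha> / 4"
  have b: "b > 0" by (simp add: b_def)
  have \<theta>: "0 < \<theta>" "\<theta> \<le> 1" using \<alpha> by (auto simp: \<theta>_def)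
  have crit: "beta_crit \<alpha> = \<theta> * b" by (simp add: beta_crit_def b_def \<theta>_def)
  \<comment> \<open>Chebyshev: the bound 1/\<sigma> on the integral of u^2 limits every level set
    with k >= 1 to measure b/\<sigma>.\<close>
  define M where "M = b / \<sigma>"
  have M: "M > 0" using b \<sigma> by (simp add: M_def)
  obtain D where D: "D > 0" "D > ln M" and
    R: "\<And>E m y. E \<in> sets borel \<Longrightarrow> emeasure lborel E = ennreal m \<Longrightarrow> 0 < m \<Longrightarrow> m \<le> M \<Longrightarrow>
      (\<integral>\<^sup>+x. indicator E x * riesz2 (x - y) \<partial>lborel) \<le> ennreal (m * (D - ln m) / (32 * pi\<^sup>2))"
    using nn_integral_set_riesz2[OF M] by blast
  obtain C1 where C1: "C1 > 0" "\<And>E m (y::real^4). E \<in> sets borel \<Longrightarrow> emeasure lborel E = ennreal m \<Longrightarrow> m > 0 \<Longrightarrow>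
      (\<integral>\<^sup>+x. indicator E x * ennreal (norm (x - y) powr - \<alpha>) \<partial>lborel) \<le> ennreal (C1 * m powr (1 - \<alpha> / 4))"
    using nn_integral_set_powr[OF \<alpha>] by blast
  obtain K0 where K0: "K0 \<ge> 0" "\<And>(I :: nat set) T. finite I \<Longrightarrow> (\<And>k. k \<in> I \<Longrightarrow> k \<ge> 1) \<Longrightarrow>
    (\<And>i k. i \<in> I \<Longrightarrow> k \<in> I \<Longrightarrow> i \<le> k \<Longrightarrow> (sqrt (real i) + sqrt (real k))\<^sup>2 \<le> 3 * T i + T k) \<Longrightarrow>
    (\<Sum>k\<in>I. exp (\<theta> * (real k - T k))) \<le> K0"
    using sum_exp_near_diagonal[OF \<theta>(1)] by blast
  \<comment> \<open>The additive error of the two-level inequality is absorbed here, so that the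
    inequality takes the pure form 3 T_i + T_k.\<close>
  define D' where "D' = D + 64 * pi ^ 4 * c\<^sup>2 / \<sigma>"
  define K1 where "K1 = exp \<theta> * C1 * exp (\<theta> * D') * K0"
  define K where "K = 3 * (C1 * (pi\<^sup>2 / 2) powr (1 - \<alpha> / 4)) + 3 * (b * (1 / \<sigma>)) + K1"
  have "(\<integral>\<^sup>+x. ennreal ((exp (beta_crit \<alpha> * (u x)\<^sup>2) - 1) / norm x powr \<alpha>) \<partial>lborel) \<le> ennreal K"
    if fm [measurable]: "f \<in> borel_measurable borel" and um [measurable]: "u \<in> borel_measurable borel" and
     energy: "(\<integral>\<^sup>+x. ennreal ((f x)\<^sup>2) \<partial>lborel) + ennreal \<sigma> * (\<integral>\<^sup>+x. ennreal ((u x)\<^sup>2) \<partial>lborel) \<le> 1" and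
     lev: "\<And>s E. 0 \<le> s \<Longrightarrow> E \<in> sets borel \<Longrightarrow> emeasure lborel E < \<infinity> \<Longrightarrow> (\<And>x. x \<in> E \<Longrightarrow> s < \<bar>u x\<bar>) \<Longrightarrow>
        ennreal s * emeasure lborel E \<le> (\<integral>\<^sup>+y. indicator E y * pot c f u y \<partial>lborel)"
   for f u :: "real^4 \<Rightarrow> real"
  proof -
    have u2: "(\<integral>\<^sup>+x. ennreal ((u x)\<^sup>2) \<partial>lborel) \<le> ennreal (1 / \<sigma>)"
    proof -
      have "ennreal \<sigma> * (\<integral>\<^sup>+x. ennreal ((u x)\<^sup>2) \<partial>lborel) \<le> 1"
        by (rule order_trans[OF _ energy]) simp
      then have "ennreal (1 / \<sigma>) * (ennreal \<sigma> * (\<integral>\<^sup>+x. ennreal ((u x)\<^sup>2) \<partial>lborel)) \<le> ennreal (1 / \<sigma>) * 1"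
        by (intro mult_left_mono) auto
      moreover have "ennreal (1 / \<sigma>) * ennreal \<sigma> = 1" using \<sigma> by (simp add: ennreal_mult[symmetric])
      ultimately show ?thesis by (simp add: mult.assoc[symmetric])
    qed
    define E where "E k = {x. real k < b * (u x)\<^sup>2}" for k :: nat
    have E [measurable]: "E k \<in> sets borel" for k
    proof -
      have "{x \<in> space borel. real k < b * (u x)\<^sup>2} \<in> sets borel" by measurable
      then show ?thesis by (simp add: E_def)
    qed
    have finE: "emeasure lborel (E k) \<le> ennreal M" if "k \<ge> 1" for k
    proof -
      have "emeasure lborel (E k) = (\<integral>\<^sup>+x. indicator (E k) x \<partial>lborel)" by simp
      also have "\<dots> \<le> (\<integral>\<^sup>+x. ennreal b * ennreal ((u x)\<^sup>2) \<partial>lborel)"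
      proof (rule nn_integral_mono)
        fix x
        have "1 \<le> b * (u x)\<^sup>2" if "x \<in> E k" using that \<open>k \<ge> 1\<close> by (simp add: E_def)
        then show "indicator (E k) x \<le> ennreal b * ennreal ((u x)\<^sup>2)"
          using b by (auto simp: indicator_def ennreal_mult[symmetric])
      qed
      also have "\<dots> = ennreal b * (\<integral>\<^sup>+x. ennreal ((u x)\<^sup>2) \<partial>lborel)" by (simp add: nn_integral_cmult)
      also have "\<dots> \<le> ennreal b * ennreal (1 / \<sigma>)" by (intro mult_left_mono u2) auto
      also have "\<dots> = ennreal M" using b \<sigma> by (simp add: ennreal_mult[symmetric] M_def)
      finally show ?thesis .
    qed
    define m where "m k = measure lborel (E k)" for k
    have m: "emeasure lborel (E k) = ennreal (m k)" "0 \<le> m k" "m k \<le> M" if "k \<ge> 1" for k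
    proof -
      have "emeasure lborel (E k) \<noteq> \<infinity>" using finE[OF that] by (auto simp: top_unique)
      then show e: "emeasure lborel (E k) = ennreal (m k)" unfolding m_def by (simp add: emeasure_eq_ennreal_measure)
      show "0 \<le> m k" by (simp add: m_def)
      show "m k \<le> M" using finE[OF that] M unfolding e by simp
    qed
    define T where "T k = D' - ln (m k)" for k
    have two: "(sqrt (real i) + sqrt (real k))\<^sup>2 \<le> 3 * T i + T k"
      if ik: "i \<ge> 1" "i \<le> k" and mp: "m i > 0" "m k > 0" for i k
    proof -
      have k: "k \<ge> 1" using ik by simp
      have l: "ennreal (sqrt (real k / b)) * ennreal (m k) \<le> (\<integral>\<^sup>+y. indicator (E k) y * pot c f u y \<partial>lborel)" if k: "k \<ge> 1" for k
      proof -
        have "sqrt (real k / b) < \<bar>u x\<bar>" if "x \<in> E k" for x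
        proof -
          have "real k / b < (u x)\<^sup>2" using that b by (simp add: E_def field_simps)
          then show ?thesis by (metis real_sqrt_less_iff real_sqrt_abs)
        qed
        then show ?thesis unfolding m(1)[OF k, symmetric] using b m(1)[OF k] by (intro lev) auto
      qed
      have "32 * pi\<^sup>2 * (sqrt (real i / b) + sqrt (real k / b))\<^sup>2 \<le> 3 * (D - ln (m i)) + (D - ln (m k)) + 64 * pi ^ 4 * c\<^sup>2 / \<sigma>"
        using two_level_inequality[OF fm um E[of i] E[of k] energy \<sigma> c m(1)[OF ik(1)] m(1)[OF k] mp
            m(3)[OF ik(1)] m(3)[OF k] D(2) R _ _ l[OF ik(1)] l[OF k]] b by simp
      \<comment> \<open>Measuring levels in units of b = 32 pi^2 makes the constant cancel.\<close>
      moreover have "32 * pi\<^sup>2 * (sqrt (real i / b) + sqrt (real k / b))\<^sup>2 = (sqrt (real i) + sqrt (real k))\<^sup>2"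
      proof -
        have "sqrt (real i / b) + sqrt (real k / b) = (sqrt (real i) + sqrt (real k)) / sqrt b"
          by (simp add: real_sqrt_divide add_divide_distrib)
        then show ?thesis using b unfolding b_def[symmetric] by (simp add: power_divide)
      qed
      moreover have "64 * pi ^ 4 * c\<^sup>2 / \<sigma> \<ge> 0" using \<sigma> by simp
      ultimately show ?thesis unfolding T_def D'_def by argo
    qed
    \<comment> \<open>Below level 1 the integrand is at most 3 |x|^(-\<alpha>) inside the unit ball,
      and outside it exp y - 1 <= 3y gives a multiple of u^2. Above level 1 the single term of the
      series for the layer of x suffices.\<close>
    have low: "ennreal ((exp (\<theta> * b * (u x)\<^sup>2) - 1) / norm x powr \<alpha>) \<le>
      ennreal 3 * (indicator (ball 0 1) x * ennreal (norm x powr - \<alpha>)) + ennreal (3 * b) * ennreal ((u x)\<^sup>2)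
       + (\<Sum>k. ennreal (exp (\<theta> * real (k + 2))) * (indicator (E (k + 1)) x * ennreal (norm x powr - \<alpha>)))" for x
    proof (cases "b * (u x)\<^sup>2 \<le> 1")
      case True
      have y: "0 \<le> \<theta> * b * (u x)\<^sup>2" "\<theta> * b * (u x)\<^sup>2 \<le> b * (u x)\<^sup>2"
        using \<theta> b mult_right_mono[OF \<theta>(2), of "b * (u x)\<^sup>2"] by (auto simp: mult.assoc)
      have "exp (\<theta> * b * (u x)\<^sup>2) \<le> exp 1" using y True by simp
      then have e3: "exp (\<theta> * b * (u x)\<^sup>2) \<le> 3" using exp_le by linarith
      have "exp (\<theta> * b * (u x)\<^sup>2) - 1 \<le> \<theta> * b * (u x)\<^sup>2 * exp (\<theta> * b * (u x)\<^sup>2)" by (rule exp_minus_one_le)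
      also have "\<dots> \<le> (b * (u x)\<^sup>2) * 3" by (rule mult_mono[OF y(2) e3]) (use b in auto)
      finally have e: "exp (\<theta> * b * (u x)\<^sup>2) - 1 \<le> 3 * (b * (u x)\<^sup>2)" by simp
      have "ennreal ((exp (\<theta> * b * (u x)\<^sup>2) - 1) / norm x powr \<alpha>) \<le>
         ennreal 3 * (indicator (ball 0 1) x * ennreal (norm x powr - \<alpha>)) + ennreal (3 * b) * ennreal ((u x)\<^sup>2)"
      proof (cases "norm x < 1")
        case True
        have "(exp (\<theta> * b * (u x)\<^sup>2) - 1) / norm x powr \<alpha> \<le> 3 * norm x powr - \<alpha>"
          unfolding powr_minus divide_inverse using e3 by (intro mult_right_mono) auto
        then have "ennreal ((exp (\<theta> * b * (u x)\<^sup>2) - 1) / norm x powr \<alpha>) \<le> ennreal (3 * norm x powr - \<alpha>)" by (rule ennreal_leI)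
        also have "\<dots> = ennreal 3 * (indicator (ball 0 1) x * ennreal (norm x powr - \<alpha>))"
          using True by (simp add: ennreal_mult)
        finally show ?thesis by (rule order_trans) simp
      next
        case False
        then have "1 \<le> norm x powr \<alpha>" using \<alpha> by (intro ge_one_powr_ge_zero) auto
        then have "(exp (\<theta> * b * (u x)\<^sup>2) - 1) / norm x powr \<alpha> \<le> (exp (\<theta> * b * (u x)\<^sup>2) - 1) / 1"
          using y(1) by (intro divide_left_mono) auto
        then have "ennreal ((exp (\<theta> * b * (u x)\<^sup>2) - 1) / norm x powr \<alpha>) \<le> ennreal (3 * b * (u x)\<^sup>2)" using e by (intro ennreal_leI) simp
        also have "\<dots> = ennreal (3 * b) * ennreal ((u x)\<^sup>2)" using b by (intro ennreal_mult) auto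
        finally show ?thesis by (rule order_trans) simp
      qed
      then show ?thesis by (rule order_trans) simp
    next
      case False
      \<comment> \<open>As b u^2 > 1, the rounded-up value is at least 2 and the subtraction of
        naturals does not truncate. The shift places b u^2 above j + 1 and at most at j + 2.\<close>
      define j where "j = nat \<lceil>b * (u x)\<^sup>2\<rceil> - 2"
      have j: "real (j + 1) < b * (u x)\<^sup>2" "b * (u x)\<^sup>2 \<le> real (j + 2)"
        using False unfolding j_def by linarith+
      have "\<theta> * b * (u x)\<^sup>2 \<le> \<theta> * real (j + 2)"
        unfolding mult.assoc using \<theta> j(2) by (intro mult_left_mono) auto
      then have "exp (\<theta> * b * (u x)\<^sup>2) - 1 \<le> exp (\<theta> * real (j + 2))" by (smt (verit) exp_le_cancel_iff)
      then have "(exp (\<theta> * b * (u x)\<^sup>2) - 1) / norm x powr \<alpha> \<le> exp (\<theta> * real (j + 2)) * norm x powr - \<alpha>"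
        unfolding powr_minus divide_inverse by (intro mult_right_mono) auto
      then have "ennreal ((exp (\<theta> * b * (u x)\<^sup>2) - 1) / norm x powr \<alpha>) \<le> ennreal (exp (\<theta> * real (j + 2)) * norm x powr - \<alpha>)"
        by (rule ennreal_leI)
      also have "\<dots> = ennreal (exp (\<theta> * real (j + 2))) * (indicator (E (j + 1)) x * ennreal (norm x powr - \<alpha>))"
        using j(1) by (simp add: ennreal_mult E_def)
      also have "\<dots> = (\<Sum>k\<in>{j}. ennreal (exp (\<theta> * real (k + 2))) * (indicator (E (k + 1)) x * ennreal (norm x powr - \<alpha>)))" by simp
      also have "\<dots> \<le> (\<Sum>k. ennreal (exp (\<theta> * real (k + 2))) * (indicator (E (k + 1)) x * ennreal (norm x powr - \<alpha>)))"
        by (rule sum_le_suminf) auto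
      finally show ?thesis by (rule order_trans) simp
    qed
    have sum: "(\<Sum>k. ennreal (exp (\<theta> * real (k + 2))) * (\<integral>\<^sup>+x. indicator (E (k + 1)) x * ennreal (norm x powr - \<alpha>) \<partial>lborel)) \<le> ennreal K1"
    proof (rule suminf_le_const)
      fix n
      \<comment> \<open>Null level sets are left out: their integrals vanish, while
        \<open>ln (m k)\<close> carries no information about them.\<close>
      define I where "I = {k \<in> {1..n}. m k > 0}"
      have level: "ennreal (exp (\<theta> * real (k + 1))) * (\<integral>\<^sup>+x. indicator (E k) x * ennreal (norm x powr - \<alpha>) \<partial>lborel)
        \<le> (if m k > 0 then ennreal (exp \<theta> * C1 * exp (\<theta> * D') * exp (\<theta> * (real k - T k))) else 0)" if k: "k \<ge> 1" for k
      proof (cases "m k > 0")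
        case True
        have "(\<integral>\<^sup>+x. indicator (E k) x * ennreal (norm x powr - \<alpha>) \<partial>lborel) \<le> ennreal (C1 * m k powr \<theta>)"
          using C1(2)[OF E m(1)[OF k] True, of 0] by (simp add: \<theta>_def)
        then have "ennreal (exp (\<theta> * real (k + 1))) * (\<integral>\<^sup>+x. indicator (E k) x * ennreal (norm x powr - \<alpha>) \<partial>lborel)
          \<le> ennreal (exp (\<theta> * real (k + 1))) * ennreal (C1 * m k powr \<theta>)" by (rule mult_left_mono) auto
        also have "\<dots> = ennreal (exp (\<theta> * real (k + 1)) * (C1 * m k powr \<theta>))" using C1(1) by (intro ennreal_mult[symmetric]) auto
        also have "exp (\<theta> * real (k + 1)) * (C1 * m k powr \<theta>) = C1 * exp (\<theta> * real (k + 1) + \<theta> * ln (m k))"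
          using True by (simp add: powr_def exp_add)
        also have "\<theta> * real (k + 1) + \<theta> * ln (m k) = \<theta> + \<theta> * D' + \<theta> * (real k - T k)"
          by (simp add: T_def algebra_simps)
        also have "C1 * exp (\<theta> + \<theta> * D' + \<theta> * (real k - T k)) = exp \<theta> * C1 * exp (\<theta> * D') * exp (\<theta> * (real k - T k))"
          by (simp add: exp_add)
        finally show ?thesis using True by simp
      next
        case False
        then have z: "emeasure lborel (E k) = 0" using m(1,2)[OF k] by simp
        have "(\<integral>\<^sup>+x. indicator (E k) x * ennreal (norm x powr - \<alpha>) \<partial>lborel) = 0"
          by (subst mult.commute, rule nn_integral_null_set) (auto simp: null_sets_def z)
        then show ?thesis using False by simp
      qed
      have "(\<Sum>k<n. ennreal (exp (\<theta> * real (k + 2))) * (\<integral>\<^sup>+x. indicator (E (k + 1)) x * ennreal (norm x powr - \<alpha>) \<partial>lborel))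
        = (\<Sum>k\<in>{1..n}. ennreal (exp (\<theta> * real (k + 1))) * (\<integral>\<^sup>+x. indicator (E k) x * ennreal (norm x powr - \<alpha>) \<partial>lborel))"
        by (rule sum.reindex_bij_witness[of _ "\<lambda>k. k - 1" Suc]) (auto simp: add_ac)
      also have "\<dots> \<le> (\<Sum>k\<in>{1..n}. (if m k > 0 then ennreal (exp \<theta> * C1 * exp (\<theta> * D') * exp (\<theta> * (real k - T k))) else 0))"
        by (intro sum_mono level) auto
      also have "\<dots> = (\<Sum>k\<in>I. ennreal (exp \<theta> * C1 * exp (\<theta> * D') * exp (\<theta> * (real k - T k))))"
        unfolding I_def by (subst sum.inter_filter) auto
      also have "\<dots> = ennreal (\<Sum>k\<in>I. exp \<theta> * C1 * exp (\<theta> * D') * exp (\<theta> * (real k - T k)))"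
        using C1(1) by (intro sum_ennreal) auto
      also have "\<dots> = ennreal (exp \<theta> * C1 * exp (\<theta> * D') * (\<Sum>k\<in>I. exp (\<theta> * (real k - T k))))"
        by (simp only: sum_distrib_left)
      also have "\<dots> \<le> ennreal K1"
        unfolding K1_def using C1(1) by (intro ennreal_leI mult_left_mono K0(2)) (auto simp: I_def intro!: two)
      finally show "(\<Sum>k<n. ennreal (exp (\<theta> * real (k + 2))) * (\<integral>\<^sup>+x. indicator (E (k + 1)) x * ennreal (norm x powr - \<alpha>) \<partial>lborel)) \<le> ennreal K1" .
    qed auto
    have K1: "K1 \<ge> 0" using C1(1) K0(1) by (simp add: K1_def)
    have ballb: "(\<integral>\<^sup>+x. indicator (ball 0 1) x * ennreal (norm (x::real^4) powr - \<alpha>) \<partial>lborel) \<le> ennreal (C1 * (pi\<^sup>2 / 2) powr (1 - \<alpha> / 4))"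
      using C1(2)[of "ball 0 1" "pi\<^sup>2 / 2" 0] by (simp add: emeasure_ball unit_ball_vol_4)
    have "(\<integral>\<^sup>+x. ennreal ((exp (\<theta> * b * (u x)\<^sup>2) - 1) / norm x powr \<alpha>) \<partial>lborel) \<le>
      (\<integral>\<^sup>+x. ennreal 3 * (indicator (ball 0 1) x * ennreal (norm x powr - \<alpha>)) + ennreal (3 * b) * ennreal ((u x)\<^sup>2)
       + (\<Sum>k. ennreal (exp (\<theta> * real (k + 2))) * (indicator (E (k + 1)) x * ennreal (norm x powr - \<alpha>))) \<partial>lborel)"
      by (intro nn_integral_mono low)
    also have "\<dots> = ennreal 3 * (\<integral>\<^sup>+x. indicator (ball 0 1) x * ennreal (norm (x::real^4) powr - \<alpha>) \<partial>lborel) + ennreal (3 * b) * (\<integral>\<^sup>+x. ennreal ((u x)\<^sup>2) \<partial>lborel)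
       + (\<Sum>k. ennreal (exp (\<theta> * real (k + 2))) * (\<integral>\<^sup>+x. indicator (E (k + 1)) x * ennreal (norm x powr - \<alpha>) \<partial>lborel))"
      by (simp add: nn_integral_add nn_integral_cmult nn_integral_suminf)
    also have "\<dots> \<le> ennreal 3 * ennreal (C1 * (pi\<^sup>2 / 2) powr (1 - \<alpha> / 4)) + ennreal (3 * b) * ennreal (1 / \<sigma>) + ennreal K1"
      by (intro add_mono mult_left_mono ballb u2 sum) auto
    also have "\<dots> = ennreal (3 * (C1 * (pi\<^sup>2 / 2) powr (1 - \<alpha> / 4)) + (3 * b) * (1 / \<sigma>)) + ennreal K1"
      using C1(1) b \<sigma> by (subst ennreal_mult_add_mult) auto
    also have "\<dots> = ennreal K" unfolding K_def using C1(1) b \<sigma> K1 by (subst ennreal_plus[symmetric]) auto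
    finally show ?thesis unfolding crit .
  qed
  with that show ?thesis by blast
qed

section \<open>Mollification\<close>

lemma integral_lborel_affine:
  fixes f :: "'a::euclidean_space \<Rightarrow> real"
  assumes [measurable]: "f \<in> borel_measurable borel" and c: "c \<noteq> 0"
  shows "(\<integral>x. f x \<partial>lborel) = \<bar>c\<bar> ^ DIM('a) * (\<integral>x. f (t + c *\<^sub>R x) \<partial>lborel)"
  by (subst lborel_affine[OF c, of t])
     (simp add: integral_density integral_distr)

text \<open>In the non-integrable case the left side is 0 by convention. This spares an
  integrability proof for regularised functions.\<close>

lemma ennreal_integral_le_nn_integral:
  assumes [measurable]: "g \<in> borel_measurable M"
  shows "ennreal (\<integral>x. g x \<partial>M) \<le> (\<integral>\<^sup>+x. ennreal (g x) \<partial>M)"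
proof (cases "integrable M g")
  case True
  then have fin: "(\<integral>\<^sup>+x. ennreal (g x) \<partial>M) \<noteq> \<infinity>"
    by (simp add: real_integrable_def)
  have "(\<integral>x. g x \<partial>M) \<le> enn2real (\<integral>\<^sup>+x. ennreal (g x) \<partial>M)"
    using True by (simp add: real_lebesgue_integral_def)
  then have "ennreal (\<integral>x. g x \<partial>M) \<le> ennreal (enn2real (\<integral>\<^sup>+x. ennreal (g x) \<partial>M))" by (rule ennreal_leI)
  also have "\<dots> = (\<integral>\<^sup>+x. ennreal (g x) \<partial>M)" using fin by (simp add: ennreal_enn2real less_top)
  finally show ?thesis .
next
  case False
  then show ?thesis by (simp add: not_integrable_integral_eq)
qed

text \<open>In s = |w|^2 the integrand becomes 2s/(s + 1)^3 on the half-line, with primitive (s/(s +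
  1))^2 rising from 0 to 1.\<close>

lemma bubble_profile_integral:
  defines "P \<equiv> \<lambda>w::real^4. 2 / pi\<^sup>2 / ((norm w)\<^sup>2 + 1) ^ 3"
  shows "integrable lborel P" "(\<integral>w. P w \<partial>lborel) = 1"
proof -
  have [measurable]: "P \<in> borel_measurable borel" unfolding P_def by measurable
  let ?f = "\<lambda>s::real. 2 * s / (s + 1) ^ 3"
  have "(\<integral>\<^sup>+w. ennreal (P w) \<partial>lborel) = (\<integral>\<^sup>+s. ennreal (pi\<^sup>2 * s) * ennreal (2 / pi\<^sup>2 / (s + 1) ^ 3) \<partial>lborel)"
    unfolding P_def by (rule nn_integral_radial[of "\<lambda>s. ennreal (2 / pi\<^sup>2 / (s + 1) ^ 3)"]) measurable
  also have "\<dots> = (\<integral>\<^sup>+s. ennreal (?f s) * indicator {0..} s \<partial>lborel)"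
  proof (intro nn_integral_cong)
    fix s :: real
    show "ennreal (pi\<^sup>2 * s) * ennreal (2 / pi\<^sup>2 / (s + 1) ^ 3) = ennreal (?f s) * indicator {0..} s"
    proof (cases "s \<ge> 0")
      case True
      then have "ennreal (pi\<^sup>2 * s) * ennreal (2 / pi\<^sup>2 / (s + 1) ^ 3) = ennreal (pi\<^sup>2 * s * (2 / pi\<^sup>2 / (s + 1) ^ 3))"
        by (intro ennreal_mult[symmetric]) auto
      then show ?thesis using True by (simp add: mult.commute)
    qed (simp add: ennreal_neg mult_nonneg_nonpos)
  qed
  also have "\<dots> = ennreal (1 - (\<lambda>s::real. s\<^sup>2 / (s + 1)\<^sup>2) 0)"
  proof (rule nn_integral_FTC_atLeast)
    show "((\<lambda>s::real. s\<^sup>2 / (s + 1)\<^sup>2) has_real_derivative ?f s) (at s)" if "0 \<le> s" for s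
    proof -
      have "((\<lambda>s. s / (s + 1)) has_real_derivative 1 / (s + 1)\<^sup>2) (at s)"
        using that by (auto intro!: derivative_eq_intros simp: power2_eq_square)
      from DERIV_power[OF this, of 2] show ?thesis
        using that by (simp add: power_divide power2_eq_square power3_eq_cube)
    qed
    have "((\<lambda>s::real. (1 - inverse (1 + s))\<^sup>2) \<longlongrightarrow> (1 - 0)\<^sup>2) at_top"
      by (intro tendsto_intros tendsto_inverse_0_at_top filterlim_tendsto_add_at_top[OF tendsto_const] filterlim_ident)
    then have "((\<lambda>s::real. (1 - inverse (1 + s))\<^sup>2) \<longlongrightarrow> 1) at_top" by simp
    then show "((\<lambda>s::real. s\<^sup>2 / (s + 1)\<^sup>2) \<longlongrightarrow> 1) at_top"
    proof (rule Lim_transform_eventually)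
      show "\<forall>\<^sub>F s::real in at_top. (1 - inverse (1 + s))\<^sup>2 = s\<^sup>2 / (s + 1)\<^sup>2"
        using eventually_ge_at_top[of 0] by eventually_elim (auto simp: field_simps simp flip: power_divide)
    qed
  qed auto
  finally have "(\<integral>\<^sup>+w. ennreal (P w) \<partial>lborel) = ennreal 1" by simp
  moreover have "0 \<le> P w" for w by (simp add: P_def)
  ultimately have "has_bochner_integral lborel P 1"
    by (intro has_bochner_integral_nn_integral) auto
  then show "integrable lborel P" "(\<integral>w. P w \<partial>lborel) = 1"
    by (auto simp: has_bochner_integral_iff)
qed

lemma borel_measurable_bubble [measurable]: "bubble e \<in> borel_measurable borel"
  unfolding bubble_def[abs_def] by measurable

lemma bubble_nonneg: "e \<ge> 0 \<Longrightarrow> bubble e x \<ge> 0"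
  by (simp add: bubble_def)

lemma bubble_eq_0: "norm x \<ge> 1 \<Longrightarrow> bubble e x = 0"
  by (simp add: bubble_def cutoff_eq_0 one_le_power)

text \<open>With parameter e^2 the bubble lives at length scale e; after rescaling only the cutoff
  still depends on e.\<close>

lemma bubble_scaled:
  assumes "e > 0"
  shows "e ^ 4 * bubble (e\<^sup>2) (e *\<^sub>R w) = cutoff (e\<^sup>2 * (norm w)\<^sup>2) * (2 / pi\<^sup>2 / ((norm w)\<^sup>2 + 1) ^ 3)"
proof -
  have "(norm (e *\<^sub>R w))\<^sup>2 + e\<^sup>2 = e\<^sup>2 * ((norm w)\<^sup>2 + 1)"
    by (simp add: power_mult_distrib distrib_left)
  then have "e ^ 4 * bubble (e\<^sup>2) (e *\<^sub>R w) = cutoff (e\<^sup>2 * (norm w)\<^sup>2) * (e ^ 4 * (2 * e\<^sup>2 / pi\<^sup>2 / (e\<^sup>2 * ((norm w)\<^sup>2 + 1)) ^ 3))"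
    unfolding bubble_def by (simp add: power_mult_distrib)
  also have "e ^ 4 * (2 * e\<^sup>2 / pi\<^sup>2 / (e\<^sup>2 * ((norm w)\<^sup>2 + 1)) ^ 3) = 2 / pi\<^sup>2 / ((norm w)\<^sup>2 + 1) ^ 3"
    using assms by (simp add: power_mult_distrib power2_eq_square power3_eq_cube power4_eq_xxxx)
  finally show ?thesis .
qed

definition mollify :: "real \<Rightarrow> (real^4 \<Rightarrow> real) \<Rightarrow> real^4 \<Rightarrow> real" where
  "mollify e \<psi> x = (\<integral>y. \<psi> y * bubble e (x - y) \<partial>lborel)"

lemma mollify_eq:
  assumes [measurable]: "\<psi> \<in> borel_measurable borel" and e: "e > 0"
  shows "mollify (e\<^sup>2) \<psi> x = (\<integral>w. cutoff (e\<^sup>2 * (norm w)\<^sup>2) * (2 / pi\<^sup>2 / ((norm w)\<^sup>2 + 1) ^ 3) * \<psi> (x - e *\<^sub>R w) \<partial>lborel)"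
proof -
  have "mollify (e\<^sup>2) \<psi> x = e ^ 4 * (\<integral>w. \<psi> (x - e *\<^sub>R w) * bubble (e\<^sup>2) (e *\<^sub>R w) \<partial>lborel)"
    unfolding mollify_def using e
    by (subst integral_lborel_affine[of _ "- e" x]) auto
  also have "\<dots> = (\<integral>w. e ^ 4 * (\<psi> (x - e *\<^sub>R w) * bubble (e\<^sup>2) (e *\<^sub>R w)) \<partial>lborel)"
    by simp
  also have "\<dots> = (\<integral>w. (e ^ 4 * bubble (e\<^sup>2) (e *\<^sub>R w)) * \<psi> (x - e *\<^sub>R w) \<partial>lborel)"
    by (simp only: mult_ac)
  finally show ?thesis unfolding bubble_scaled[OF e] .
qed

text \<open>The cutoff only removes mass from a profile of mass 1.\<close>

lemma mollify_bound:
  assumes \<psi> [measurable]: "\<psi> \<in> borel_measurable borel" and e: "e > 0" and B: "\<And>x. \<bar>\<psi> x\<bar> \<le> B"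
  shows "\<bar>mollify (e\<^sup>2) \<psi> x\<bar> \<le> B"
proof -
  have B0: "B \<ge> 0" using B[of 0] by linarith
  have "\<bar>mollify (e\<^sup>2) \<psi> x\<bar> \<le> (\<integral>w. B * (2 / pi\<^sup>2 / ((norm (w::real^4))\<^sup>2 + 1) ^ 3) \<partial>lborel)"
    unfolding mollify_eq[OF \<psi> e]
  proof (rule integral_abs_bound_integral)
    show i: "integrable lborel (\<lambda>w::real^4. B * (2 / pi\<^sup>2 / ((norm w)\<^sup>2 + 1) ^ 3))"
      by (intro integrable_mult_right bubble_profile_integral)
    show b: "\<bar>cutoff (e\<^sup>2 * (norm w)\<^sup>2) * (2 / pi\<^sup>2 / ((norm w)\<^sup>2 + 1) ^ 3) * \<psi> (x - e *\<^sub>R w)\<bar> \<le> B * (2 / pi\<^sup>2 / ((norm w)\<^sup>2 + 1) ^ 3)" for w :: "real^4"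
    proof -
      have "\<bar>cutoff (e\<^sup>2 * (norm w)\<^sup>2) * (2 / pi\<^sup>2 / ((norm w)\<^sup>2 + 1) ^ 3) * \<psi> (x - e *\<^sub>R w)\<bar>
        = cutoff (e\<^sup>2 * (norm w)\<^sup>2) * (2 / pi\<^sup>2 / ((norm w)\<^sup>2 + 1) ^ 3) * \<bar>\<psi> (x - e *\<^sub>R w)\<bar>"
        by (simp add: abs_mult)
      also have "\<dots> \<le> 1 * (2 / pi\<^sup>2 / ((norm w)\<^sup>2 + 1) ^ 3) * B"
        by (intro mult_mono cutoff_le_1 B) auto
      finally show ?thesis by (simp only: mult_ac mult_1)
    qed
    show "integrable lborel (\<lambda>w. cutoff (e\<^sup>2 * (norm w)\<^sup>2) * (2 / pi\<^sup>2 / ((norm w)\<^sup>2 + 1) ^ 3) * \<psi> (x - e *\<^sub>R w))"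
      by (rule Bochner_Integration.integrable_bound[OF i]) (use b B0 in \<open>auto intro!: AE_I2 simp del: times_divide_eq_right\<close>)
  qed
  then show ?thesis by (simp only: integral_mult_right_zero bubble_profile_integral(2) mult_1_right)
qed

text \<open>The cutoff leaves the mollifier with mass below 1, and it is not renormalised: after
  rescaling the cutoff tends to 1 pointwise, and dominated convergence restores the full
  mass.\<close>

lemma mollify_tendsto:
  assumes \<psi>: "continuous_on UNIV \<psi>" and B: "\<And>x. \<bar>\<psi> x\<bar> \<le> B"
  shows "(\<lambda>n. mollify ((inverse (real (Suc n)))\<^sup>2) \<psi> x) \<longlonglongrightarrow> \<psi> x"
proof -
  have m [measurable]: "\<psi> \<in> borel_measurable borel" using \<psi> by (rule borel_measurable_continuous_onI)
  let ?e = "\<lambda>n. inverse (real (Suc n))" and ?P = "\<lambda>w::real^4. 2 / pi\<^sup>2 / ((norm w)\<^sup>2 + 1) ^ 3"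
  have B0: "B \<ge> 0" using B[of 0] by linarith
  have e0: "?e \<longlonglongrightarrow> 0" by (rule LIMSEQ_inverse_real_of_nat)
  have "(\<lambda>n. \<integral>w. cutoff ((?e n)\<^sup>2 * (norm w)\<^sup>2) * ?P w * \<psi> (x - ?e n *\<^sub>R w) \<partial>lborel) \<longlonglongrightarrow> (\<integral>w. ?P w * \<psi> x \<partial>lborel)"
  proof (rule integral_dominated_convergence[where w="\<lambda>w. B * ?P w"])
    show "integrable lborel (\<lambda>w::real^4. B * ?P w)"
      by (intro integrable_mult_right bubble_profile_integral)
    show "AE w in lborel. (\<lambda>n. cutoff ((?e n)\<^sup>2 * (norm w)\<^sup>2) * ?P w * \<psi> (x - ?e n *\<^sub>R w)) \<longlonglongrightarrow> ?P w * \<psi> x"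
    proof (rule AE_I2)
      fix w :: "real^4"
      have "(\<lambda>n. cutoff ((?e n)\<^sup>2 * (norm w)\<^sup>2)) \<longlonglongrightarrow> cutoff (0\<^sup>2 * (norm w)\<^sup>2)"
        by (rule continuous_on_tendsto_compose[OF continuous_cutoff[of UNIV]]) (intro tendsto_intros e0, simp_all)
      moreover have "(\<lambda>n. \<psi> (x - ?e n *\<^sub>R w)) \<longlonglongrightarrow> \<psi> (x - 0 *\<^sub>R w)"
        by (rule continuous_on_tendsto_compose[OF \<psi>]) (intro tendsto_intros e0, simp_all)
      ultimately have "(\<lambda>n. cutoff ((?e n)\<^sup>2 * (norm w)\<^sup>2) * ?P w * \<psi> (x - ?e n *\<^sub>R w)) \<longlonglongrightarrow> cutoff (0\<^sup>2 * (norm w)\<^sup>2) * ?P w * \<psi> (x - 0 *\<^sub>R w)"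
        by (intro tendsto_mult tendsto_const)
      then show "(\<lambda>n. cutoff ((?e n)\<^sup>2 * (norm w)\<^sup>2) * ?P w * \<psi> (x - ?e n *\<^sub>R w)) \<longlonglongrightarrow> ?P w * \<psi> x" by simp
    qed
    show "AE w in lborel. norm (cutoff ((?e n)\<^sup>2 * (norm w)\<^sup>2) * ?P w * \<psi> (x - ?e n *\<^sub>R w)) \<le> B * ?P w" for n
    proof (rule AE_I2)
      fix w :: "real^4"
      have "norm (cutoff ((?e n)\<^sup>2 * (norm w)\<^sup>2) * ?P w * \<psi> (x - ?e n *\<^sub>R w))
        = cutoff ((?e n)\<^sup>2 * (norm w)\<^sup>2) * ?P w * \<bar>\<psi> (x - ?e n *\<^sub>R w)\<bar>"
        by (simp add: abs_mult)
      also have "\<dots> \<le> 1 * ?P w * B"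
        by (intro mult_mono cutoff_le_1 B) auto
      finally show "norm (cutoff ((?e n)\<^sup>2 * (norm w)\<^sup>2) * ?P w * \<psi> (x - ?e n *\<^sub>R w)) \<le> B * ?P w" by (simp only: mult_ac mult_1)
    qed
  qed measurable
  moreover have "(\<integral>w. ?P w * \<psi> x \<partial>lborel) = \<psi> x"
    by (simp only: integral_mult_left_zero bubble_profile_integral(2) mult_1)
  ultimately show ?thesis by (simp add: mollify_eq[OF m])
qed

lemma mollify_eq_0:
  assumes "\<And>y. norm y > R \<Longrightarrow> \<psi> y = 0" "norm x > R + 1"
  shows "mollify e \<psi> x = 0"
proof -
  have *: "\<psi> y * bubble e (x - y) = 0" for y
  proof (cases "norm y > R")
    case False
    then have "norm (x - y) \<ge> 1" using assms(2) norm_triangle_ineq2[of x y] by linarith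
    then show ?thesis by (simp add: bubble_eq_0)
  qed (simp add: assms)
  show ?thesis unfolding mollify_def * by simp
qed

text \<open>The Borel counterpart of \<open>locally_integrable\<close>, to which Fubini on products of \<open>lborel\<close> applies.\<close>

definition loc_int :: "('a::euclidean_space \<Rightarrow> real) \<Rightarrow> bool" where
  "loc_int h \<longleftrightarrow> h \<in> borel_measurable borel \<and> (\<forall>R. integrable lborel (\<lambda>x. indicator (cball 0 R) x * h x))"

lemma loc_int_measurable: "loc_int h \<Longrightarrow> h \<in> borel_measurable borel"
  by (simp add: loc_int_def)

lemma loc_int_integrable_mult:
  fixes h :: "'a::euclidean_space \<Rightarrow> real"
  assumes h: "loc_int h" and [measurable]: "\<psi> \<in> borel_measurable borel"
    and B: "\<And>x. \<bar>\<psi> x\<bar> \<le> B" and R: "\<And>x. norm x > R \<Longrightarrow> \<psi> x = 0"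
  shows "integrable lborel (\<lambda>x. h x * \<psi> x)"
proof -
  have [measurable]: "h \<in> borel_measurable borel" using h by (rule loc_int_measurable)
  have "integrable lborel (\<lambda>x. B * (indicator (cball 0 R) x * h x))"
    using h by (simp add: loc_int_def)
  then show ?thesis
  proof (rule Bochner_Integration.integrable_bound)
    show "AE x in lborel. norm (h x * \<psi> x) \<le> norm (B * (indicator (cball 0 R) x * h x))"
    proof (rule AE_I2)
      fix x
      have "\<bar>\<psi> x\<bar> * \<bar>h x\<bar> \<le> \<bar>B\<bar> * \<bar>h x\<bar>" using B[of x] by (intro mult_right_mono) auto
      then show "norm (h x * \<psi> x) \<le> norm (B * (indicator (cball 0 R) x * h x))"
        using R[of x] by (cases "norm x > R") (auto simp: abs_mult mult.commute)
    qed
  qed measurable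
qed

text \<open>Fubini moves the mollification from h to the continuous function \<psi>, where it
  converges everywhere and stays bounded with support in a fixed ball. Lebesgue points of h never
  enter, and the inner integrals test h against smooth bubbles only.\<close>

lemma integral_mollify_tendsto:
  fixes h :: "real^4 \<Rightarrow> real"
  assumes h: "loc_int h" and \<psi>: "continuous_on UNIV \<psi>" and B: "\<And>x. \<bar>\<psi> x\<bar> \<le> B" and R: "\<And>x. norm x > R \<Longrightarrow> \<psi> x = 0"
  shows "(\<lambda>n. \<integral>y. \<psi> y * (\<integral>x. h x * bubble ((inverse (real (Suc n)))\<^sup>2) (x - y) \<partial>lborel) \<partial>lborel) \<longlonglongrightarrow> (\<integral>x. h x * \<psi> x \<partial>lborel)"
proof -
  have m [measurable]: "\<psi> \<in> borel_measurable borel" using \<psi> by (rule borel_measurable_continuous_onI)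
  have hm [measurable]: "h \<in> borel_measurable borel" using h by (rule loc_int_measurable)
  have B0: "B \<ge> 0" using B[of 0] by linarith
  define e where "e n = inverse (real (Suc n))" for n
  have e: "e n > 0" for n by (simp add: e_def)
  have mm [measurable]: "mollify d \<psi> \<in> borel_measurable borel" for d
    unfolding mollify_def[abs_def] by measurable
  have hb: "integrable lborel (\<lambda>x. B * \<bar>indicator (cball 0 (R + 1)) x * h x\<bar>)"
    using h by (simp add: loc_int_def)
  have "(\<lambda>n. \<integral>x. h x * mollify ((e n)\<^sup>2) \<psi> x \<partial>lborel) \<longlonglongrightarrow> (\<integral>x. h x * \<psi> x \<partial>lborel)"
  proof (rule integral_dominated_convergence[OF _ _ hb])
    show "AE x in lborel. (\<lambda>n. h x * mollify ((e n)\<^sup>2) \<psi> x) \<longlonglongrightarrow> h x * \<psi> x"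
      unfolding e_def by (intro AE_I2 tendsto_intros mollify_tendsto[OF \<psi> B])
    show "AE x in lborel. norm (h x * mollify ((e n)\<^sup>2) \<psi> x) \<le> B * \<bar>indicator (cball 0 (R + 1)) x * h x\<bar>" for n
    proof (rule AE_I2)
      fix x
      show "norm (h x * mollify ((e n)\<^sup>2) \<psi> x) \<le> B * \<bar>indicator (cball 0 (R + 1)) x * h x\<bar>"
      proof (cases "norm x > R + 1")
        case True
        then show ?thesis using mollify_eq_0[of R \<psi> x, OF R True] B0 by simp
      next
        case False
        then show ?thesis using mollify_bound[OF m e[of n] B, of x]
          by (simp add: abs_mult mult.commute[of B] mult_left_mono)
      qed
    qed
  qed measurable
  moreover have "(\<integral>y. \<psi> y * (\<integral>x. h x * bubble ((e n)\<^sup>2) (x - y) \<partial>lborel) \<partial>lborel) = (\<integral>x. h x * mollify ((e n)\<^sup>2) \<psi> x \<partial>lborel)" for n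
  proof -
    \<comment> \<open>The height of the bubble at its centre. It blows up as n grows, but n is fixed
      while Fubini is applied.\<close>
    define C where "C = 2 * (e n)\<^sup>2 / pi\<^sup>2 / ((e n)\<^sup>2) ^ 3"
    have C: "bubble ((e n)\<^sup>2) x \<le> C" for x
    proof -
      have "(2 * (e n)\<^sup>2 / pi\<^sup>2 / ((norm x)\<^sup>2 + (e n)\<^sup>2) ^ 3) \<le> C"
        unfolding C_def using e[of n] by (intro divide_left_mono power_mono mult_pos_pos zero_less_power add_nonneg_pos) auto
      then show ?thesis unfolding bubble_def
        using cutoff_le_1[of "(norm x)\<^sup>2"] e[of n] by (meson cutoff_nonneg divide_nonneg_nonneg mult_left_le_one_le order_trans zero_le_power zero_le_power2 add_nonneg_nonneg mult_nonneg_nonneg zero_le_numeral)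
    qed
    have C0: "C \<ge> 0" by (simp add: C_def)
    let ?F = "\<lambda>x y. \<psi> y * (h x * bubble ((e n)\<^sup>2) (x - y))"
    have int: "integrable (lborel \<Otimes>\<^sub>M lborel) (\<lambda>(x, y). ?F x y)"
    proof (rule integrableI_bounded)
      have "(\<integral>\<^sup>+z. ennreal (norm (case z of (x, y) \<Rightarrow> ?F x y)) \<partial>(lborel \<Otimes>\<^sub>M lborel)) =
        (\<integral>\<^sup>+x. (\<integral>\<^sup>+y. ennreal (norm (?F x y)) \<partial>lborel) \<partial>lborel)"
        by (subst lborel.nn_integral_fst[symmetric]) auto
      also have "\<dots> \<le> (\<integral>\<^sup>+x. (\<integral>\<^sup>+y. ennreal (C * (B * \<bar>indicator (cball 0 (R + 1)) x * h x\<bar>)) * indicator (cball (0 :: real^4) R) y \<partial>lborel) \<partial>lborel)"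
      proof (rule nn_integral_mono, rule nn_integral_mono)
        fix x y :: "real^4"
        show "ennreal (norm (?F x y)) \<le> ennreal (C * (B * \<bar>indicator (cball 0 (R + 1)) x * h x\<bar>)) * indicator (cball 0 R) y"
        proof (cases "norm y > R \<or> norm (x - y) \<ge> 1")
          case True
          then show ?thesis using R[of y] bubble_eq_0[of "x - y"] by auto
        next
          case False
          then have "norm x \<le> R + 1" using norm_triangle_ineq2[of x y] by linarith
          moreover have "\<bar>\<psi> y\<bar> * (\<bar>h x\<bar> * \<bar>bubble ((e n)\<^sup>2) (x - y)\<bar>) \<le> B * (\<bar>h x\<bar> * C)"
            using B C B0 bubble_nonneg[of "(e n)\<^sup>2" "x - y"] by (intro mult_mono) auto
          ultimately show ?thesis using False by (simp add: abs_mult mult_ac ennreal_leI)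
        qed
      qed
      also have "\<dots> = (\<integral>\<^sup>+x. ennreal (C * (B * \<bar>indicator (cball 0 (R + 1)) x * h x\<bar>)) \<partial>lborel) * emeasure lborel (cball 0 R :: (real^4) set)"
        by (subst nn_integral_cmult_indicator) (simp_all add: nn_integral_multc)
      also have "(\<integral>\<^sup>+x. ennreal (C * (B * \<bar>indicator (cball 0 (R + 1)) x * h x\<bar>)) \<partial>lborel) = ennreal (\<integral>x. C * (B * \<bar>indicator (cball 0 (R + 1)) x * h x\<bar>) \<partial>lborel)"
        by (rule nn_integral_eq_integral) (use hb B0 C0 in auto)
      also have "\<dots> * emeasure lborel (cball 0 R :: (real^4) set) < \<infinity>"
        using emeasure_lborel_cball_finite[of "0 :: real^4" R] by (simp add: ennreal_mult_less_top)
      finally show "(\<integral>\<^sup>+z. ennreal (norm (case z of (x, y) \<Rightarrow> ?F x y)) \<partial>(lborel \<Otimes>\<^sub>M lborel)) < \<infinity>" .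
    qed measurable
    have "(\<integral>y. \<psi> y * (\<integral>x. h x * bubble ((e n)\<^sup>2) (x - y) \<partial>lborel) \<partial>lborel) = (\<integral>y. (\<integral>x. ?F x y \<partial>lborel) \<partial>lborel)" by simp
    also have "\<dots> = (\<integral>x. (\<integral>y. ?F x y \<partial>lborel) \<partial>lborel)" by (rule lborel_pair.Fubini_integral[OF int])
    also have "\<dots> = (\<integral>x. (\<integral>y. h x * (\<psi> y * bubble ((e n)\<^sup>2) (x - y)) \<partial>lborel) \<partial>lborel)" by (simp only: mult_ac)
    also have "\<dots> = (\<integral>x. h x * mollify ((e n)\<^sup>2) \<psi> x \<partial>lborel)" unfolding mollify_def by simp
    finally show ?thesis .
  qed
  ultimately show ?thesis by (simp add: e_def)
qed

section \<open>From the weak Laplacian to level sets\<close>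

text \<open>The inequality \<open>u \<le> g\<close>, tested with continuous functions of compact support.\<close>

definition tests_le :: "('a::euclidean_space \<Rightarrow> real) \<Rightarrow> ('a \<Rightarrow> ennreal) \<Rightarrow> bool" where
  "tests_le u g \<longleftrightarrow> (\<forall>\<psi> R. continuous_on UNIV \<psi> \<longrightarrow> (\<forall>x. 0 \<le> \<psi> x \<and> \<psi> x \<le> 1) \<longrightarrow> (\<forall>x. norm x > R \<longrightarrow> \<psi> x = 0) \<longrightarrow>
      ennreal (\<integral>x. u x * \<psi> x \<partial>lborel) \<le> (\<integral>\<^sup>+x. ennreal (\<psi> x) * g x \<partial>lborel))"

definition weak_laplacian_eq :: "(real^'n::finite \<Rightarrow> real) \<Rightarrow> (real^'n \<Rightarrow> real) \<Rightarrow> bool" where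
  "weak_laplacian_eq u f \<longleftrightarrow> (\<forall>\<phi>. test_function \<phi> \<longrightarrow>
      (\<integral>x. u x * (\<Sum>i\<in>UNIV. pderivs [i, i] \<phi> x) \<partial>lborel) = (\<integral>x. f x * \<phi> x \<partial>lborel))"

text \<open>The functions \<open>\<psi> n\<close> decrease to the indicator of K and live in a fixed
  ball, on which u is integrable and g has finite integral. Dominated convergence then passes to the
  limit on both sides.\<close>

lemma level_from_compact:
  fixes u :: "'a::euclidean_space \<Rightarrow> real" and g :: "'a \<Rightarrow> ennreal"
  assumes u: "loc_int u" and [measurable]: "g \<in> borel_measurable borel"
    and fin: "\<And>R. (\<integral>\<^sup>+x. indicator (cball 0 R) x * g x \<partial>lborel) < \<infinity>"
    and T: "tests_le u g"
    and K: "compact K" and s: "0 \<le> s" "\<And>x. x \<in> K \<Longrightarrow> s < u x"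
  shows "ennreal s * emeasure lborel K \<le> (\<integral>\<^sup>+x. indicator K x * g x \<partial>lborel)"
proof (cases "K = {}")
  case False
  have clK: "closed K" using K by (rule compact_imp_closed)
  have [measurable]: "u \<in> borel_measurable borel" using u by (rule loc_int_measurable)
  have Km [measurable]: "K \<in> sets borel" using clK by simp
  obtain R where "\<forall>x\<in>K. norm x \<le> R" using compact_imp_bounded[OF K] unfolding bounded_iff by auto
  then have R: "K \<subseteq> cball 0 R" by auto
  define \<psi> where "\<psi> n x = max 0 (1 - real (Suc n) * infdist x K)" for n x
  have cont: "continuous_on UNIV (\<psi> n)" for n
    unfolding \<psi>_def by (intro continuous_intros)
  have [measurable]: "\<psi> n \<in> borel_measurable borel" for n
    using cont by (rule borel_measurable_continuous_onI)
  have \<psi>01: "0 \<le> \<psi> n x" "\<psi> n x \<le> 1" for n x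
    by (auto simp: \<psi>_def infdist_nonneg)
  have supp: "\<psi> n x = 0" if "norm x > R + 1" for n x
  proof -
    obtain y where y: "y \<in> K" "infdist x K = dist x y" using infdist_attains_inf[OF clK False] .
    have "norm y \<le> R" using y R by auto
    then have "infdist x K \<ge> 1" using that y(2) norm_triangle_ineq2[of x y] by (simp add: dist_norm)
    then have "1 * 1 \<le> real (Suc n) * infdist x K" by (intro mult_mono) auto
    then show ?thesis by (simp add: \<psi>_def)
  qed
  have ev: "\<forall>\<^sub>F n in sequentially. \<psi> n x = indicator K x" for x
  proof (cases "x \<in> K")
    case True
    then show ?thesis using clK by (simp add: \<psi>_def)
  next
    case False
    then have d: "infdist x K > 0" using clK \<open>K \<noteq> {}\<close> by (intro infdist_pos_not_in_closed)
    obtain N where N: "1 / infdist x K < real N" using reals_Archimedean2 by blast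
    show ?thesis
    proof (rule eventually_sequentiallyI)
      fix n assume "N \<le> n"
      then have "1 / infdist x K \<le> real (Suc n)" using N by linarith
      then have "1 \<le> real (Suc n) * infdist x K" using d by (simp only: divide_le_eq) 
      then show "\<psi> n x = indicator K x" using False by (simp add: \<psi>_def)
    qed
  qed
  have lim1: "(\<lambda>n. \<integral>x. u x * \<psi> n x \<partial>lborel) \<longlonglongrightarrow> (\<integral>x. u x * indicator K x \<partial>lborel)"
  proof (rule integral_dominated_convergence[where w="\<lambda>x. norm (indicator (cball 0 (R + 1)) x * u x)"])
    show "integrable lborel (\<lambda>x. norm (indicator (cball 0 (R + 1)) x * u x))"
      using u by (simp add: loc_int_def del: norm_mult)
    show "AE x in lborel. (\<lambda>n. u x * \<psi> n x) \<longlonglongrightarrow> u x * indicator K x"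
      by (intro AE_I2 tendsto_mult tendsto_const tendsto_eventually ev)
    show "AE x in lborel. norm (u x * \<psi> n x) \<le> norm (indicator (cball 0 (R + 1)) x * u x)" for n
    proof (rule AE_I2)
      fix x show "norm (u x * \<psi> n x) \<le> norm (indicator (cball 0 (R + 1)) x * u x)"
        using supp[of x n] \<psi>01[of n x] mult_left_mono[of "\<bar>\<psi> n x\<bar>" 1 "\<bar>u x\<bar>"]
        by (cases "norm x > R + 1") (auto simp: abs_mult)
    qed
  qed measurable
  have lim2: "(\<lambda>n. \<integral>\<^sup>+x. ennreal (\<psi> n x) * g x \<partial>lborel) \<longlonglongrightarrow> (\<integral>\<^sup>+x. indicator K x * g x \<partial>lborel)"
  proof (rule nn_integral_dominated_convergence[where w="\<lambda>x. indicator (cball 0 (R + 1)) x * g x"])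
    show "(\<integral>\<^sup>+x. indicator (cball 0 (R + 1)) x * g x \<partial>lborel) < \<infinity>" by (rule fin)
    show "AE x in lborel. (\<lambda>n. ennreal (\<psi> n x) * g x) \<longlonglongrightarrow> indicator K x * g x"
    proof (intro AE_I2 tendsto_eventually)
      fix x show "\<forall>\<^sub>F n in sequentially. ennreal (\<psi> n x) * g x = indicator K x * g x"
        using ev[of x] by eventually_elim (simp add: ennreal_indicator)
    qed
    show "AE x in lborel. ennreal (\<psi> n x) * g x \<le> indicator (cball 0 (R + 1)) x * g x" for n
    proof (rule AE_I2)
      fix x show "ennreal (\<psi> n x) * g x \<le> indicator (cball 0 (R + 1)) x * g x"
      proof (cases "norm x > R + 1")
        case False
        have "ennreal (\<psi> n x) * g x \<le> 1 * g x"
          using \<psi>01[of n x] by (intro mult_right_mono) auto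
        then show ?thesis using False by simp
      qed (simp add: supp)
    qed
  qed measurable
  have "ennreal (\<integral>x. u x * indicator K x \<partial>lborel) \<le> (\<integral>\<^sup>+x. indicator K x * g x \<partial>lborel)"
    by (rule LIMSEQ_le[OF tendsto_ennrealI[OF lim1] lim2])
       (use T cont \<psi>01 supp in \<open>unfold tests_le_def, blast\<close>)
  moreover have "s * measure lborel K \<le> (\<integral>x. u x * indicator K x \<partial>lborel)"
  proof -
    have "s * measure lborel K = (\<integral>x. s * indicator K x \<partial>lborel)" by simp
    also have "\<dots> \<le> (\<integral>x. u x * indicator K x \<partial>lborel)"
    proof (rule integral_mono)
      show "integrable lborel (\<lambda>x. s * indicator K x)"
        using emeasure_compact_finite[OF K] by (intro integrable_mult_right integrable_real_indicator) auto
      show "integrable lborel (\<lambda>x. u x * indicator K x)"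
        by (rule loc_int_integrable_mult[OF u, where B=1 and R=R]) (use R in \<open>auto simp: indicator_def split: if_splits\<close>)
      show "s * indicator K x \<le> u x * indicator K x" for x
        using s(2)[of x] by (auto simp: indicator_def)
    qed
    finally show ?thesis .
  qed
  moreover have "ennreal s * emeasure lborel K = ennreal (s * measure lborel K)"
  proof -
    have "emeasure lborel K \<noteq> \<infinity>" using emeasure_compact_finite[OF K] by auto
    then show ?thesis using s(1) by (simp add: emeasure_eq_ennreal_measure ennreal_mult)
  qed
  ultimately show ?thesis by (metis ennreal_leI order_trans)
qed simp

text \<open>Inner regularity: up to small measure E is closed, and a closed set is exhausted by its
  intersections with balls, to which the compact case applies.\<close>

lemma level_from_tests:
  fixes u :: "'a::euclidean_space \<Rightarrow> real" and g :: "'a \<Rightarrow> ennreal"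
  assumes u: "loc_int u" and gm [measurable]: "g \<in> borel_measurable borel"
    and fin: "\<And>R. (\<integral>\<^sup>+x. indicator (cball 0 R) x * g x \<partial>lborel) < \<infinity>"
    and T: "tests_le u g"
    and E: "E \<in> sets borel" and s: "0 \<le> s" "\<And>x. x \<in> E \<Longrightarrow> s < u x"
  shows "ennreal s * emeasure lborel E \<le> (\<integral>\<^sup>+x. indicator E x * g x \<partial>lborel)"
proof (rule ennreal_le_epsilon)
  have [measurable]: "E \<in> sets borel" by (rule E)
  fix e :: real assume e: "e > 0"
  have El: "E \<in> sets lebesgue" using E by simp
  \<comment> \<open>After multiplication by s the lost measure costs at most e; the summand 1 avoids
    division by zero.\<close>
  have "e / (s + 1) > 0" using e s by simp
  then obtain C where C: "closed C" "C \<subseteq> E" "E - C \<in> lmeasurable" "emeasure lebesgue (E - C) < ennreal (e / (s + 1))"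
    using sets_lebesgue_inner_closed[OF El] by metis
  have [measurable]: "C \<in> sets borel" using C by simp
  have C4: "emeasure lborel (E - C) \<le> ennreal (e / (s + 1))" using C(4) by simp
  define A where "A n = C \<inter> cball 0 (real n)" for n
  have Am: "A n \<in> sets lborel" for n by (simp add: A_def)
  have A: "ennreal s * emeasure lborel (A n) \<le> (\<integral>\<^sup>+x. indicator E x * g x \<partial>lborel)" for n
  proof -
    have "ennreal s * emeasure lborel (A n) \<le> (\<integral>\<^sup>+x. indicator (A n) x * g x \<partial>lborel)"
      using C by (intro level_from_compact[OF u gm fin T]) (auto simp: A_def closed_Int_compact s)
    also have "\<dots> \<le> (\<integral>\<^sup>+x. indicator E x * g x \<partial>lborel)"
      using C(2) by (intro nn_integral_mono mult_right_mono) (auto simp: A_def indicator_def)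
    finally show ?thesis .
  qed
  have UA: "(\<Union>n. A n) = C"
    by (auto simp: A_def real_arch_simple)
  have "ennreal s * emeasure lborel C = ennreal s * (SUP n. emeasure lborel (A n))"
    unfolding UA[symmetric] using Am by (subst SUP_emeasure_incseq) (auto simp: incseq_def A_def)
  also have "\<dots> = (SUP n. ennreal s * emeasure lborel (A n))" by (rule SUP_mult_left_ennreal)
  also have "\<dots> \<le> (\<integral>\<^sup>+x. indicator E x * g x \<partial>lborel)" by (rule SUP_least) (rule A)
  finally have 1: "ennreal s * emeasure lborel C \<le> (\<integral>\<^sup>+x. indicator E x * g x \<partial>lborel)" .
  have "s * (e / (s + 1)) \<le> e" using s(1) e by (simp add: field_simps)
  then have 2: "ennreal s * ennreal (e / (s + 1)) \<le> ennreal e"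
    using s(1) e by (simp add: ennreal_mult[symmetric] ennreal_leI)
  have "emeasure lborel E = emeasure lborel C + emeasure lborel (E - C)"
    using C(2) by (subst plus_emeasure) (auto simp: Un_absorb1)
  then have "ennreal s * emeasure lborel E = ennreal s * emeasure lborel C + ennreal s * emeasure lborel (E - C)"
    by (simp add: distrib_left)
  also have "\<dots> \<le> (\<integral>\<^sup>+x. indicator E x * g x \<partial>lborel) + ennreal e"
    using 1 2 C4 by (meson add_mono mult_left_mono order_trans zero_le)
  finally show "ennreal s * emeasure lborel E \<le> (\<integral>\<^sup>+x. indicator E x * g x \<partial>lborel) + ennreal e" .
qed

section \<open>Test functions and local integrability\<close>

lemma test_functionE:
  fixes \<phi> :: "real^'n::finite \<Rightarrow> real"
  assumes "test_function \<phi>"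
  obtains R B where "\<And>x. \<bar>\<phi> x\<bar> \<le> B" "\<And>x. norm x > R \<Longrightarrow> \<phi> x = 0"
proof -
  have cont: "continuous_on UNIV \<phi>" using assms smooth_imp_continuous_on by (auto simp: test_function_def)
  have K: "compact (closure {x. \<phi> x \<noteq> 0})" using assms by (simp add: test_function_def)
  obtain R where "\<forall>x\<in>closure {x. \<phi> x \<noteq> 0}. norm x \<le> R" using compact_imp_bounded[OF K] unfolding bounded_iff by auto
  then have R: "closure {x. \<phi> x \<noteq> 0} \<subseteq> cball 0 R" by auto
  have z: "\<phi> x = 0" if "norm x > R" for x
  proof (rule ccontr)
    assume "\<phi> x \<noteq> 0"
    then have "x \<in> closure {x. \<phi> x \<noteq> 0}" using closure_subset[of "{x. \<phi> x \<noteq> 0}"] by blast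
    then have "x \<in> cball 0 R" using R by blast
    then show False using that by simp
  qed
  have "compact (\<phi> ` cball 0 R)"
    by (intro compact_continuous_image continuous_on_subset[OF cont]) auto
  then obtain B where B: "\<And>y. y \<in> \<phi> ` cball 0 R \<Longrightarrow> \<bar>y\<bar> \<le> B"
    using compact_imp_bounded[of "\<phi> ` cball 0 R"] unfolding bounded_iff real_norm_def by blast
  have "\<bar>\<phi> x\<bar> \<le> max B 0" for x
  proof (cases "norm x > R")
    case False
    then have "\<phi> x \<in> \<phi> ` cball 0 R" by simp
    from B[OF this] show ?thesis by simp
  qed (simp add: z)
  then show ?thesis using that z by blast
qed

lemma test_function_continuous: "test_function \<phi> \<Longrightarrow> continuous_on S \<phi>"
  by (simp add: test_function_def smooth_imp_continuous_on)

lemma test_function_measurable: "test_function \<phi> \<Longrightarrow> \<phi> \<in> borel_measurable borel"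
  by (intro borel_measurable_continuous_onI test_function_continuous)

lemma test_function_pderiv_at:
  assumes "test_function \<phi>"
  shows "test_function (pderiv_at i \<phi>)"
  unfolding test_function_def
proof
  show "smooth (pderiv_at i \<phi>)" using assms by (simp add: test_function_def smooth_pderiv_at)
  let ?S = "closure {x. \<phi> x \<noteq> 0}"
  have "pderiv_at i \<phi> x = 0" if "x \<notin> ?S" for x
  proof -
    have "(\<phi> has_derivative (\<lambda>_. 0)) (at x)"
    proof (rule has_derivative_transform_within_open[of "\<lambda>_. 0"])
      show "open (- ?S)" "x \<in> - ?S" using that by auto
      show "0 = \<phi> y" if "y \<in> - ?S" for y
        using that closure_subset[of "{x. \<phi> x \<noteq> 0}"] by (metis (mono_tags, lifting) ComplD mem_Collect_eq subsetD)
    qed simp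
    from pderiv_at_eqI[OF this] show ?thesis by simp
  qed
  then have "{x. pderiv_at i \<phi> x \<noteq> 0} \<subseteq> ?S" by blast
  then have "closure {x. pderiv_at i \<phi> x \<noteq> 0} \<subseteq> ?S" by (rule closure_minimal) simp
  moreover have "compact (?S \<inter> closure {x. pderiv_at i \<phi> x \<noteq> 0})"
    using assms by (intro compact_Int_closed) (auto simp: test_function_def)
  ultimately show "compact (closure {x. pderiv_at i \<phi> x \<noteq> 0})" by (simp add: Int_absorb1)
qed

lemma test_function_pderivs: "test_function \<phi> \<Longrightarrow> test_function (pderivs js \<phi>)"
  by (induction js) (simp_all add: pderivs_Cons test_function_pderiv_at)

lemma loc_int_integrable_test:
  fixes h :: "real^'n::finite \<Rightarrow> real"
  assumes "loc_int h" "test_function \<phi>"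
  shows "integrable lborel (\<lambda>x. h x * \<phi> x)"
proof -
  obtain R B where "\<And>x. \<bar>\<phi> x\<bar> \<le> B" "\<And>x. norm x > R \<Longrightarrow> \<phi> x = 0"
    by (rule test_functionE[OF assms(2)]) (rule that)
  then show ?thesis by (rule loc_int_integrable_mult[OF assms(1) test_function_measurable[OF assms(2)]])
qed

lemma nn_integral_riesz: "(\<integral>\<^sup>+x. ennreal (riesz x) \<partial>lborel) < \<infinity>"
proof -
  have "(\<integral>\<^sup>+x. ennreal (riesz x) \<partial>lborel) = (\<integral>\<^sup>+x. ennreal (1 / (4 * pi\<^sup>2)) * (indicator (ball 0 1) x * ennreal (norm (x::real^4) powr - 2)) \<partial>lborel)"
  proof (intro nn_integral_cong)
    fix x :: "real^4"
    show "ennreal (riesz x) = ennreal (1 / (4 * pi\<^sup>2)) * (indicator (ball 0 1) x * ennreal (norm x powr - 2))"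
    proof (cases "norm x < 1")
      case True
      have "norm x powr - 2 = 1 / (norm x)\<^sup>2" by (cases "x = 0") (simp_all add: powr_minus_divide)
      then show ?thesis using True by (simp add: riesz_def ennreal_mult[symmetric])
    qed (simp add: riesz_def)
  qed
  also have "\<dots> = ennreal (1 / (4 * pi\<^sup>2)) * (\<integral>\<^sup>+x. indicator (ball 0 1) x * ennreal (norm (x::real^4) powr - 2) \<partial>lborel)"
    by (rule nn_integral_cmult) measurable
  also have "\<dots> < \<infinity>"
    using nn_integral_ball_powr[of 2 1] by (simp add: ennreal_mult_less_top le_less_trans)
  finally show ?thesis .
qed

text \<open>Since k vanishes outside the unit ball, only the values of f on the ball of radius R + 1
  matter, and there the integrals multiply.\<close>

lemma nn_integral_convolution_finite:
  fixes k f :: "real^4 \<Rightarrow> real"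
  assumes [measurable]: "k \<in> borel_measurable borel" and k0: "\<And>x. norm x \<ge> 1 \<Longrightarrow> k x = 0"
    and k: "(\<integral>\<^sup>+x. ennreal (k x) \<partial>lborel) < \<infinity>" and f: "loc_int f"
  shows "(\<integral>\<^sup>+y. indicator (cball 0 R) y * (\<integral>\<^sup>+x. ennreal (k (x - y)) * ennreal \<bar>f x\<bar> \<partial>lborel) \<partial>lborel) < \<infinity>"
proof -
  have [measurable]: "f \<in> borel_measurable borel" using f by (rule loc_int_measurable)
  have "(\<integral>\<^sup>+y. indicator (cball 0 R) y * (\<integral>\<^sup>+x. ennreal (k (x - y)) * ennreal \<bar>f x\<bar> \<partial>lborel) \<partial>lborel)
     = (\<integral>\<^sup>+y. (\<integral>\<^sup>+x. indicator (cball 0 R) y * (ennreal (k (x - y)) * ennreal \<bar>f x\<bar>) \<partial>lborel) \<partial>lborel)"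
    by (simp add: nn_integral_cmult)
  also have "\<dots> = (\<integral>\<^sup>+x. (\<integral>\<^sup>+y. indicator (cball 0 R) y * (ennreal (k (x - y)) * ennreal \<bar>f x\<bar>) \<partial>lborel) \<partial>lborel)"
    by (rule lborel_pair.Fubini') measurable
  also have "\<dots> \<le> (\<integral>\<^sup>+x. (\<integral>\<^sup>+y. ennreal (k (x - y)) * ennreal \<bar>indicator (cball 0 (R + 1)) x * f x\<bar> \<partial>lborel) \<partial>lborel)"
  proof (rule nn_integral_mono, rule nn_integral_mono)
    fix x y :: "real^4"
    show "indicator (cball 0 R) y * (ennreal (k (x - y)) * ennreal \<bar>f x\<bar>) \<le> ennreal (k (x - y)) * ennreal \<bar>indicator (cball 0 (R + 1)) x * f x\<bar>"
    proof (cases "norm y > R \<or> norm (x - y) \<ge> 1")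
      case True
      then show ?thesis using k0[of "x - y"] by auto
    next
      case False
      then have "norm x \<le> R + 1" using norm_triangle_ineq2[of x y] by linarith
      then show ?thesis using False by simp
    qed
  qed
  also have "\<dots> = (\<integral>\<^sup>+x. (\<integral>\<^sup>+y. ennreal (k (x - y)) \<partial>lborel) * ennreal \<bar>indicator (cball 0 (R + 1)) x * f x\<bar> \<partial>lborel)"
    by (simp add: nn_integral_multc)
  also have "\<dots> = (\<integral>\<^sup>+x. (\<integral>\<^sup>+y. ennreal (k y) \<partial>lborel) * ennreal \<bar>indicator (cball 0 (R + 1)) x * f x\<bar> \<partial>lborel)"
    by (subst nn_integral_lborel_reflect[of "\<lambda>y. ennreal (k y)"]) auto
  also have "\<dots> = (\<integral>\<^sup>+y. ennreal (k y) \<partial>lborel) * (\<integral>\<^sup>+x. ennreal \<bar>indicator (cball 0 (R + 1)) x * f x\<bar> \<partial>lborel)"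
    by (rule nn_integral_cmult) measurable
  also have "(\<integral>\<^sup>+x. ennreal \<bar>indicator (cball 0 (R + 1)) x * f x\<bar> \<partial>lborel) < \<infinity>"
  proof -
    have "integrable lborel (\<lambda>x. indicator (cball 0 (R + 1)) x * f x)" using f by (simp add: loc_int_def)
    from conjunct2[OF integrable_iff_bounded[THEN iffD1, OF this]] show ?thesis unfolding real_norm_def .
  qed
  then have "(\<integral>\<^sup>+y. ennreal (k y) \<partial>lborel) * (\<integral>\<^sup>+x. ennreal \<bar>indicator (cball 0 (R + 1)) x * f x\<bar> \<partial>lborel) < \<infinity>"
    using k by (simp add: ennreal_mult_less_top)
  finally show ?thesis .
qed

lemma pot_locally_finite:
  assumes f: "loc_int f" and u: "loc_int u"
  shows "(\<integral>\<^sup>+y. indicator (cball 0 R) y * pot c f u y \<partial>lborel) < \<infinity>"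
proof -
  have [measurable]: "f \<in> borel_measurable borel" "u \<in> borel_measurable borel" using f u loc_int_measurable by auto
  have 1: "(\<integral>\<^sup>+y. indicator (cball 0 R) y * (\<integral>\<^sup>+x. ennreal (riesz (x - y)) * ennreal \<bar>f x\<bar> \<partial>lborel) \<partial>lborel) < \<infinity>"
    by (rule nn_integral_convolution_finite[OF _ _ nn_integral_riesz f]) (auto simp: riesz_def)
  have 2: "(\<integral>\<^sup>+y. indicator (cball 0 R) y * (\<integral>\<^sup>+x. ennreal (indicator (ball 0 1) (x - y)) * ennreal \<bar>u x\<bar> \<partial>lborel) \<partial>lborel) < \<infinity>"
    by (rule nn_integral_convolution_finite[OF _ _ _ u]) (auto simp: ennreal_indicator emeasure_ball)
  have "(\<integral>\<^sup>+y. indicator (cball 0 R) y * pot c f u y \<partial>lborel) =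
    (\<integral>\<^sup>+y. indicator (cball 0 R) y * (\<integral>\<^sup>+x. ennreal (riesz (x - y)) * ennreal \<bar>f x\<bar> \<partial>lborel) \<partial>lborel)
    + ennreal c * (\<integral>\<^sup>+y. indicator (cball 0 R) y * (\<integral>\<^sup>+x. ennreal (indicator (ball 0 1) (x - y)) * ennreal \<bar>u x\<bar> \<partial>lborel) \<partial>lborel)"
    unfolding pot_def distrib_left mult.left_commute[of _ "ennreal c"]
    by (simp add: nn_integral_add nn_integral_cmult ennreal_indicator)
  then show ?thesis using 1 2 by (simp add: ennreal_mult_less_top)
qed

section \<open>Testing with the regularised Newtonian kernel\<close>

lemma newton_le_riesz: "e > 0 \<Longrightarrow> x \<noteq> 0 \<Longrightarrow> newton e x \<le> riesz x"
proof -
  assume e: "e > 0" and x: "x \<noteq> 0"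
  show ?thesis
  proof (cases "norm x < 1")
    case True
    have "cutoff ((norm x)\<^sup>2) / (4 * pi\<^sup>2 * ((norm x)\<^sup>2 + e)) \<le> 1 / (4 * pi\<^sup>2 * (norm x)\<^sup>2)"
      using e x by (intro frac_le cutoff_le_1 mult_pos_pos) auto
    then show ?thesis using True by (simp add: newton_def riesz_def)
  next
    case False
    then show ?thesis by (simp add: newton_def cutoff_eq_0 one_le_power)
  qed
qed

lemma newton_nonneg: "e > 0 \<Longrightarrow> 0 \<le> newton e x"
  by (simp add: newton_def)

text \<open>Testing the equation with \<open>newton e\<close> centred at y produces the average of u
  against a bubble. The cutoff error costs C times the integral of |u| over the unit ball around y,
  and the kernel is dominated by \<open>riesz\<close>. The majorant \<open>pot\<close> is the same
  for every e, so e can tend to 0 after integration against \<psi>.\<close>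

lemma weak_laplacian_pot:
  obtains C where "C > 0"
    "\<And>u f :: real^4 \<Rightarrow> real. loc_int u \<Longrightarrow> loc_int f \<Longrightarrow> weak_laplacian_eq u f \<Longrightarrow> tests_le u (pot C f u)"
proof -
  obtain C where C: "C > 0" "\<And>e x y. e > 0 \<Longrightarrow>
       \<bar>(\<Sum>i\<in>UNIV. pderivs [i, i] (\<lambda>x. newton e (x - y)) x) + bubble e (x - y)\<bar> \<le> C * indicator (ball 0 1) (x - y)"
    using laplacian_newton by blast
  have "ennreal (\<integral>x. u x * \<psi> x \<partial>lborel) \<le> (\<integral>\<^sup>+x. ennreal (\<psi> x) * pot C f u x \<partial>lborel)"
    if u: "loc_int u" and f: "loc_int f"
      and weak: "weak_laplacian_eq u f"
      and \<psi>: "continuous_on UNIV \<psi>" "\<And>x. 0 \<le> \<psi> x" "\<And>x. \<psi> x \<le> 1" "\<And>x. norm x > R \<Longrightarrow> \<psi> x = 0"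
    for u f :: "real^4 \<Rightarrow> real" and \<psi> R
  proof -
    have [measurable]: "f \<in> borel_measurable borel" "u \<in> borel_measurable borel" using f u loc_int_measurable by auto
    have [measurable]: "\<psi> \<in> borel_measurable borel" using \<psi>(1) by (rule borel_measurable_continuous_onI)
    have pm [measurable]: "pot C f u \<in> borel_measurable borel" by (rule borel_measurable_pot) measurable
    have pw: "ennreal (\<integral>x. u x * bubble e (x - y) \<partial>lborel) \<le> pot C f u y" if e: "e > 0" for e y
    proof -
      let ?N = "\<lambda>x. newton e (x - y)" and ?B = "\<lambda>x. bubble e (x - y)"
      let ?L = "\<lambda>x. \<Sum>i\<in>UNIV. pderivs [i, i] ?N x"
      have tN: "test_function ?N" and tB: "test_function ?B"
        using e by (auto intro: test_function_newton test_function_bubble)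
      have iL: "integrable lborel (\<lambda>x. u x * ?L x)"
        unfolding sum_distrib_left by (intro Bochner_Integration.integrable_sum loc_int_integrable_test[OF u] test_function_pderivs tN)
      have iB: "integrable lborel (\<lambda>x. u x * ?B x)" by (rule loc_int_integrable_test[OF u tB])
      have iN: "integrable lborel (\<lambda>x. f x * ?N x)" by (rule loc_int_integrable_test[OF f tN])
      have iR: "integrable lborel (\<lambda>x. u x * (?L x + ?B x))"
        unfolding distrib_left by (intro Bochner_Integration.integrable_add iL iB)
      \<comment> \<open>Adding and subtracting the Laplacian isolates the bubble; the weak equation
        then trades u times the Laplacian for f times the kernel.\<close>
      have "(\<integral>x. u x * ?B x \<partial>lborel) = (\<integral>x. u x * (?L x + ?B x) \<partial>lborel) - (\<integral>x. u x * ?L x \<partial>lborel)"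
        unfolding distrib_left Bochner_Integration.integral_add[OF iL iB] by simp
      also have "\<dots> = (\<integral>x. u x * (?L x + ?B x) \<partial>lborel) - (\<integral>x. f x * ?N x \<partial>lborel)"
        using weak tN by (simp add: weak_laplacian_eq_def)
      also have "\<dots> \<le> norm (\<integral>x. f x * ?N x \<partial>lborel) + norm (\<integral>x. u x * (?L x + ?B x) \<partial>lborel)" by simp
      finally have "ennreal (\<integral>x. u x * ?B x \<partial>lborel) \<le> ennreal (norm (\<integral>x. f x * ?N x \<partial>lborel) + norm (\<integral>x. u x * (?L x + ?B x) \<partial>lborel))"
        by (rule ennreal_leI)
      also have "\<dots> = ennreal (norm (\<integral>x. f x * ?N x \<partial>lborel)) + ennreal (norm (\<integral>x. u x * (?L x + ?B x) \<partial>lborel))"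
        by (rule ennreal_plus) auto
      also have "\<dots> \<le> (\<integral>\<^sup>+x. norm (f x * ?N x) \<partial>lborel) + (\<integral>\<^sup>+x. norm (u x * (?L x + ?B x)) \<partial>lborel)"
        by (intro add_mono integral_norm_bound_ennreal iN iR)
      also have "\<dots> \<le> pot C f u y"
        unfolding pot_def
      proof (rule add_mono)
        show "(\<integral>\<^sup>+x. norm (f x * ?N x) \<partial>lborel) \<le> (\<integral>\<^sup>+x. ennreal (riesz (x - y)) * ennreal \<bar>f x\<bar> \<partial>lborel)"
        proof (rule nn_integral_mono_AE)
          show "AE x in lborel. ennreal (norm (f x * ?N x)) \<le> ennreal (riesz (x - y)) * ennreal \<bar>f x\<bar>"
            using AE_lborel_singleton[of y]
          proof eventually_elim
            case (elim x)
            then have "\<bar>?N x\<bar> \<le> riesz (x - y)" using newton_le_riesz[OF e, of "x - y"] newton_nonneg[OF e, of "x - y"] by simp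
            then have "norm (f x * ?N x) \<le> riesz (x - y) * \<bar>f x\<bar>"
              by (simp add: abs_mult mult.commute mult_left_mono)
            then show ?case by (simp add: ennreal_mult[symmetric] ennreal_leI)
          qed
        qed
        have "(\<integral>\<^sup>+x. norm (u x * (?L x + ?B x)) \<partial>lborel) \<le> (\<integral>\<^sup>+x. ennreal C * (indicator (ball 0 1) (x - y) * ennreal \<bar>u x\<bar>) \<partial>lborel)"
        proof (rule nn_integral_mono)
          fix x
          have "norm (u x * (?L x + ?B x)) \<le> \<bar>u x\<bar> * (C * indicator (ball 0 1) (x - y))"
            unfolding real_norm_def abs_mult by (intro mult_left_mono C e) auto
          also have "\<dots> = C * (indicator (ball 0 1) (x - y) * \<bar>u x\<bar>)" by simp
          finally have "ennreal (norm (u x * (?L x + ?B x))) \<le> ennreal (C * (indicator (ball 0 1) (x - y) * \<bar>u x\<bar>))" by (rule ennreal_leI)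
          then show "ennreal (norm (u x * (?L x + ?B x))) \<le> ennreal C * (indicator (ball 0 1) (x - y) * ennreal \<bar>u x\<bar>)"
            using C(1) by (simp add: ennreal_mult ennreal_indicator)
        qed
        then show "(\<integral>\<^sup>+x. norm (u x * (?L x + ?B x)) \<partial>lborel) \<le> ennreal C * (\<integral>\<^sup>+x. indicator (ball 0 1) (x - y) * ennreal \<bar>u x\<bar> \<partial>lborel)"
          by (simp add: nn_integral_cmult)
      qed
      finally show ?thesis .
    qed
    let ?e = "\<lambda>n. (inverse (real (Suc n)))\<^sup>2"
    have lim: "(\<lambda>n. \<integral>y. \<psi> y * (\<integral>x. u x * bubble (?e n) (x - y) \<partial>lborel) \<partial>lborel) \<longlonglongrightarrow> (\<integral>x. u x * \<psi> x \<partial>lborel)"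
      by (rule integral_mollify_tendsto[OF u \<psi>(1) _ \<psi>(4), of 1]) (use \<psi>(2,3) in auto)
    have "ennreal (\<integral>y. \<psi> y * (\<integral>x. u x * bubble (?e n) (x - y) \<partial>lborel) \<partial>lborel) \<le> (\<integral>\<^sup>+x. ennreal (\<psi> x) * pot C f u x \<partial>lborel)" for n
    proof -
      have "ennreal (\<integral>y. \<psi> y * (\<integral>x. u x * bubble (?e n) (x - y) \<partial>lborel) \<partial>lborel) \<le> (\<integral>\<^sup>+y. ennreal (\<psi> y * (\<integral>x. u x * bubble (?e n) (x - y) \<partial>lborel)) \<partial>lborel)"
        by (rule ennreal_integral_le_nn_integral) measurable
      also have "\<dots> \<le> (\<integral>\<^sup>+x. ennreal (\<psi> x) * pot C f u x \<partial>lborel)"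
        using \<psi>(2) by (intro nn_integral_mono) (simp add: ennreal_mult' mult_left_mono pw)
      finally show ?thesis .
    qed
    then show ?thesis
      by (intro LIMSEQ_le_const2[OF tendsto_ennrealI[OF lim]]) auto
  qed
  then have "tests_le u (pot C f u)" if "loc_int u" "loc_int f" "weak_laplacian_eq u f" for u f :: "real^4 \<Rightarrow> real"
    unfolding tests_le_def using that by blast
  with C(1) that show ?thesis by blast
qed

section \<open>The bound on Sobolev functions\<close>

lemma locally_integrable_rep:
  fixes h :: "real^'n::finite \<Rightarrow> real"
  assumes h: "locally_integrable h"
  obtains h' where "loc_int h'" "AE x in lborel. h x = h' x"
proof -
  have hm: "h \<in> borel_measurable lebesgue" using h by (simp add: locally_integrable_def)
  obtain h' where h' [measurable]: "h' \<in> borel_measurable lborel" and ae: "AE x in lborel. h x = h' x"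
    using completion_ex_borel_measurable_real[OF hm] by auto
  have "integrable lborel (\<lambda>x. indicator (cball 0 R) x * h' x)" for R
  proof -
    have "set_integrable lebesgue (cball 0 R) h" using h by (simp add: locally_integrable_def)
    then have "integrable lebesgue (\<lambda>x. indicator (cball 0 R) x * h x)" by (simp add: set_integrable_def)
    moreover have "(\<lambda>x. indicator (cball 0 R) x * h x) \<in> borel_measurable lebesgue"
      using calculation by (rule borel_measurable_integrable)
    moreover have m: "(\<lambda>x. indicator (cball 0 R) x * h' x) \<in> borel_measurable lborel" by measurable
    then have "(\<lambda>x. indicator (cball 0 R) x * h' x) \<in> borel_measurable lebesgue" by (rule measurable_completion)
    moreover have "AE x in lebesgue. indicator (cball 0 R) x * h x = indicator (cball 0 R) x * h' x"
      using AE_completion[OF ae] by eventually_elim simp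
    ultimately have "integrable lebesgue (\<lambda>x. indicator (cball 0 R) x * h' x)"
      using integrable_cong_AE by blast
    then show ?thesis using integrable_completion[OF m] by simp
  qed
  then have "loc_int h'" using h' by (simp add: loc_int_def)
  with ae that show ?thesis by blast
qed

lemma integral_lebesgue_rep:
  fixes h :: "real^'n::finite \<Rightarrow> real"
  assumes "locally_integrable h" "loc_int h'" "AE x in lborel. h x = h' x" and \<phi>: "\<phi> \<in> borel_measurable borel"
  shows "(LINT x|lebesgue. h x * \<phi> x) = (\<integral>x. h' x * \<phi> x \<partial>lborel)"
proof -
  have hm [measurable]: "h \<in> borel_measurable lebesgue" using assms by (simp add: locally_integrable_def)
  have h'm: "h' \<in> borel_measurable lborel" using assms(2) loc_int_measurable by auto
  have \<phi>m: "\<phi> \<in> borel_measurable lborel" using \<phi> by simp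
  have [measurable]: "h' \<in> borel_measurable lebesgue" "\<phi> \<in> borel_measurable lebesgue"
    using h'm \<phi>m by (auto intro: measurable_completion)
  have "(LINT x|lebesgue. h x * \<phi> x) = (LINT x|lebesgue. h' x * \<phi> x)"
  proof (rule integral_cong_AE)
    show "AE x in lebesgue. h x * \<phi> x = h' x * \<phi> x"
      using AE_completion[OF assms(3)] by eventually_elim simp
  qed measurable
  also have "\<dots> = (\<integral>x. h' x * \<phi> x \<partial>lborel)"
    using h'm \<phi>m by (intro integral_completion borel_measurable_times)
  finally show ?thesis .
qed

lemma loc_int_sum:
  assumes "\<And>i. i \<in> I \<Longrightarrow> loc_int (h i)"
  shows "loc_int (\<lambda>x. \<Sum>i\<in>I. h i x)"
  unfolding loc_int_def
proof (intro conjI allI)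
  show "(\<lambda>x. \<Sum>i\<in>I. h i x) \<in> borel_measurable borel"
    using assms by (intro borel_measurable_sum) (simp add: loc_int_def)
  have "integrable lborel (\<lambda>x. \<Sum>i\<in>I. indicator (cball 0 R) x * h i x)" for R
    using assms by (intro Bochner_Integration.integrable_sum) (simp add: loc_int_def)
  then show "integrable lborel (\<lambda>x. indicator (cball 0 R) x * (\<Sum>i\<in>I. h i x))" for R
    by (simp add: sum_distrib_left)
qed

lemma loc_int_minus: "loc_int h \<Longrightarrow> loc_int (\<lambda>x. - h x)"
  unfolding loc_int_def by auto

lemma loc_int_diff: "loc_int h \<Longrightarrow> loc_int g \<Longrightarrow> loc_int (\<lambda>x. h x - g x)"
  unfolding loc_int_def right_diff_distrib by (simp add: borel_measurable_diff)

lemma has_weak_deriv_wderiv: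
  assumes "u \<in> sobolev k p" "length js \<le> k"
  shows "has_weak_deriv js u (wderiv js u)"
proof -
  have "\<exists>v. has_weak_deriv js u v" using assms unfolding sobolev_def by blast
  then show ?thesis unfolding wderiv_def by (rule someI_ex)
qed

lemma pot_minus: "pot c (\<lambda>x. - f x) (\<lambda>x. - u x) = pot c f u"
  by (simp add: pot_def[abs_def])

text \<open>Energy and integral see u only up to null sets, so Borel representatives of u and of its
  pure second weak derivatives may be used. The sum of the latter is the f of the level set
  estimate, and the weak equation for it follows by adding the coordinate identities.\<close>

lemma adams_integral_bounded:
  fixes \<alpha> \<tau> \<sigma> :: real
  assumes \<alpha>: "0 \<le> \<alpha>" "\<alpha> < 4" and \<tau>: "\<tau> > 0" and \<sigma>: "\<sigma> > 0"
  obtains K :: real where "\<And>u :: real^4 \<Rightarrow> real. u \<in> sobolev 2 2 \<Longrightarrow> adams_energy \<tau> \<sigma> u \<le> 1 \<Longrightarrow>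
    adams_integral \<alpha> (beta_crit \<alpha>) u \<le> ennreal K"
proof -
  obtain C where C: "C > 0" and tests: "\<And>u f :: real^4 \<Rightarrow> real. loc_int u \<Longrightarrow> loc_int f \<Longrightarrow>
      weak_laplacian_eq u f \<Longrightarrow> tests_le u (pot C f u)"
    by (rule weak_laplacian_pot) blast
  show ?thesis
  proof (rule level_set_integral_bound[OF \<alpha> \<sigma> C])
    fix K :: real
    assume K: "\<And>f u :: real^4 \<Rightarrow> real. f \<in> borel_measurable borel \<Longrightarrow> u \<in> borel_measurable borel \<Longrightarrow>
         (\<integral>\<^sup>+x. ennreal ((f x)\<^sup>2) \<partial>lborel) + ennreal \<sigma> * (\<integral>\<^sup>+x. ennreal ((u x)\<^sup>2) \<partial>lborel) \<le> 1 \<Longrightarrow>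
         (\<And>s E. 0 \<le> s \<Longrightarrow> E \<in> sets borel \<Longrightarrow> emeasure lborel E < \<infinity> \<Longrightarrow> (\<And>x. x \<in> E \<Longrightarrow> s < \<bar>u x\<bar>) \<Longrightarrow>
            ennreal s * emeasure lborel E \<le> (\<integral>\<^sup>+y. indicator E y * pot C f u y \<partial>lborel)) \<Longrightarrow>
         (\<integral>\<^sup>+x. ennreal ((exp (beta_crit \<alpha> * (u x)\<^sup>2) - 1) / norm x powr \<alpha>) \<partial>lborel) \<le> ennreal K"
    have "adams_integral \<alpha> (beta_crit \<alpha>) u \<le> ennreal K"
      if u: "u \<in> sobolev 2 2" and en: "adams_energy \<tau> \<sigma> u \<le> 1" for u :: "real^4 \<Rightarrow> real"
    proof -
      have wd: "has_weak_deriv [i, i] u (wderiv [i, i] u)" for i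
        by (rule has_weak_deriv_wderiv[OF u]) simp
      have lu: "locally_integrable u" and lw: "locally_integrable (wderiv [i, i] u)" for i
        using wd unfolding has_weak_deriv_def by auto
      obtain v where v: "loc_int v" "AE x in lborel. u x = v x" by (rule locally_integrable_rep[OF lu])
      have "\<exists>w. loc_int w \<and> (AE x in lborel. wderiv [i, i] u x = w x)" for i
        by (rule locally_integrable_rep[OF lw[of i]]) blast
      then obtain w where w: "\<And>i. loc_int (w i)" "\<And>i. AE x in lborel. wderiv [i, i] u x = w i x" by metis
      define f where "f x = (\<Sum>i\<in>UNIV. w i x)" for x
      have f: "loc_int f" unfolding f_def by (intro loc_int_sum w)
      have fae: "AE x in lborel. weak_laplacian u x = f x"
      proof -
        have "AE x in lborel. \<forall>i\<in>UNIV. wderiv [i, i] u x = w i x"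
          by (intro AE_finite_allI w) simp
        then show ?thesis by eventually_elim (simp add: weak_laplacian_def f_def)
      qed
      have weak: "(\<integral>x. v x * (\<Sum>i\<in>UNIV. pderivs [i, i] \<phi> x) \<partial>lborel) = (\<integral>x. f x * \<phi> x \<partial>lborel)"
        if \<phi>: "test_function \<phi>" for \<phi>
      proof -
        have 1: "(\<integral>x. v x * pderivs [i, i] \<phi> x \<partial>lborel) = (\<integral>x. w i x * \<phi> x \<partial>lborel)" for i
        proof -
          have "(\<integral>x. v x * pderivs [i, i] \<phi> x \<partial>lborel) = (LINT x|lebesgue. u x * pderivs [i, i] \<phi> x)"
            by (rule integral_lebesgue_rep[OF lu v test_function_measurable[OF test_function_pderivs[OF \<phi>]], symmetric])
          also have "\<dots> = (LINT x|lebesgue. wderiv [i, i] u x * \<phi> x)"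
            using wd[of i] \<phi> unfolding has_weak_deriv_def by simp
          also have "\<dots> = (\<integral>x. w i x * \<phi> x \<partial>lborel)"
            by (rule integral_lebesgue_rep[OF lw w test_function_measurable[OF \<phi>]])
          finally show ?thesis .
        qed
        have "(\<integral>x. v x * (\<Sum>i\<in>UNIV. pderivs [i, i] \<phi> x) \<partial>lborel) = (\<Sum>i\<in>UNIV. \<integral>x. v x * pderivs [i, i] \<phi> x \<partial>lborel)"
          unfolding sum_distrib_left by (intro Bochner_Integration.integral_sum loc_int_integrable_test v test_function_pderivs \<phi>)
        also have "\<dots> = (\<Sum>i\<in>UNIV. \<integral>x. w i x * \<phi> x \<partial>lborel)" by (simp only: 1)
        also have "\<dots> = (\<integral>x. f x * \<phi> x \<partial>lborel)"
          unfolding f_def sum_distrib_right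
          by (intro Bochner_Integration.integral_sum[symmetric] loc_int_integrable_test w \<phi>)
        finally show ?thesis .
      qed
      then have weak_eq: "weak_laplacian_eq v f" by (simp add: weak_laplacian_eq_def)
      have [measurable]: "v \<in> borel_measurable borel" "f \<in> borel_measurable borel"
        using v f by (auto intro: loc_int_measurable)
      have energy: "(\<integral>\<^sup>+x. ennreal ((f x)\<^sup>2) \<partial>lborel) + ennreal \<sigma> * (\<integral>\<^sup>+x. ennreal ((v x)\<^sup>2) \<partial>lborel) \<le> 1"
      proof -
        have "(\<integral>\<^sup>+x. ennreal ((f x)\<^sup>2) \<partial>lborel) + ennreal \<sigma> * (\<integral>\<^sup>+x. ennreal ((v x)\<^sup>2) \<partial>lborel)
          = (\<integral>\<^sup>+x. ennreal ((f x)\<^sup>2) + ennreal \<sigma> * ennreal ((v x)\<^sup>2) \<partial>lborel)"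
          by (simp add: nn_integral_add nn_integral_cmult)
        also have "\<dots> \<le> (\<integral>\<^sup>+x. ennreal (\<bar>weak_laplacian u x\<bar>\<^sup>2 + \<tau> * (norm (weak_grad u x))\<^sup>2 + \<sigma> * \<bar>u x\<bar>\<^sup>2) \<partial>lborel)"
        proof (rule nn_integral_mono_AE)
          show "AE x in lborel. ennreal ((f x)\<^sup>2) + ennreal \<sigma> * ennreal ((v x)\<^sup>2) \<le>
            ennreal (\<bar>weak_laplacian u x\<bar>\<^sup>2 + \<tau> * (norm (weak_grad u x))\<^sup>2 + \<sigma> * \<bar>u x\<bar>\<^sup>2)"
            using fae v(2)
          proof eventually_elim
            case (elim x)
            have "ennreal ((f x)\<^sup>2) + ennreal \<sigma> * ennreal ((v x)\<^sup>2) = ennreal ((f x)\<^sup>2 + \<sigma> * (v x)\<^sup>2)"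
              using \<sigma> by (simp add: ennreal_mult)
            also have "\<dots> \<le> ennreal (\<bar>weak_laplacian u x\<bar>\<^sup>2 + \<tau> * (norm (weak_grad u x))\<^sup>2 + \<sigma> * \<bar>u x\<bar>\<^sup>2)"
              using elim \<tau> by (intro ennreal_leI) simp
            finally show ?case .
          qed
        qed
        also have "\<dots> = adams_energy \<tau> \<sigma> u" unfolding adams_energy_def by (rule nn_integral_completion[symmetric])
        also note en
        finally show ?thesis .
      qed
      have lev: "ennreal s * emeasure lborel E \<le> (\<integral>\<^sup>+y. indicator E y * pot C f v y \<partial>lborel)"
        if s: "0 \<le> s" and E [measurable]: "E \<in> sets borel" and sE: "\<And>x. x \<in> E \<Longrightarrow> s < \<bar>v x\<bar>" for s E
      proof -
        have pm [measurable]: "pot C f v \<in> borel_measurable borel" by (rule borel_measurable_pot) measurable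
        \<comment> \<open>The potential bound is one-sided. Where v <= 0 it is applied to -v and -f;
          \<open>pot\<close> sees only absolute values.\<close>
        define P N where "P = E \<inter> {x. 0 < v x}" and "N = E \<inter> {x. v x \<le> 0}"
        have "{x \<in> space borel. 0 < v x} \<in> sets borel" "{x \<in> space borel. v x \<le> 0} \<in> sets borel" by measurable
        then have PN [measurable]: "P \<in> sets borel" "N \<in> sets borel" using E by (auto simp: P_def N_def)
        have p: "ennreal s * emeasure lborel P \<le> (\<integral>\<^sup>+y. indicator P y * pot C f v y \<partial>lborel)"
          by (rule level_from_tests[OF v(1) pm pot_locally_finite[OF f v(1)] tests[OF v(1) f weak_eq] PN(1) s])
             (use sE in \<open>force simp: P_def\<close>)
        have weak': "weak_laplacian_eq (\<lambda>x. - v x) (\<lambda>x. - f x)"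
          using weak_eq by (simp add: weak_laplacian_eq_def)
        have n: "ennreal s * emeasure lborel N \<le> (\<integral>\<^sup>+y. indicator N y * pot C f v y \<partial>lborel)"
          using level_from_tests[OF loc_int_minus[OF v(1)] _ _ tests[OF loc_int_minus[OF v(1)] loc_int_minus[OF f] weak'] PN(2) s]
            pm pot_locally_finite[OF f v(1)] sE unfolding pot_minus by (force simp: N_def)
        have E': "E = P \<union> N" "P \<inter> N = {}" by (auto simp: P_def N_def)
        have "ennreal s * emeasure lborel E = ennreal s * emeasure lborel P + ennreal s * emeasure lborel N"
          unfolding E'(1) distrib_left[symmetric] using E'(2) by (subst plus_emeasure) auto
        also have "\<dots> \<le> (\<integral>\<^sup>+y. indicator P y * pot C f v y \<partial>lborel) + (\<integral>\<^sup>+y. indicator N y * pot C f v y \<partial>lborel)"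
          by (intro add_mono p n)
        also have "\<dots> = (\<integral>\<^sup>+y. indicator P y * pot C f v y + indicator N y * pot C f v y \<partial>lborel)"
          by (rule nn_integral_add[symmetric]) measurable
        also have "\<dots> = (\<integral>\<^sup>+y. indicator E y * pot C f v y \<partial>lborel)"
          unfolding E'(1) using E'(2) by (intro nn_integral_cong) (auto simp: indicator_def)
        finally show ?thesis .
      qed
      have "adams_integral \<alpha> (beta_crit \<alpha>) u = (\<integral>\<^sup>+x. ennreal ((exp (beta_crit \<alpha> * (u x)\<^sup>2) - 1) / norm x powr \<alpha>) \<partial>lborel)"
        unfolding adams_integral_def by (rule nn_integral_completion)
      also have "\<dots> = (\<integral>\<^sup>+x. ennreal ((exp (beta_crit \<alpha> * (v x)\<^sup>2) - 1) / norm x powr \<alpha>) \<partial>lborel)"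
      proof (rule nn_integral_cong_AE)
        show "AE x in lborel. ennreal ((exp (beta_crit \<alpha> * (u x)\<^sup>2) - 1) / norm x powr \<alpha>) = ennreal ((exp (beta_crit \<alpha> * (v x)\<^sup>2) - 1) / norm x powr \<alpha>)"
          using v(2) by eventually_elim simp
      qed
      also have "\<dots> \<le> ennreal K" by (rule K[OF _ _ energy lev]) auto
      finally show ?thesis .
    qed
    then show ?thesis by (rule that)
  qed
qed

lemma adams_integral_mono:
  assumes "\<beta> \<le> \<gamma>" shows "adams_integral \<alpha> \<beta> u \<le> adams_integral \<alpha> \<gamma> u"
  unfolding adams_integral_def
  using assms by (intro nn_integral_mono ennreal_leI divide_right_mono diff_right_mono) (auto intro!: mult_right_mono)

section \<open>Weak derivatives of test functions\<close>

text \<open>The fundamental lemma of the calculus of variations. Testing with bubbles gives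
  vanishing integrals against all continuous functions of compact support with values in [0, 1]; the
  level inequality with majorant 0 then makes each set where h > 1/(k + 1) null.\<close>

lemma loc_int_nonpos_if_test_integrals_zero:
  fixes h :: "real^4 \<Rightarrow> real"
  assumes h: "loc_int h" and z: "\<And>\<phi>. test_function \<phi> \<Longrightarrow> (\<integral>x. h x * \<phi> x \<partial>lborel) = 0"
  shows "AE x in lborel. h x \<le> 0"
proof -
  have [measurable]: "h \<in> borel_measurable borel" using h by (rule loc_int_measurable)
  have "tests_le h (\<lambda>x. 0)"
    unfolding tests_le_def
  proof (intro allI impI)
    fix \<psi> :: "real^4 \<Rightarrow> real" and R
    assume \<psi>: "continuous_on UNIV \<psi>" "\<forall>x. 0 \<le> \<psi> x \<and> \<psi> x \<le> 1" "\<forall>x. norm x > R \<longrightarrow> \<psi> x = 0"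
    let ?e = "\<lambda>n. (inverse (real (Suc n)))\<^sup>2"
    have "(\<lambda>n. \<integral>y. \<psi> y * (\<integral>x. h x * bubble (?e n) (x - y) \<partial>lborel) \<partial>lborel) \<longlonglongrightarrow> (\<integral>x. h x * \<psi> x \<partial>lborel)"
      by (rule integral_mollify_tendsto[OF h \<psi>(1), of 1 R]) (use \<psi> in auto)
    moreover have "(\<integral>x. h x * bubble (?e n) (x - y) \<partial>lborel) = 0" for n y
      by (rule z[OF test_function_bubble]) simp
    ultimately have "(\<lambda>n. 0) \<longlonglongrightarrow> (\<integral>x. h x * \<psi> x \<partial>lborel)" by simp
    then have "(\<integral>x. h x * \<psi> x \<partial>lborel) = 0" by (simp add: LIMSEQ_const_iff)
    then show "ennreal (\<integral>x. h x * \<psi> x \<partial>lborel) \<le> (\<integral>\<^sup>+x. ennreal (\<psi> x) * 0 \<partial>lborel)" by simp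
  qed
  have null: "emeasure lborel {x. inverse (real (Suc k)) < h x} = 0" for k
  proof -
    have m: "{x \<in> space borel. inverse (real (Suc k)) < h x} \<in> sets borel" by measurable
    have "ennreal (inverse (real (Suc k))) * emeasure lborel {x. inverse (real (Suc k)) < h x} \<le> (\<integral>\<^sup>+x. indicator {x. inverse (real (Suc k)) < h x} x * 0 \<partial>lborel)"
      using m by (intro level_from_tests[OF h _ _ \<open>tests_le h (\<lambda>x. 0)\<close>]) auto
    then show ?thesis by simp
  qed
  have "AE x in lborel. \<forall>k. h x \<le> inverse (real (Suc k))"
    unfolding AE_all_countable
  proof
    fix k
    have m: "{x \<in> space borel. inverse (real (Suc k)) < h x} \<in> sets borel" by measurable
    show "AE x in lborel. h x \<le> inverse (real (Suc k))"
      by (rule AE_I[OF _ null[of k]]) (use m in auto)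
  qed
  then show ?thesis
  proof eventually_elim
    case (elim x)
    show ?case
      by (rule LIMSEQ_le_const[OF LIMSEQ_inverse_real_of_nat]) (use elim in blast)
  qed
qed

text \<open>\<open>wderiv\<close> is an arbitrary choice, so its values become known only through
  uniqueness. The difference of two candidates is nonpositive almost everywhere in either
  order.\<close>

lemma has_weak_deriv_unique:
  fixes u :: "real^4 \<Rightarrow> real"
  assumes v: "has_weak_deriv js u v" and w: "has_weak_deriv js u w"
  shows "AE x in lborel. v x = w x"
proof -
  have lv: "locally_integrable v" and lw: "locally_integrable w"
    using v w by (auto simp: has_weak_deriv_def)
  obtain v' where v': "loc_int v'" "AE x in lborel. v x = v' x" by (rule locally_integrable_rep[OF lv])
  obtain w' where w': "loc_int w'" "AE x in lborel. w x = w' x" by (rule locally_integrable_rep[OF lw])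
  have eq: "(\<integral>x. v' x * \<phi> x \<partial>lborel) = (\<integral>x. w' x * \<phi> x \<partial>lborel)" if \<phi>: "test_function \<phi>" for \<phi>
  proof -
    have m: "\<phi> \<in> borel_measurable borel" by (rule test_function_measurable[OF \<phi>])
    have "(- 1) ^ length js * (LINT x|lebesgue. v x * \<phi> x) = (- 1) ^ length js * (LINT x|lebesgue. w x * \<phi> x)"
      using v[unfolded has_weak_deriv_def, THEN conjunct2, THEN conjunct2, rule_format, OF \<phi>]
        w[unfolded has_weak_deriv_def, THEN conjunct2, THEN conjunct2, rule_format, OF \<phi>] by (rule trans[OF sym])
    then have "(LINT x|lebesgue. v x * \<phi> x) = (LINT x|lebesgue. w x * \<phi> x)" by simp
    then show ?thesis
      unfolding integral_lebesgue_rep[OF lv v' m] integral_lebesgue_rep[OF lw w' m] .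
  qed
  have z: "(\<integral>x. (v' x - w' x) * \<phi> x \<partial>lborel) = 0" "(\<integral>x. (w' x - v' x) * \<phi> x \<partial>lborel) = 0" if \<phi>: "test_function \<phi>" for \<phi>
    unfolding left_diff_distrib
    using eq[OF \<phi>] loc_int_integrable_test[OF v'(1) \<phi>] loc_int_integrable_test[OF w'(1) \<phi>] by simp_all
  have "AE x in lborel. v' x - w' x \<le> 0" "AE x in lborel. w' x - v' x \<le> 0"
    by (rule loc_int_nonpos_if_test_integrals_zero[OF loc_int_diff[OF v'(1) w'(1)] z(1)]
        loc_int_nonpos_if_test_integrals_zero[OF loc_int_diff[OF w'(1) v'(1)] z(2)]; assumption)+
  then show ?thesis using v'(2) w'(2) by eventually_elim simp
qed

section \<open>Integration by parts for test functions\<close>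

lemma loc_int_one: "loc_int (\<lambda>x. 1 :: real)"
  unfolding loc_int_def
  by (auto intro!: integrable_real_indicator emeasure_compact_finite[unfolded infinity_ennreal_def])

lemma test_function_integrable: "test_function \<phi> \<Longrightarrow> integrable lborel \<phi>"
  using loc_int_integrable_test[OF loc_int_one] by fastforce

lemma test_function_mult:
  assumes "test_function u" "test_function \<phi>"
  shows "test_function (\<lambda>x. u x * \<phi> x)"
  unfolding test_function_def
proof
  show "smooth (\<lambda>x. u x * \<phi> x)" using assms by (simp add: test_function_def smooth_mult)
  have "closure {x. u x * \<phi> x \<noteq> 0} \<subseteq> closure {x. u x \<noteq> 0}" by (intro closure_mono) auto
  moreover have "compact (closure {x. u x \<noteq> 0} \<inter> closure {x. u x * \<phi> x \<noteq> 0})"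
    using assms by (intro compact_Int_closed) (auto simp: test_function_def)
  ultimately show "compact (closure {x. u x * \<phi> x \<noteq> 0})" by (simp add: Int_absorb1)
qed

text \<open>By translation invariance every difference quotient has integral 0. The mean value
  theorem bounds the quotients by a bound for the derivative, on a fixed ball, so dominated
  convergence applies and no iterated integral is involved.\<close>

lemma integral_pderiv_at_test:
  assumes \<phi>: "test_function \<phi>"
  shows "(\<integral>x. pderiv_at i \<phi> x \<partial>lborel) = 0"
proof -
  let ?a = "axis i 1 :: real^'a"
  have diff: "\<phi> differentiable (at x)" for x
    using \<phi> by (simp add: test_function_def smooth_imp_differentiable)
  have [measurable]: "\<phi> \<in> borel_measurable borel" "pderiv_at i \<phi> \<in> borel_measurable borel"
    using \<phi> by (auto intro: test_function_measurable test_function_pderiv_at)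
  have int: "integrable lborel \<phi>" by (rule test_function_integrable[OF \<phi>])
  obtain R0 B0 where R0: "\<And>x. \<bar>\<phi> x\<bar> \<le> B0" "\<And>x. norm x > R0 \<Longrightarrow> \<phi> x = 0"
    by (rule test_functionE[OF \<phi>]) (rule that)
  obtain R1 B where B: "\<And>x. \<bar>pderiv_at i \<phi> x\<bar> \<le> B" "\<And>x. norm x > R1 \<Longrightarrow> pderiv_at i \<phi> x = 0"
    by (rule test_functionE[OF test_function_pderiv_at[OF \<phi>]]) (rule that)
  have line: "((\<lambda>t. \<phi> (x + t *\<^sub>R ?a)) has_real_derivative pderiv_at i \<phi> (x + t *\<^sub>R ?a)) (at t)" for x t
  proof -
    have "((\<lambda>t. \<phi> (x + t *\<^sub>R ?a)) has_derivative (\<lambda>h. frechet_derivative \<phi> (at (x + t *\<^sub>R ?a)) (h *\<^sub>R ?a))) (at t)"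
      by (rule has_derivative_compose[OF _ differentiable_has_derivative[OF diff]])
         (auto intro!: derivative_eq_intros)
    moreover have "frechet_derivative \<phi> (at (x + t *\<^sub>R ?a)) (h *\<^sub>R ?a) = pderiv_at i \<phi> (x + t *\<^sub>R ?a) * h" for h
      using linear_cmul[OF linear_frechet_derivative[OF diff]] by (simp add: pderiv_at_def mult.commute)
    ultimately show ?thesis by (simp add: has_field_derivative_def)
  qed
  define e where "e n = inverse (real (Suc n))" for n
  have e: "0 < e n" "e n \<le> 1" for n by (auto simp: e_def divide_simps)
  have e0: "e \<longlonglongrightarrow> 0" unfolding e_def by (rule LIMSEQ_inverse_real_of_nat)
  define q where "q n x = (\<phi> (x + e n *\<^sub>R ?a) - \<phi> x) / e n" for n x
  have [measurable]: "q n \<in> borel_measurable borel" for n unfolding q_def by measurable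
  have int0: "(\<integral>x. q n x \<partial>lborel) = 0" for n
  proof -
    have s: "(\<integral>x. \<phi> (x + e n *\<^sub>R ?a) \<partial>lborel) = (\<integral>x. \<phi> x \<partial>lborel)"
      using integral_lborel_affine[of \<phi> 1 "e n *\<^sub>R ?a"] by (simp add: add.commute)
    have i: "integrable lborel (\<lambda>x. \<phi> (x + e n *\<^sub>R ?a))"
    proof (rule integrableI_bounded)
      have "(\<integral>\<^sup>+x. ennreal (norm (\<phi> (x + e n *\<^sub>R ?a))) \<partial>lborel) = (\<integral>\<^sup>+x. ennreal (norm (\<phi> x)) \<partial>lborel)"
        using nn_integral_lborel_shift[of "\<lambda>x. ennreal (norm (\<phi> x))" "- (e n *\<^sub>R ?a)"] by simp
      also have "\<dots> < \<infinity>" using int by (simp add: integrable_iff_bounded)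
      finally show "(\<integral>\<^sup>+x. ennreal (norm (\<phi> (x + e n *\<^sub>R ?a))) \<partial>lborel) < \<infinity>" .
    qed measurable
    show ?thesis unfolding q_def using s i int by simp
  qed
  have "(\<lambda>n. \<integral>x. q n x \<partial>lborel) \<longlonglongrightarrow> (\<integral>x. pderiv_at i \<phi> x \<partial>lborel)"
  proof (rule integral_dominated_convergence[where w="\<lambda>x::real^'a. B * indicator (cball 0 (R0 + 1)) x"])
    show "integrable lborel (\<lambda>x::real^'a. B * indicator (cball 0 (R0 + 1)) x)"
      using loc_int_one[where 'a="real^'a"] by (intro integrable_mult_right) (simp add: loc_int_def)
    show "AE x in lborel. (\<lambda>n. q n x) \<longlonglongrightarrow> pderiv_at i \<phi> x"
    proof (rule AE_I2)
      fix x
      have "((\<lambda>h. (\<phi> (x + (0 + h) *\<^sub>R ?a) - \<phi> (x + 0 *\<^sub>R ?a)) / h) \<longlongrightarrow> pderiv_at i \<phi> (x + 0 *\<^sub>R ?a)) (at 0)"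
        using line[of x 0] unfolding DERIV_def .
      then have "((\<lambda>h. (\<phi> (x + h *\<^sub>R ?a) - \<phi> x) / h) \<longlongrightarrow> pderiv_at i \<phi> x) (at 0)" by simp
      moreover have "filterlim e (at 0) sequentially"
        unfolding filterlim_at using e0 e(1) by (auto intro!: always_eventually simp: less_imp_neq[THEN not_sym])
      ultimately show "(\<lambda>n. q n x) \<longlonglongrightarrow> pderiv_at i \<phi> x"
        unfolding q_def by (rule filterlim_compose)
    qed
    show "AE x in lborel. norm (q n x) \<le> B * indicator (cball 0 (R0 + 1)) x" for n
    proof (rule AE_I2)
      fix x
      show "norm (q n x) \<le> B * indicator (cball 0 (R0 + 1)) x"
      proof (cases "norm x > R0 + 1")
        case True
        have "norm x \<le> norm (x + e n *\<^sub>R ?a) + norm (e n *\<^sub>R ?a)" using norm_triangle_ineq4[of "x + e n *\<^sub>R ?a" "e n *\<^sub>R ?a"] by simp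
        also have "norm (e n *\<^sub>R ?a) \<le> 1" using e[of n] by (simp add: norm_axis_1)
        finally have "norm (x + e n *\<^sub>R ?a) > R0" using True by simp
        then show ?thesis using True by (simp add: q_def R0)
      next
        case False
        obtain z where z: "0 < z" "z < e n" "\<phi> (x + e n *\<^sub>R ?a) - \<phi> (x + 0 *\<^sub>R ?a) = (e n - 0) * pderiv_at i \<phi> (x + z *\<^sub>R ?a)"
          using MVT2[OF e(1)[of n], of "\<lambda>t. \<phi> (x + t *\<^sub>R ?a)" "\<lambda>t. pderiv_at i \<phi> (x + t *\<^sub>R ?a)"] line by auto
        then have "q n x = pderiv_at i \<phi> (x + z *\<^sub>R ?a)" using e(1)[of n] by (simp add: q_def)
        then show ?thesis using False B(1) by simp
      qed
    qed
  qed measurable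
  then show ?thesis unfolding int0 by (simp add: LIMSEQ_const_iff)
qed

lemma integral_by_parts_test:
  assumes u: "test_function u" and \<phi>: "test_function \<phi>"
  shows "(\<integral>x. u x * pderiv_at i \<phi> x \<partial>lborel) = - (\<integral>x. pderiv_at i u x * \<phi> x \<partial>lborel)"
proof -
  have d: "u differentiable (at x)" "\<phi> differentiable (at x)" for x
    using u \<phi> by (auto simp: test_function_def smooth_imp_differentiable)
  have "0 = (\<integral>x. u x * pderiv_at i \<phi> x + pderiv_at i u x * \<phi> x \<partial>lborel)"
    using integral_pderiv_at_test[OF test_function_mult[OF u \<phi>], of i] by (simp add: pderiv_at_mult[OF d])
  also have "\<dots> = (\<integral>x. u x * pderiv_at i \<phi> x \<partial>lborel) + (\<integral>x. pderiv_at i u x * \<phi> x \<partial>lborel)"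
    by (intro Bochner_Integration.integral_add test_function_integrable test_function_mult test_function_pderiv_at u \<phi>)
  finally show ?thesis by simp
qed

text \<open>The reversal keeps the lemma independent of the symmetry of higher derivatives.\<close>

lemma integral_pderivs_test:
  assumes "test_function u" "test_function \<phi>"
  shows "(\<integral>x. u x * pderivs js \<phi> x \<partial>lborel) = (- 1) ^ length js * (\<integral>x. pderivs (rev js) u x * \<phi> x \<partial>lborel)"
  using assms(1)
proof (induction js arbitrary: u)
  case (Cons i js)
  show ?case
    using integral_by_parts_test[OF Cons.prems test_function_pderivs[OF assms(2)], of i js]
      Cons.IH[OF test_function_pderiv_at[OF Cons.prems], of i]
    by (simp add: pderivs_Cons pderivs_snoc)
qed simp

lemma test_function_lebesgue_measurable: "test_function \<phi> \<Longrightarrow> \<phi> \<in> borel_measurable lebesgue"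
  using test_function_measurable by (intro measurable_completion) simp

lemma test_function_locally_integrable:
  assumes "test_function \<phi>" shows "locally_integrable \<phi>"
  unfolding locally_integrable_def
proof (intro conjI allI impI)
  show "\<phi> \<in> borel_measurable lebesgue" by (rule test_function_lebesgue_measurable[OF assms])
  fix K :: "(real^'a) set" assume "compact K"
  then have K: "K \<in> sets lebesgue" by (simp add: compact_imp_closed)
  have "integrable lebesgue \<phi>"
    using test_function_integrable[OF assms] test_function_measurable[OF assms] by (subst integrable_completion) auto
  then show "set_integrable lebesgue K \<phi>" unfolding set_integrable_def by (rule integrable_mult_indicator[OF K])
qed

lemma has_weak_deriv_test:
  assumes u: "test_function u"
  shows "has_weak_deriv js u (pderivs (rev js) u)"
  unfolding has_weak_deriv_def
proof (intro conjI allI impI)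
  show "locally_integrable u" "locally_integrable (pderivs (rev js) u)"
    by (intro test_function_locally_integrable test_function_pderivs u)+
  fix \<phi> :: "real^'a \<Rightarrow> real" assume \<phi>: "test_function \<phi>"
  have m: "(\<lambda>x. f x * g x) \<in> borel_measurable lborel" if "test_function f" "test_function g" for f g :: "real^'a \<Rightarrow> real"
    using test_function_measurable[OF test_function_mult[OF that]] by simp
  show "(LINT x|lebesgue. u x * pderivs js \<phi> x) = (- 1) ^ length js * (LINT x|lebesgue. pderivs (rev js) u x * \<phi> x)"
    using integral_pderivs_test[OF u \<phi>]
    unfolding integral_completion[OF m[OF u test_function_pderivs[OF \<phi>]]]
      integral_completion[OF m[OF test_function_pderivs[OF u] \<phi>]] .
qed

lemma test_function_Lp_2:
  assumes "test_function \<phi>" shows "Lp_fun 2 \<phi>"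
proof -
  have "integrable lborel (\<lambda>x. \<phi> x * \<phi> x)" by (intro test_function_integrable test_function_mult assms)
  moreover have "(\<lambda>x. \<phi> x * \<phi> x) \<in> borel_measurable lborel"
    using test_function_measurable[OF test_function_mult[OF assms assms]] by simp
  ultimately have "integrable lebesgue (\<lambda>x. \<phi> x * \<phi> x)" by (simp add: integrable_completion)
  moreover have "\<bar>\<phi> x\<bar> powr 2 = \<phi> x * \<phi> x" for x by (simp add: power2_eq_square)
  ultimately show ?thesis unfolding Lp_fun_def using test_function_lebesgue_measurable[OF assms] by simp
qed

lemma test_function_sobolev: "test_function u \<Longrightarrow> u \<in> sobolev k 2"
  unfolding sobolev_def
  using has_weak_deriv_test test_function_pderivs test_function_Lp_2 by blast

text \<open>Uniqueness replaces the chosen weak derivatives by classical ones. The lists [i] and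
  [i, i] are palindromes, so the reversal in \<open>has_weak_deriv_test\<close> does not
  show.\<close>

lemma adams_energy_test:
  fixes u :: "real^4 \<Rightarrow> real"
  assumes u: "test_function u"
  shows "adams_energy \<tau> \<sigma> u = (\<integral>\<^sup>+x. ennreal ((\<Sum>i\<in>UNIV. pderivs [i, i] u x)\<^sup>2
     + \<tau> * (norm (\<chi> i. pderivs [i] u x))\<^sup>2 + \<sigma> * (u x)\<^sup>2) \<partial>lborel)"
proof -
  have ae: "AE x in lborel. wderiv js u x = pderivs (rev js) u x" for js
    by (rule has_weak_deriv_unique[OF has_weak_deriv_wderiv[OF test_function_sobolev[OF u, of "length js"]] has_weak_deriv_test[OF u]]) simp
  have "AE x in lborel. \<forall>i\<in>UNIV. wderiv [i, i] u x = pderivs [i, i] u x"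
    using ae[of "[i, i]" for i] by (intro AE_finite_allI) (simp_all only: rev.simps append.simps finite)
  moreover have "AE x in lborel. \<forall>i\<in>UNIV. wderiv [i] u x = pderivs [i] u x"
    using ae[of "[i]" for i] by (intro AE_finite_allI) (simp_all only: rev.simps append.simps finite)
  ultimately have "AE x in lborel. ennreal (\<bar>weak_laplacian u x\<bar>\<^sup>2 + \<tau> * (norm (weak_grad u x))\<^sup>2 + \<sigma> * \<bar>u x\<bar>\<^sup>2)
     = ennreal ((\<Sum>i\<in>UNIV. pderivs [i, i] u x)\<^sup>2 + \<tau> * (norm (\<chi> i. pderivs [i] u x))\<^sup>2 + \<sigma> * (u x)\<^sup>2)"
    by eventually_elim (simp add: weak_laplacian_def weak_grad_def)
  then show ?thesis unfolding adams_energy_def nn_integral_completion by (rule nn_integral_cong_AE)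
qed

section \<open>Concentrating functions\<close>

text \<open>A smoothing of 2c log(1/|x|), a multiple of the Green function of the squared Laplacian,
  levelled off near the height c log(1/d) at the scale |x|^2 = d.\<close>

definition log_bump :: "real \<Rightarrow> real \<Rightarrow> real^4 \<Rightarrow> real" where
  "log_bump c d x = cutoff ((norm x)\<^sup>2) * (- c * ln ((norm x)\<^sup>2 + d))"

lemma test_function_log_bump:
  assumes "d > 0" shows "test_function (log_bump c d)"
proof -
  have "smooth (\<lambda>x::real^4. - c * ln ((norm (x - 0))\<^sup>2 + d))"
    using assms by (intro smooth_mult smooth_const smooth_ln smooth_add smooth_norm_diff_sq add_nonneg_pos) auto
  from test_function_cutoff[where g="\<lambda>s. - c * ln (s + d)", OF this]
  show ?thesis unfolding log_bump_def[abs_def] by simp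
qed

text \<open>Applied with q = s + d: the factor s of the radial density absorbs the logarithm
  uniformly in d. For the square, ln p <= p with p = 1/sqrt q gives (ln q)^2 <= 4/q.\<close>

lemma ln_bounds_near_zero:
  fixes s q :: real
  assumes "0 < s" "s \<le> q" "s \<le> 1" "q \<le> 2"
  shows "s * \<bar>ln q\<bar> \<le> 1" "s * (ln q)\<^sup>2 \<le> 4"
proof -
  have q: "q > 0" using assms by simp
  have sq: "s / q \<le> 1" using assms by simp
  show "s * \<bar>ln q\<bar> \<le> 1"
  proof (cases "q < 1")
    case True
    have "ln (1 / q) \<le> 1 / q - 1" using q by (intro ln_le_minus_one) auto
    then have "\<bar>ln q\<bar> \<le> 1 / q" using True q by (simp add: ln_div)
    then have "s * \<bar>ln q\<bar> \<le> s * (1 / q)" using assms by (intro mult_left_mono) auto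
    then show ?thesis using sq by simp
  next
    case False
    then have "\<bar>ln q\<bar> \<le> 1" using ln_le_minus_one[OF q] assms by simp
    then have "s * \<bar>ln q\<bar> \<le> 1 * 1" using assms by (intro mult_mono) auto
    then show ?thesis by simp
  qed
  show "s * (ln q)\<^sup>2 \<le> 4"
  proof (cases "q < 1")
    case True
    define p where "p = 1 / sqrt q"
    have p: "p > 0" using q by (simp add: p_def)
    have "ln p \<le> p" using ln_le_minus_one[OF p] by simp
    moreover have "ln q = - 2 * ln p" using q by (simp add: p_def ln_div ln_sqrt)
    moreover have "p \<ge> 1" using True q by (simp add: p_def real_sqrt_le_1_iff)
    ultimately have "\<bar>ln q\<bar> \<le> 2 * p" by simp
    then have "(ln q)\<^sup>2 \<le> (2 * p)\<^sup>2" by (metis abs_ge_zero power2_abs power_mono)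
    also have "\<dots> = 4 / q" using q by (simp add: p_def power_divide)
    finally have "s * (ln q)\<^sup>2 \<le> s * (4 / q)" using assms by (intro mult_left_mono) auto
    also have "\<dots> \<le> 4" using assms q by (simp add: field_simps)
    finally show ?thesis .
  next
    case False
    then have "\<bar>ln q\<bar> \<le> 1" using ln_le_minus_one[OF q] assms by simp
    then have "(ln q)\<^sup>2 \<le> 1" by (simp add: abs_square_le_1)
    then have "s * (ln q)\<^sup>2 \<le> 1 * 1" using assms by (intro mult_mono) auto
    then show ?thesis by simp
  qed
qed

text \<open>A small \<kappa> keeps the coefficient of the leading square near 1; the remainder bears
  the cost.\<close>

lemma square_add_le:
  fixes a b \<kappa> :: real
  assumes "\<kappa> > 0"
  shows "(a + b)\<^sup>2 \<le> (1 + \<kappa>) * a\<^sup>2 + (1 + 1 / \<kappa>) * b\<^sup>2"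
proof -
  have "0 \<le> (\<kappa> * a - b)\<^sup>2 / \<kappa>" using assms by simp
  also have "\<dots> = \<kappa> * a\<^sup>2 - 2 * (a * b) + b\<^sup>2 / \<kappa>"
    using assms by (simp add: field_simps power2_eq_square)
  finally show ?thesis by (simp add: power2_sum algebra_simps)
qed

text \<open>The Laplacian of log(1/(|x|^2 + d)) is close to -4/(|x|^2 + d). Its square against the
  radial density pi^2 s integrates to 16 pi^2 log(1/d) up to a constant, while the contributions of
  the cutoff, the gradient and the function itself stay bounded as d tends to 0. Separating them
  from the leading term costs the factor 1 + \<kappa>.\<close>

lemma log_bump_energy:
  assumes \<tau>: "\<tau> > 0" and \<sigma>: "\<sigma> > 0" and \<kappa>: "\<kappa> > 0"
  obtains K where "K > 0" "\<And>c d. 0 < d \<Longrightarrow> d < 1 \<Longrightarrow>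
    adams_energy \<tau> \<sigma> (log_bump c d) \<le> ennreal (c\<^sup>2 * ((1 + \<kappa>) * 16 * pi\<^sup>2 * ln (1 / d) + K))"
proof -
  obtain C0 where C0: "C0 > 0" "\<And>s. s \<ge> 0 \<Longrightarrow> \<bar>cutoff1 s\<bar> \<le> C0 * s" "\<And>s. s \<ge> 0 \<Longrightarrow> \<bar>cutoff2 s\<bar> \<le> C0"
    using cutoff_derivative_bounds by blast
  define K0 where "K0 = (1 + 1 / \<kappa>) * (32 + 800 * C0\<^sup>2) + 4 * \<tau> * (C0 + 1)\<^sup>2 + 4 * \<sigma>"
  have K0: "K0 > 0" unfolding K0_def using \<tau> \<sigma> \<kappa> by (intro add_nonneg_pos add_nonneg_nonneg mult_nonneg_nonneg) auto
  define K where "K = (1 + \<kappa>) * 16 * pi\<^sup>2 * ln 2 + pi\<^sup>2 * K0 * (3 / 2)"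
  have K: "K > 0" unfolding K_def using \<kappa> K0 by (intro add_nonneg_pos mult_pos_pos) auto
  have "adams_energy \<tau> \<sigma> (log_bump c d) \<le> ennreal (c\<^sup>2 * ((1 + \<kappa>) * 16 * pi\<^sup>2 * ln (1 / d) + K))"
    if d: "0 < d" "d < 1" for c d
  proof -
    \<comment> \<open>For c = 1, \<open>A\<close>, \<open>D\<close> and \<open>V\<close> are the
      Laplacian, the derivative in s and the value of the function.\<close>
    define A where "A s = cutoff s * (4 * s / (s + d)\<^sup>2 - 8 / (s + d)) - 8 * s * cutoff1 s / (s + d)
      - ln (s + d) * (4 * s * cutoff2 s + 8 * cutoff1 s)" for s
    define D where "D s = - cutoff1 s * ln (s + d) - cutoff s / (s + d)" for s
    define V where "V s = - cutoff s * ln (s + d)" for s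
    define W where "W s = (A s)\<^sup>2 + \<tau> * (4 * s * (D s)\<^sup>2) + \<sigma> * (V s)\<^sup>2" for s
    have G: "((\<lambda>s. - c * ln (s + d)) has_real_derivative - c / (s + d)) (at s)" if "s \<ge> 0" for s
      using that d by (auto intro!: derivative_eq_intros)
    have G1: "((\<lambda>s. - c / (s + d)) has_real_derivative c / (s + d)\<^sup>2) (at s)" if "s \<ge> 0" for s
      using that d by (auto intro!: derivative_eq_intros simp: power2_eq_square)
    have F: "((\<lambda>s. cutoff s * (- c * ln (s + d))) has_real_derivative c * D s) (at s)" if "s \<ge> 0" for s
    proof -
      have "cutoff1 s * (- c * ln (s + d)) + - c / (s + d) * cutoff s = c * D s" by (simp add: D_def right_diff_distrib)
      then show ?thesis using DERIV_mult[OF cutoff_has_derivative G[OF that]] by (simp only:)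
    qed
    have L: "(\<Sum>i\<in>UNIV. pderivs [i, i] (log_bump c d) x) = c * A ((norm x)\<^sup>2)" for x
      using laplacian_cutoff[of "\<lambda>s. - c * ln (s + d)" "\<lambda>s. - c / (s + d)" "\<lambda>s. c / (s + d)\<^sup>2" "(norm x)\<^sup>2" x 0, OF G G1]
      unfolding log_bump_def[abs_def] A_def by (simp add: algebra_simps)
    have N: "(norm (\<chi> i. pderivs [i] (log_bump c d) x))\<^sup>2 = c\<^sup>2 * (4 * (norm x)\<^sup>2 * (D ((norm x)\<^sup>2))\<^sup>2)" for x
      using norm_gradient_radial[of "\<lambda>s. cutoff s * (- c * ln (s + d))" "\<lambda>s. c * D s" 0 x, OF F]
      unfolding log_bump_def[abs_def] by (simp add: power_mult_distrib)
    have [measurable]: "cutoff1 \<in> borel_measurable borel" "cutoff2 \<in> borel_measurable borel"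
    proof -
      have [measurable]: "flat_exp n \<in> borel_measurable borel" for n
        using flat_exp_has_derivative by (intro borel_measurable_continuous_onI) (meson DERIV_isCont continuous_at_imp_continuous_on)
      show "cutoff1 \<in> borel_measurable borel" "cutoff2 \<in> borel_measurable borel"
        unfolding cutoff1_def[abs_def] cutoff2_def[abs_def] by measurable
    qed
    have [measurable]: "W \<in> borel_measurable borel"
      unfolding W_def[abs_def] A_def D_def V_def by measurable
    have W0: "W s \<ge> 0" if "s \<ge> 0" for s unfolding W_def using that \<tau> \<sigma> by simp
    \<comment> \<open>A majorant of the radial energy density with an explicit primitive. The part
      d^2/(s + d)^3, of bounded integral, stems from the square of the deviation 4d/(s + d)^2 of the
      Laplacian from its leading term.\<close>
    define B where "B s = (1 + \<kappa>) * 16 * pi\<^sup>2 * (1 / (s + d)) + pi\<^sup>2 * K0 * (1 + d\<^sup>2 / (s + d) ^ 3)" for s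
    have bound: "pi\<^sup>2 * s * W s \<le> B s" if s: "0 < s" "s < 1" for s
    proof -
      define q where "q = s + d"
      have q: "q > 0" "s \<le> q" "q \<le> 2" "d \<le> q" using s d by (auto simp: q_def)
      have sq: "s / q \<le> 1" using q by simp
      have ln1: "s * \<bar>ln q\<bar> \<le> 1" and ln2: "s * (ln q)\<^sup>2 \<le> 4"
        using ln_bounds_near_zero[of s q] s q by auto
      have c1: "\<bar>cutoff1 s\<bar> \<le> C0 * s" and c2: "\<bar>cutoff2 s\<bar> \<le> C0" using C0 s by auto
      have m1: "\<bar>cutoff s * (4 * s / q\<^sup>2 - 8 / q)\<bar> \<le> 4 / q + 4 * d / q\<^sup>2"
      proof -
        \<comment> \<open>Substituting s = q - d exhibits the leading term -4/q and a deviation that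
          matters only for s of order d.\<close>
        have "4 * s / q\<^sup>2 - 8 / q = - (4 / q + 4 * d / q\<^sup>2)"
        proof -
          have "4 * s = 4 * q - 4 * d" by (simp add: q_def)
          then have "4 * s / q\<^sup>2 = 4 / q - 4 * d / q\<^sup>2"
            using q(1) by (simp only: diff_divide_distrib) (simp add: power2_eq_square)
          then show ?thesis by simp
        qed
        then have "\<bar>cutoff s * (4 * s / q\<^sup>2 - 8 / q)\<bar> = cutoff s * (4 / q + 4 * d / q\<^sup>2)"
          using q(1) d by (simp only: abs_mult abs_minus_cancel) (simp add: add_nonneg_nonneg)
        also have "\<dots> \<le> 1 * (4 / q + 4 * d / q\<^sup>2)"
          using cutoff_le_1[of s] q d by (intro mult_right_mono) auto
        finally show ?thesis by simp
      qed
      have m2: "\<bar>8 * s * cutoff1 s / q\<bar> \<le> 8 * C0"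
      proof -
        have "\<bar>8 * s * cutoff1 s / q\<bar> = 8 * ((s / q) * \<bar>cutoff1 s\<bar>)" using s q by (simp add: abs_mult)
        also have "\<dots> \<le> 8 * (1 * (C0 * 1))"
          using sq c1 s q C0(1) by (intro mult_left_mono mult_mono) (auto intro: order_trans[OF c1] mult_left_le)
        finally show ?thesis by simp
      qed
      have m3: "\<bar>ln q * (4 * s * cutoff2 s + 8 * cutoff1 s)\<bar> \<le> 12 * C0"
      proof -
        have "\<bar>4 * s * cutoff2 s + 8 * cutoff1 s\<bar> \<le> 4 * s * \<bar>cutoff2 s\<bar> + 8 * \<bar>cutoff1 s\<bar>"
          using s by (intro order_trans[OF abs_triangle_ineq]) (simp add: abs_mult)
        also have "\<dots> \<le> 4 * s * C0 + 8 * (C0 * s)" using c1 c2 s by (intro add_mono mult_left_mono) auto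
        finally have "\<bar>ln q\<bar> * \<bar>4 * s * cutoff2 s + 8 * cutoff1 s\<bar> \<le> \<bar>ln q\<bar> * (12 * C0 * s)"
          by (intro mult_left_mono) auto
        also have "\<dots> = 12 * C0 * (s * \<bar>ln q\<bar>)" by simp
        also have "\<dots> \<le> 12 * C0 * 1" using ln1 C0(1) by (intro mult_left_mono) auto
        finally show ?thesis by (simp add: abs_mult)
      qed
      have "\<bar>A s\<bar> \<le> 4 / q + (4 * d / q\<^sup>2 + 20 * C0)"
      proof -
        have "\<bar>a - b - e\<bar> \<le> x + y + z" if "\<bar>a\<bar> \<le> x" "\<bar>b\<bar> \<le> y" "\<bar>e\<bar> \<le> z" for a b e x y z :: real
          using that by linarith
        from this[OF m1 m2 m3] show ?thesis unfolding A_def q_def[symmetric] by simp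
      qed
      then have "(A s)\<^sup>2 \<le> (4 / q + (4 * d / q\<^sup>2 + 20 * C0))\<^sup>2" by (metis abs_ge_zero power2_abs power_mono)
      also have "\<dots> \<le> (1 + \<kappa>) * (4 / q)\<^sup>2 + (1 + 1 / \<kappa>) * (4 * d / q\<^sup>2 + 20 * C0)\<^sup>2" by (rule square_add_le[OF \<kappa>])
      also have "\<dots> \<le> (1 + \<kappa>) * (4 / q)\<^sup>2 + (1 + 1 / \<kappa>) * (2 * (4 * d / q\<^sup>2)\<^sup>2 + 2 * (20 * C0)\<^sup>2)"
        using \<kappa> square_add_le[of 1 "4 * d / q\<^sup>2" "20 * C0"] by (intro add_left_mono mult_left_mono) auto
      finally have "(A s)\<^sup>2 \<le> (1 + \<kappa>) * (4 / q)\<^sup>2 + (1 + 1 / \<kappa>) * (2 * (4 * d / q\<^sup>2)\<^sup>2 + 2 * (20 * C0)\<^sup>2)" .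
      then have "s * (A s)\<^sup>2 \<le> s * ((1 + \<kappa>) * (4 / q)\<^sup>2 + (1 + 1 / \<kappa>) * (2 * (4 * d / q\<^sup>2)\<^sup>2 + 2 * (20 * C0)\<^sup>2))"
        using s by (intro mult_left_mono) auto
      also have "\<dots> = (1 + \<kappa>) * (16 * (s / q) * (1 / q)) + (1 + 1 / \<kappa>) * (32 * (s / q) * (d\<^sup>2 / q ^ 3) + s * (800 * C0\<^sup>2))"
        using q(1) by (simp add: power_divide power_mult_distrib power2_eq_square power3_eq_cube distrib_left mult_ac)
      also have "\<dots> \<le> (1 + \<kappa>) * (16 * 1 * (1 / q)) + (1 + 1 / \<kappa>) * (32 * 1 * (d\<^sup>2 / q ^ 3) + 1 * (800 * C0\<^sup>2))"
        using sq s q \<kappa> by (intro add_mono mult_left_mono mult_right_mono) auto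
      finally have a: "s * (A s)\<^sup>2 \<le> (1 + \<kappa>) * (16 * (1 / q)) + (1 + 1 / \<kappa>) * (32 * (d\<^sup>2 / q ^ 3) + 800 * C0\<^sup>2)" by simp
      have "s * \<bar>D s\<bar> \<le> C0 + 1"
      proof -
        have "\<bar>D s\<bar> \<le> \<bar>cutoff1 s\<bar> * \<bar>ln q\<bar> + cutoff s / q"
          unfolding D_def q_def[symmetric] using q by (simp add: abs_mult[symmetric] order_trans[OF abs_triangle_ineq4])
        then have "s * \<bar>D s\<bar> \<le> s * (\<bar>cutoff1 s\<bar> * \<bar>ln q\<bar> + cutoff s / q)" using s by (intro mult_left_mono) auto
        also have "\<dots> = \<bar>cutoff1 s\<bar> * (s * \<bar>ln q\<bar>) + cutoff s * (s / q)" by (simp add: distrib_left)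
        also have "\<dots> \<le> C0 * 1 + 1 * 1"
          using sq s q ln1 cutoff_le_1[of s] C0(1) c1 by (intro add_mono mult_mono) (auto intro: order_trans[OF c1])
        finally show ?thesis by simp
      qed
      then have "(s * \<bar>D s\<bar>)\<^sup>2 \<le> (C0 + 1)\<^sup>2" using s by (intro power_mono) auto
      then have "s\<^sup>2 * (D s)\<^sup>2 \<le> (C0 + 1)\<^sup>2" by (simp only: power_mult_distrib power2_abs)
      moreover have "s * (4 * s * (D s)\<^sup>2) = 4 * (s\<^sup>2 * (D s)\<^sup>2)" by (simp add: power2_eq_square)
      ultimately have "s * (4 * s * (D s)\<^sup>2) \<le> 4 * (C0 + 1)\<^sup>2" by linarith
      then have b: "\<tau> * (s * (4 * s * (D s)\<^sup>2)) \<le> \<tau> * (4 * (C0 + 1)\<^sup>2)" using \<tau> by (intro mult_left_mono) auto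
      have "s * (V s)\<^sup>2 \<le> 4"
      proof -
        have "s * (V s)\<^sup>2 = (cutoff s)\<^sup>2 * (s * (ln q)\<^sup>2)" unfolding V_def q_def[symmetric] by (simp add: power_mult_distrib)
        also have "\<dots> \<le> 1 * 4" using ln2 s cutoff_le_1[of s] by (intro mult_mono) (auto simp: power_le_one)
        finally show ?thesis by simp
      qed
      then have v: "\<sigma> * (s * (V s)\<^sup>2) \<le> \<sigma> * 4" using \<sigma> by (intro mult_left_mono) auto
      have z: "0 \<le> d\<^sup>2 / q ^ 3" using q by simp
      have k: "0 \<le> 1 + 1 / \<kappa>" using \<kappa> by simp
      have "s * W s = s * (A s)\<^sup>2 + \<tau> * (s * (4 * s * (D s)\<^sup>2)) + \<sigma> * (s * (V s)\<^sup>2)"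
        unfolding W_def by (simp add: algebra_simps)
      also have "\<dots> \<le> (1 + \<kappa>) * (16 * (1 / q)) + (1 + 1 / \<kappa>) * (32 * (d\<^sup>2 / q ^ 3) + 800 * C0\<^sup>2) + \<tau> * (4 * (C0 + 1)\<^sup>2) + \<sigma> * 4"
        using a b v by linarith
      also have "\<dots> \<le> (1 + \<kappa>) * 16 * (1 / q) + K0 * (1 + d\<^sup>2 / q ^ 3)"
      proof -
        let ?z = "d\<^sup>2 / q ^ 3" and ?k = "1 + 1 / \<kappa>"
        have "?k * 32 * ?z \<le> K0 * ?z"
          unfolding K0_def using z k \<tau> \<sigma> by (intro mult_right_mono) (auto simp: distrib_left intro!: add_nonneg_nonneg mult_nonneg_nonneg)
        moreover have "?k * (800 * C0\<^sup>2) + \<tau> * (4 * (C0 + 1)\<^sup>2) + \<sigma> * 4 \<le> K0"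
          unfolding K0_def using k by (simp add: distrib_left)
        moreover have "?k * (32 * ?z + 800 * C0\<^sup>2) = ?k * 32 * ?z + ?k * (800 * C0\<^sup>2)" by (simp only: distrib_left mult.assoc)
        moreover have "K0 * (1 + ?z) = K0 + K0 * ?z" by (simp only: distrib_left mult_1_right)
        moreover have "(1 + \<kappa>) * (16 * (1 / q)) = (1 + \<kappa>) * 16 * (1 / q)" by simp
        ultimately show ?thesis by linarith
      qed
      finally have "pi\<^sup>2 * (s * W s) \<le> pi\<^sup>2 * ((1 + \<kappa>) * 16 * (1 / q) + K0 * (1 + d\<^sup>2 / q ^ 3))"
        by (intro mult_left_mono) auto
      also have "\<dots> = B s" unfolding B_def q_def[symmetric] by (simp only: distrib_left mult_ac)
      finally show ?thesis by (simp only: mult.assoc)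
    qed
    define P where "P s = (1 + \<kappa>) * 16 * pi\<^sup>2 * ln (s + d) + pi\<^sup>2 * K0 * (s - d\<^sup>2 / 2 * inverse (s + d) ^ 2)" for s
    have B: "(B has_integral P 1 - P 0) {0..1}"
    proof (rule fundamental_theorem_of_calculus)
      fix s :: real assume s: "s \<in> {0..1}"
      have i: "((\<lambda>s. inverse (s + d)) has_real_derivative - (inverse (s + d) ^ 2)) (at s)"
        using s d by (auto intro!: derivative_eq_intros simp: power2_eq_square divide_simps)
      have l: "((\<lambda>s. ln (s + d)) has_real_derivative 1 / (s + d)) (at s)"
        using s d by (auto intro!: derivative_eq_intros)
      have i2: "((\<lambda>s. inverse (s + d) ^ 2) has_real_derivative - 2 / (s + d) ^ 3) (at s)"
        using DERIV_power[OF i, of 2] by (simp add: power2_eq_square power3_eq_cube inverse_eq_divide)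
      have "(P has_real_derivative (1 + \<kappa>) * 16 * pi\<^sup>2 * (1 / (s + d)) + pi\<^sup>2 * K0 * (1 - d\<^sup>2 / 2 * (- 2 / (s + d) ^ 3))) (at s)"
        unfolding P_def[abs_def]
        by (intro DERIV_add DERIV_cmult DERIV_diff DERIV_ident l i2)
      then have "(P has_real_derivative B s) (at s)" unfolding B_def by simp
      then show "(P has_vector_derivative B s) (at s within {0..1})"
        by (simp add: has_real_derivative_iff_has_vector_derivative[symmetric] has_field_derivative_at_within)
    qed simp
    have B0: "B s \<ge> 0" if "s \<ge> 0" for s
      unfolding B_def using that d K0 \<kappa> by (intro add_nonneg_nonneg mult_nonneg_nonneg) auto
    \<comment> \<open>The constants of \<open>K\<close>: ln(1 + d) <= ln 2, and the bounded part of
      the primitive grows by at most 1 + 1/2, the half coming from its value at s = 0.\<close>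
    have PP: "P 1 - P 0 \<le> (1 + \<kappa>) * 16 * pi\<^sup>2 * ln (1 / d) + K"
    proof -
      have "ln (1 + d) \<le> ln 2" using d by simp
      then have l: "(1 + \<kappa>) * 16 * pi\<^sup>2 * ln (1 + d) \<le> (1 + \<kappa>) * 16 * pi\<^sup>2 * ln 2" using \<kappa> by (intro mult_left_mono) auto
      have dd: "d\<^sup>2 / 2 * inverse (0 + d) ^ 2 = 1 / 2" using d by (simp add: power_inverse[symmetric] field_simps)
      have "0 \<le> d\<^sup>2 / 2 * inverse (1 + d) ^ 2" by simp
      then have "1 - d\<^sup>2 / 2 * inverse (1 + d) ^ 2 - (0 - 1 / 2) \<le> 3 / 2" by linarith
      then have m: "pi\<^sup>2 * K0 * (1 - d\<^sup>2 / 2 * inverse (1 + d) ^ 2 - (0 - 1 / 2)) \<le> pi\<^sup>2 * K0 * (3 / 2)"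
        using K0 by (intro mult_left_mono) auto
      have "P 1 - P 0 = (1 + \<kappa>) * 16 * pi\<^sup>2 * ln (1 + d) + (1 + \<kappa>) * 16 * pi\<^sup>2 * ln (1 / d) + pi\<^sup>2 * K0 * (1 - d\<^sup>2 / 2 * inverse (1 + d) ^ 2 - (0 - 1 / 2))"
        unfolding P_def dd using d by (simp add: ln_div algebra_simps)
      then show ?thesis unfolding K_def using l m by linarith
    qed
    have "adams_energy \<tau> \<sigma> (log_bump c d) = (\<integral>\<^sup>+x. ennreal (c\<^sup>2 * W ((norm (x::real^4))\<^sup>2)) \<partial>lborel)"
      unfolding adams_energy_test[OF test_function_log_bump[OF d(1)]] L N
      by (intro nn_integral_cong) (simp add: W_def V_def log_bump_def power_mult_distrib algebra_simps)
    also have "\<dots> = (\<integral>\<^sup>+s. ennreal (pi\<^sup>2 * s) * ennreal (c\<^sup>2 * W s) \<partial>lborel)"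
      by (rule nn_integral_radial[of "\<lambda>s. ennreal (c\<^sup>2 * W s)"]) measurable
    also have "\<dots> \<le> (\<integral>\<^sup>+s. ennreal (c\<^sup>2) * (ennreal (B s) * indicator {0..1} s) \<partial>lborel)"
    proof (rule nn_integral_mono)
      fix s :: real
      consider "s \<le> 0" | "s \<ge> 1" | "0 < s" "s < 1" by linarith
      then show "ennreal (pi\<^sup>2 * s) * ennreal (c\<^sup>2 * W s) \<le> ennreal (c\<^sup>2) * (ennreal (B s) * indicator {0..1} s)"
      proof cases
        case 1
        then have "ennreal (pi\<^sup>2 * s) = 0" by (simp add: ennreal_neg mult_nonneg_nonpos)
        then show ?thesis by simp
      next
        case 2
        then have "W s = 0" by (simp add: W_def A_def D_def V_def cutoff_eq_0 cutoff1_eq_0 cutoff2_eq_0)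
        then show ?thesis by simp
      next
        case 3
        have "ennreal (pi\<^sup>2 * s) * ennreal (c\<^sup>2 * W s) = ennreal (c\<^sup>2 * (pi\<^sup>2 * s * W s))"
          using 3 W0[of s] by (subst ennreal_mult[symmetric]) (auto simp: mult_ac)
        also have "\<dots> \<le> ennreal (c\<^sup>2 * B s)" using bound[OF 3] by (intro ennreal_leI mult_left_mono) auto
        also have "\<dots> = ennreal (c\<^sup>2) * (ennreal (B s) * indicator {0..1} s)"
          using 3 B0[of s] by (simp add: ennreal_mult)
        finally show ?thesis .
      qed
    qed
    also have "\<dots> = ennreal (c\<^sup>2) * (\<integral>\<^sup>+s. ennreal (B s) * indicator {0..1} s \<partial>lborel)"
      by (rule nn_integral_cmult) (unfold B_def, measurable)
    also have "(\<integral>\<^sup>+s. ennreal (B s) * indicator {0..1} s \<partial>lborel) = ennreal (P 1 - P 0)"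
      by (rule nn_integral_has_integral_lebesgue'[OF _ B]) (use B0 in auto)
    also have "ennreal (c\<^sup>2) * ennreal (P 1 - P 0) \<le> ennreal (c\<^sup>2) * ennreal ((1 + \<kappa>) * 16 * pi\<^sup>2 * ln (1 / d) + K)"
      by (intro mult_left_mono ennreal_leI PP) auto
    also have "\<dots> = ennreal (c\<^sup>2 * ((1 + \<kappa>) * 16 * pi\<^sup>2 * ln (1 / d) + K))"
      using d K \<kappa> by (intro ennreal_mult[symmetric] add_nonneg_nonneg mult_nonneg_nonneg) auto
    finally show ?thesis .
  qed
  with K that show ?thesis by blast
qed

text \<open>Only the ball |x|^2 < d is kept. There the logarithm is at least ln(1/(2d)), the weight
  is at least d^(-\<alpha>/2), and the volume pi^2 d^2 / 2 completes the power d^(2 -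
  \<alpha>/2).\<close>

lemma adams_integral_log_bump_ge:
  assumes \<alpha>: "0 \<le> \<alpha>" and d: "0 < d" "d < 1 / 2" and \<beta>: "\<beta> \<ge> 0" and r: "0 \<le> r" "\<And>s. 0 \<le> s \<Longrightarrow> s \<le> d \<Longrightarrow> r \<le> cutoff s"
  shows "ennreal ((exp (\<beta> * (c\<^sup>2 * r\<^sup>2 * (ln (1 / d) - ln 2)\<^sup>2)) - 1) * (pi\<^sup>2 / 2 * d powr (2 - \<alpha> / 2))) \<le> adams_integral \<alpha> \<beta> (log_bump c d)"
proof -
  define Y where "Y = (exp (\<beta> * (c\<^sup>2 * r\<^sup>2 * (ln (1 / d) - ln 2)\<^sup>2)) - 1) / d powr (\<alpha> / 2)"
  have Y0: "Y \<ge> 0" unfolding Y_def using \<beta> by (intro divide_nonneg_nonneg) auto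
  have "ennreal Y * emeasure lborel (ball 0 (sqrt d) :: (real^4) set) = (\<integral>\<^sup>+x. ennreal Y * indicator (ball (0::real^4) (sqrt d)) x \<partial>lborel)"
    by (simp add: nn_integral_cmult_indicator)
  also have "\<dots> \<le> (\<integral>\<^sup>+x. ennreal ((exp (\<beta> * (log_bump c d x)\<^sup>2) - 1) / norm x powr \<alpha>) \<partial>lborel)"
  proof (rule nn_integral_mono_AE)
    show "AE x in lborel. ennreal Y * indicator (ball 0 (sqrt d)) x \<le> ennreal ((exp (\<beta> * (log_bump c d x)\<^sup>2) - 1) / norm x powr \<alpha>)"
      using AE_lborel_singleton[of 0]
    proof eventually_elim
      case (elim x)
      show ?case
      proof (cases "norm x < sqrt d")
        case True
        define s where "s = (norm x)\<^sup>2"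
        have s: "0 \<le> s" "s \<le> d" using True d by (auto simp: s_def real_less_rsqrt less_imp_le) (metis norm_ge_zero real_sqrt_le_iff real_sqrt_pow2 power_mono less_imp_le)
        have "ln (s + d) \<le> ln (2 * d)" using s d by simp
        also have "ln (2 * d) = - (ln (1 / d) - ln 2)" using d by (simp add: ln_mult ln_div)
        finally have "ln (1 / d) - ln 2 \<le> - ln (s + d)" by simp
        \<comment> \<open>Here d < 1/2 enters: the lower bound must be nonnegative before it is
          squared.\<close>
        moreover have "0 \<le> ln (1 / d) - ln 2" using d by (simp add: ln_div[symmetric] field_simps)
        ultimately have "(ln (1 / d) - ln 2)\<^sup>2 \<le> (- ln (s + d))\<^sup>2" by (intro power_mono) auto
        moreover have "r\<^sup>2 \<le> (cutoff s)\<^sup>2" using r s by (intro power_mono) auto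
        ultimately have "c\<^sup>2 * r\<^sup>2 * (ln (1 / d) - ln 2)\<^sup>2 \<le> c\<^sup>2 * (cutoff s)\<^sup>2 * (- ln (s + d))\<^sup>2"
          by (intro mult_mono) auto
        also have "\<dots> = (log_bump c d x)\<^sup>2" unfolding log_bump_def s_def by (simp add: power_mult_distrib)
        finally have "\<beta> * (c\<^sup>2 * r\<^sup>2 * (ln (1 / d) - ln 2)\<^sup>2) \<le> \<beta> * (log_bump c d x)\<^sup>2" using \<beta> by (rule mult_left_mono)
        then have 1: "exp (\<beta> * (c\<^sup>2 * r\<^sup>2 * (ln (1 / d) - ln 2)\<^sup>2)) - 1 \<le> exp (\<beta> * (log_bump c d x)\<^sup>2) - 1" by simp
        have "norm x powr \<alpha> \<le> sqrt d powr \<alpha>" using True \<alpha> by (intro powr_mono2) auto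
        also have "\<dots> = d powr (\<alpha> / 2)" using d by (simp add: powr_half_sqrt[symmetric] powr_powr)
        finally have 2: "norm x powr \<alpha> \<le> d powr (\<alpha> / 2)" .
        have "Y \<le> (exp (\<beta> * (log_bump c d x)\<^sup>2) - 1) / norm x powr \<alpha>"
          unfolding Y_def using 1 2 elim \<beta> by (intro frac_le) auto
        then show ?thesis using True by (simp add: ennreal_leI)
      qed simp
    qed
  qed
  also have "\<dots> = adams_integral \<alpha> \<beta> (log_bump c d)"
    unfolding adams_integral_def by (rule nn_integral_completion[symmetric])
  also have "ennreal Y * emeasure lborel (ball 0 (sqrt d) :: (real^4) set) = ennreal (Y * (pi\<^sup>2 / 2 * d\<^sup>2))"
  proof -
    have "emeasure lborel (ball 0 (sqrt d) :: (real^4) set) = ennreal (pi\<^sup>2 / 2 * d\<^sup>2)"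
      using d by (simp add: emeasure_ball unit_ball_vol_4 power4_eq_xxxx power2_eq_square mult.assoc)
    then show ?thesis using Y0 by (simp only: ennreal_mult[symmetric] zero_le_power2 divide_nonneg_nonneg mult_nonneg_nonneg zero_le_numeral)
  qed
  also have "Y * (pi\<^sup>2 / 2 * d\<^sup>2) = (exp (\<beta> * (c\<^sup>2 * r\<^sup>2 * (ln (1 / d) - ln 2)\<^sup>2)) - 1) * (pi\<^sup>2 / 2 * d powr (2 - \<alpha> / 2))"
    unfolding Y_def using d by (simp add: powr_diff)
  finally show ?thesis .
qed

text \<open>With t = ln(1/d) and c^2 about 1/(16 pi^2 t) the exponent grows like a t, whereas volume
  and weight together cost exp(-2\<theta>t). Up to the margin \<kappa>, the condition a > 2\<theta>
  is \<beta> > \<open>beta_crit \<alpha>\<close>.\<close>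

lemma adams_integral_unbounded:
  fixes \<alpha> \<tau> \<sigma> \<beta> Y :: real
  assumes \<alpha>: "0 \<le> \<alpha>" "\<alpha> < 4" and \<tau>: "\<tau> > 0" and \<sigma>: "\<sigma> > 0" and \<beta>: "\<beta> > beta_crit \<alpha>"
  obtains u :: "real^4 \<Rightarrow> real" where "u \<in> sobolev 2 2" "adams_energy \<tau> \<sigma> u \<le> 1" "ennreal Y \<le> adams_integral \<alpha> \<beta> u"
proof -
  define \<theta> where "\<theta> = 1 - \<alpha> / 4"
  have \<theta>: "\<theta> > 0" using \<alpha> by (simp add: \<theta>_def)
  have crit: "beta_crit \<alpha> = \<theta> * (32 * pi\<^sup>2)" by (simp add: beta_crit_def \<theta>_def)
  have cp: "beta_crit \<alpha> > 0" unfolding crit using \<theta> by simp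
  have \<beta>0: "\<beta> > 0" using \<beta> cp by linarith
  define R where "R = \<beta> / beta_crit \<alpha>"
  have R: "R > 1" using \<beta> cp by (simp add: R_def)
  \<comment> \<open>Chosen so that \<kappa>(2R + 1) is half of R - 1. This leaves room for both
    losses, the energy factor 1 + \<kappa> and the cutoff factor (1 - \<kappa>)^2.\<close>
  define \<kappa> where "\<kappa> = (R - 1) / (2 * (2 * R + 1))"
  have \<kappa>: "\<kappa> > 0" "\<kappa> < 1" using R by (auto simp: \<kappa>_def divide_simps)
  have gain: "R * (1 - \<kappa>)\<^sup>2 > 1 + \<kappa>"
  proof -
    have "\<kappa> * (2 * R + 1) = (R - 1) / 2" using R by (simp add: \<kappa>_def divide_simps)
    then have "1 + \<kappa> < R - 2 * (R * \<kappa>)" using R by (simp add: algebra_simps)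
    also have "\<dots> \<le> R * (1 - \<kappa>)\<^sup>2" using R by (simp add: power2_eq_square algebra_simps)
    finally show ?thesis .
  qed
  obtain K where K: "K > 0" and energy: "\<And>c d. 0 < d \<Longrightarrow> d < 1 \<Longrightarrow>
    adams_energy \<tau> \<sigma> (log_bump c d) \<le> ennreal (c\<^sup>2 * ((1 + \<kappa>) * 16 * pi\<^sup>2 * ln (1 / d) + K))"
    using log_bump_energy[OF \<tau> \<sigma> \<kappa>(1)] by blast
  define M where "M = (1 + \<kappa>) * 16 * pi\<^sup>2"
  have M: "M > 0" using \<kappa> by (simp add: M_def)
  define a where "a = \<beta> * (1 - \<kappa>)\<^sup>2 / M"
  have a2: "a > 2 * \<theta>"
  proof -
    have "\<beta> = R * beta_crit \<alpha>" using cp by (simp add: R_def)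
    then have "\<beta> = R * (\<theta> * (32 * pi\<^sup>2))" by (simp only: crit)
    then have "a = 2 * \<theta> * (R * (1 - \<kappa>)\<^sup>2 / (1 + \<kappa>))" 
    proof -
      have "R * (\<theta> * (32 * p)) * x / (w * 16 * p) = 2 * \<theta> * (R * x / w)" if "p > 0" "w > 0" for p x w
        using that by (simp add: field_simps)
      from this[of "pi\<^sup>2" "1 + \<kappa>" "(1 - \<kappa>)\<^sup>2"] \<open>\<beta> = R * (\<theta> * (32 * pi\<^sup>2))\<close> show ?thesis
        using \<kappa> by (simp add: a_def M_def)
    qed
    moreover have "R * (1 - \<kappa>)\<^sup>2 / (1 + \<kappa>) > 1" using gain \<kappa> by simp
    ultimately show ?thesis using \<theta> by (metis mult_1_right mult_strict_left_mono zero_less_mult_iff zero_less_numeral)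
  qed
  define k where "k = K / M"
  \<comment> \<open>The exponent will be at least a t - b: here 2 ln 2 stems from the shift of the
    logarithm and k from the constant in the energy.\<close>
  define b where "b = a * (2 * ln 2 + k)"
  have "isCont cutoff 0" using cutoff_has_derivative by (rule DERIV_isCont)
  then have "\<exists>d0>0. \<forall>s. dist s 0 < d0 \<longrightarrow> dist (cutoff s) (cutoff 0) < \<kappa>"
    using \<kappa>(1) unfolding continuous_at_eps_delta by blast
  then obtain d0 where d0: "d0 > 0" "\<And>s. \<bar>s\<bar> < d0 \<Longrightarrow> \<bar>cutoff s - 1\<bar> < \<kappa>"
    by (auto simp: dist_real_def)
  \<comment> \<open>Three demands on t: d < 1/2, d < \<open>d0\<close>, and a gain (a - 2\<theta>)t
    - b of at least 2|Y|/pi^2.\<close>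
  define t where "t = max (max 1 (ln (1 / d0) + 1)) ((2 * \<bar>Y\<bar> / pi\<^sup>2 + b) / (a - 2 * \<theta>))"
  have t1: "t \<ge> 1" by (simp add: t_def)
  have t2: "t > ln (1 / d0)" by (simp add: t_def less_max_iff_disj)
  have t3: "(a - 2 * \<theta>) * t - b \<ge> 2 * \<bar>Y\<bar> / pi\<^sup>2"
  proof -
    have "(2 * \<bar>Y\<bar> / pi\<^sup>2 + b) / (a - 2 * \<theta>) \<le> t" by (simp add: t_def)
    then have "2 * \<bar>Y\<bar> / pi\<^sup>2 + b \<le> t * (a - 2 * \<theta>)" using a2 by (subst (asm) pos_divide_le_eq) auto
    then show ?thesis by (simp add: mult.commute[of t] del: divide_le_eq)
  qed
  define d where "d = exp (- t)"
  have d: "0 < d" by (simp add: d_def)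
  have d1: "d < 1 / 2"
  proof -
    have "ln 2 < (1::real)" using ln_2_less_1 .
    then have "exp (- t) < exp (- ln 2)" using t1 by simp
    then show ?thesis by (simp add: d_def exp_minus)
  qed
  have d2: "d < d0"
  proof -
    have "exp (- t) < exp (- ln (1 / d0))" using t2 by simp
    then show ?thesis using d0(1) by (simp add: d_def exp_minus)
  qed
  have lnd: "ln (1 / d) = t" by (simp add: d_def ln_div)
  define c where "c = 1 / sqrt (M * t + K)"
  have MK: "M * t + K > 0" using M K t1 by (intro add_pos_pos mult_pos_pos) auto
  have c: "c\<^sup>2 = 1 / (M * t + K)" using MK by (simp add: c_def power_divide)
  have e1: "adams_energy \<tau> \<sigma> (log_bump c d) \<le> 1"
    using energy[OF d, of c] d1 MK unfolding lnd c M_def[symmetric] by simp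
  have low: "1 - \<kappa> \<le> cutoff s" if "0 \<le> s" "s \<le> d" for s
    using d0(2)[of s] d2 that by (simp add: abs_if split: if_splits)
  define X where "X = \<beta> * (c\<^sup>2 * (1 - \<kappa>)\<^sup>2 * (t - ln 2)\<^sup>2)"
  have X: "X \<ge> a * t - b"
  proof -
    have tk: "t + k > 0" using t1 K M by (auto simp: k_def intro!: add_pos_pos)
    have Xa: "X = a * ((t - ln 2)\<^sup>2 / (t + k))"
    proof -
      have "M * t + K = M * (t + k)" using M by (simp add: k_def distrib_left)
      then show ?thesis unfolding X_def c a_def by simp
    qed
    have le: "(t - ln 2)\<^sup>2 / (t + k) \<ge> t - 2 * ln 2 - k"
    proof -
      \<comment> \<open>After multiplication by t + k the two sides of the claim differ exactly by
        the square (ln 2 + k)^2.\<close>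
      have "(t - 2 * ln 2 - k) * (t + k) + (ln 2 + k)\<^sup>2 = (t - ln 2)\<^sup>2"
        by (simp add: power2_eq_square algebra_simps)
      then have "(t - 2 * ln 2 - k) * (t + k) \<le> (t - ln 2)\<^sup>2"
        by (metis le_add_same_cancel1 zero_le_power2)
      then show ?thesis using tk by (simp add: pos_le_divide_eq)
    qed
    have "X \<ge> a * (t - 2 * ln 2 - k)"
      unfolding Xa by (rule mult_left_mono[OF le]) (use a2 \<theta> in simp)
    then show ?thesis by (simp add: b_def algebra_simps)
  qed
  have "\<bar>Y\<bar> \<le> (exp X - 1) * (pi\<^sup>2 / 2 * d powr (2 - \<alpha> / 2))"
  proof -
    have dp: "d powr (2 - \<alpha> / 2) = exp (- (2 * \<theta> * t))"
      by (simp add: d_def powr_def \<theta>_def algebra_simps)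
    define E where "E = exp (- (2 * \<theta> * t))"
    have "exp X * E = exp (X - 2 * \<theta> * t)" by (simp add: E_def exp_diff exp_minus divide_inverse)
    then have 1: "(exp X - 1) * E = exp (X - 2 * \<theta> * t) - E" by (simp only: left_diff_distrib mult_1)
    have 2: "1 + (X - 2 * \<theta> * t) \<le> exp (X - 2 * \<theta> * t)" by (rule exp_ge_add_one_self)
    have "(a - 2 * \<theta>) * t - b = (a * t - b) - 2 * \<theta> * t" by (simp add: left_diff_distrib)
    then have 3: "2 * \<bar>Y\<bar> / pi\<^sup>2 \<le> X - 2 * \<theta> * t" using X t3 by linarith
    have 4: "E \<le> 1" using \<theta> t1 by (simp add: E_def)
    have "2 * \<bar>Y\<bar> / pi\<^sup>2 \<le> (exp X - 1) * exp (- (2 * \<theta> * t))"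
      unfolding E_def[symmetric] 1 using 2 3 4 by linarith
    then have "pi\<^sup>2 / 2 * (2 * \<bar>Y\<bar> / pi\<^sup>2) \<le> pi\<^sup>2 / 2 * ((exp X - 1) * exp (- (2 * \<theta> * t)))"
      by (intro mult_left_mono) auto
    then show ?thesis unfolding dp by (simp add: mult_ac)
  qed
  then have "ennreal Y \<le> ennreal ((exp X - 1) * (pi\<^sup>2 / 2 * d powr (2 - \<alpha> / 2)))"
    by (intro ennreal_leI) linarith
  also have "\<dots> \<le> adams_integral \<alpha> \<beta> (log_bump c d)"
    using adams_integral_log_bump_ge[OF \<alpha>(1) d d1 _ _ low, of \<beta> c] \<beta>0 \<kappa> unfolding X_def lnd by simp
  finally show ?thesis using that test_function_sobolev[OF test_function_log_bump[OF d]] e1 by blast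
qed

theorem theorem1p4:
  fixes \<alpha> \<tau> \<sigma> :: real
  assumes "0 \<le> \<alpha>" and "\<alpha> < 4" and "\<tau> > 0" and "\<sigma> > 0"
  shows "(\<forall>\<beta>. 0 \<le> \<beta> \<and> \<beta> \<le> beta_crit \<alpha> \<longrightarrow>
            (SUP u \<in> {u \<in> (sobolev 2 2 :: (real^4 \<Rightarrow> real) set). adams_energy \<tau> \<sigma> u \<le> 1}.
               adams_integral \<alpha> \<beta> u) < \<infinity>)
       \<and> (\<forall>\<beta>. \<beta> > beta_crit \<alpha> \<longrightarrow>
            (SUP u \<in> {u \<in> (sobolev 2 2 :: (real^4 \<Rightarrow> real) set). adams_energy \<tau> \<sigma> u \<le> 1}.
               adams_integral \<alpha> \<beta> u) = \<infinity>)"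
proof (intro conjI allI impI)
  \<comment> \<open>The integral increases with \<beta>, so the bound at the critical exponent
    covers all smaller ones.\<close>
  fix \<beta> assume \<beta>: "0 \<le> \<beta> \<and> \<beta> \<le> beta_crit \<alpha>"
  obtain K :: real where K: "\<And>u :: real^4 \<Rightarrow> real. u \<in> sobolev 2 2 \<Longrightarrow> adams_energy \<tau> \<sigma> u \<le> 1 \<Longrightarrow>
    adams_integral \<alpha> (beta_crit \<alpha>) u \<le> ennreal K"
    using adams_integral_bounded[OF assms] by blast
  have "(SUP u \<in> {u \<in> (sobolev 2 2 :: (real^4 \<Rightarrow> real) set). adams_energy \<tau> \<sigma> u \<le> 1}. adams_integral \<alpha> \<beta> u) \<le> ennreal K"
  proof (rule SUP_least)
    fix u :: "real^4 \<Rightarrow> real" assume "u \<in> {u \<in> sobolev 2 2. adams_energy \<tau> \<sigma> u \<le> 1}"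
    then have "adams_integral \<alpha> (beta_crit \<alpha>) u \<le> ennreal K" using K by blast
    then show "adams_integral \<alpha> \<beta> u \<le> ennreal K"
      using adams_integral_mono[of \<beta> "beta_crit \<alpha>" \<alpha> u] \<beta> by (meson order_trans)
  qed
  then show "(SUP u \<in> {u \<in> (sobolev 2 2 :: (real^4 \<Rightarrow> real) set). adams_energy \<tau> \<sigma> u \<le> 1}. adams_integral \<alpha> \<beta> u) < \<infinity>"
    by (rule le_less_trans) simp
next
  fix \<beta> assume \<beta>: "\<beta> > beta_crit \<alpha>"
  let ?S = "SUP u \<in> {u \<in> (sobolev 2 2 :: (real^4 \<Rightarrow> real) set). adams_energy \<tau> \<sigma> u \<le> 1}. adams_integral \<alpha> \<beta> u"
  have S: "ennreal Y \<le> ?S" for Y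
  proof -
    obtain u :: "real^4 \<Rightarrow> real" where "u \<in> sobolev 2 2" "adams_energy \<tau> \<sigma> u \<le> 1" "ennreal Y \<le> adams_integral \<alpha> \<beta> u"
      by (rule adams_integral_unbounded[OF assms \<beta>])
    then show ?thesis by (intro SUP_upper2[of u]) auto
  qed
  show "?S = \<infinity>"
  proof (rule ccontr)
    assume "?S \<noteq> \<infinity>"
    then obtain r where r: "0 \<le> r" "?S = ennreal r" by (cases ?S) auto
    then show False using S[of "r + 1"] by simp
  qed
qed

end
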